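(* There is an algorithm that, given a deMorgan formula $F$ of size $s$ over $n$ variables, computes two polygonal curves $P,Q$ in the plane $\mathbb{R}^2$ (with rational vertex coordinates), each with $N = O(2^{n/2}\cdot s)$ vertices, such that the discrete Fr\'echet distance satisfies $d_F(P,Q) \le 1$ if and only if $F$ is satisfiable. The algorithm runs in time $O(N)$.
   Context: A deMorgan formula over variables $z_1,\dots,z_n$ is a rooted tree whose leaves are labelled by variables or their negations and whose internal gates are AND or OR gates; its size is the number of leaves. A curve is a sequence $P=(p_1,\dots,p_n)$ of points in $\mathbb{R}^2$. For curves $P=(p_1,\dots,p_n)$, $Q=(q_1,\dots,q_m)$, a traversal is a pair of monotone non-decreasing onto maps $\phi:\{1,\dots,n+m\}\to\{1,\dots,n\}$, $\psi:\{1,\dots,n+m\}\to\{1,\dots,m\}$; it stays in distance $\delta$ if $\|p_{\phi(t)}-q_{\psi(t)}\|_2\le\delta$ for all $t$. The discrete Fr\'echet distance $d_F(P,Q)$ is the minimal $\delta$ such that some traversal stays in distance $\delta$. *)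

theory Defs
  imports "HOL-Analysis.Analysis"
begin

section \<open>deMorgan formulas\<close>

datatype formula =
    Lit bool nat  \<comment> \<open>\<open>Lit True i\<close> is the leaf \<open>z\<^sub>i\<close>, \<open>Lit False i\<close> is its negation\<close>
  | And "formula list"
  | Or "formula list"

fun eval :: "(nat \<Rightarrow> bool) \<Rightarrow> formula \<Rightarrow> bool" where
  "eval \<alpha> (Lit b i) = (\<alpha> i = b)"
| "eval \<alpha> (And Fs) = (\<forall>F\<in>set Fs. eval \<alpha> F)"
| "eval \<alpha> (Or Fs) = (\<exists>F\<in>set Fs. eval \<alpha> F)"

definition satisfiable :: "formula \<Rightarrow> bool" where
  "satisfiable F \<longleftrightarrow> (\<exists>\<alpha>. eval \<alpha> F)"

fun leaves :: "formula \<Rightarrow> nat" where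
  "leaves (Lit b i) = 1"
| "leaves (And Fs) = sum_list (map leaves Fs)"
| "leaves (Or Fs) = sum_list (map leaves Fs)"

text \<open>Every gate has fan-in at least two. Without this, the number of leaves would not
  bound the number of gates.\<close>

fun formula_over :: "nat \<Rightarrow> formula \<Rightarrow> bool" where
  "formula_over n (Lit b i) \<longleftrightarrow> 1 \<le> i \<and> i \<le> n"
| "formula_over n (And Fs) \<longleftrightarrow> 2 \<le> length Fs \<and> (\<forall>F\<in>set Fs. formula_over n F)"
| "formula_over n (Or Fs) \<longleftrightarrow> 2 \<le> length Fs \<and> (\<forall>F\<in>set Fs. formula_over n F)"


section \<open>Curves and the discrete Frechet distance\<close>

type_synonym curve = "(real \<times> real) list"

definition traversal :: "nat \<Rightarrow> nat \<Rightarrow> (nat \<Rightarrow> nat) \<Rightarrow> (nat \<Rightarrow> nat) \<Rightarrow> bool" where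
  "traversal n m \<phi> \<psi> \<longleftrightarrow>
     mono_on {1..n+m} \<phi> \<and> \<phi> ` {1..n+m} = {1..n} \<and>
     mono_on {1..n+m} \<psi> \<and> \<psi> ` {1..n+m} = {1..m}"

text \<open>List indices start at 0, hence the shift by one. The norm on \<open>real \<times> real\<close> is the
  Euclidean norm.\<close>

definition stays_within :: "curve \<Rightarrow> curve \<Rightarrow> (nat \<Rightarrow> nat) \<Rightarrow> (nat \<Rightarrow> nat) \<Rightarrow> real \<Rightarrow> bool" where
  "stays_within P Q \<phi> \<psi> \<delta> \<longleftrightarrow>
     (\<forall>t\<in>{1..length P + length Q}. norm (P ! (\<phi> t - 1) - Q ! (\<psi> t - 1)) \<le> \<delta>)"

definition frechet_dist :: "curve \<Rightarrow> curve \<Rightarrow> real" where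
  "frechet_dist P Q =
     (LEAST \<delta>. \<exists>\<phi> \<psi>. traversal (length P) (length Q) \<phi> \<psi> \<and> stays_within P Q \<phi> \<psi> \<delta>)"


section \<open>Word RAM\<close>

text \<open>A structured word RAM with words of \<open>w\<close> bits. Each program mentions only a fixed finite
  set of registers; the memory is addressed indirectly. Every instruction and every test costs one
  time unit, and arithmetic is modulo \<open>2 ^ w\<close>.\<close>

datatype arith = Add | Sub | Mul | Div

datatype instr =
    Const nat nat            \<comment> \<open>\<open>r := k\<close>\<close>
  | Arith arith nat nat nat  \<comment> \<open>\<open>r := r1 op r2\<close>\<close>
  | Load nat nat             \<comment> \<open>\<open>r := mem[r1]\<close>\<close>
  | Store nat nat            \<comment> \<open>\<open>mem[r] := r1\<close>\<close>

datatype program =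
    Instr instr
  | Seq program program
  | IfLess nat nat program program
  | WhileLess nat nat program

type_synonym state = "(nat \<Rightarrow> nat) \<times> (nat \<Rightarrow> nat)"  \<comment> \<open>registers, memory\<close>

fun arith_op :: "nat \<Rightarrow> arith \<Rightarrow> nat \<Rightarrow> nat \<Rightarrow> nat" where
  "arith_op w Add x y = (x + y) mod 2 ^ w"
| "arith_op w Sub x y = nat ((int x - int y) mod 2 ^ w)"
| "arith_op w Mul x y = (x * y) mod 2 ^ w"
| "arith_op w Div x y = x div y"

fun step :: "nat \<Rightarrow> instr \<Rightarrow> state \<Rightarrow> state" where
  "step w (Const r k) (R, M) = (R(r := k mod 2 ^ w), M)"
| "step w (Arith f r r1 r2) (R, M) = (R(r := arith_op w f (R r1) (R r2)), M)"
| "step w (Load r r1) (R, M) = (R(r := M (R r1)), M)"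
| "step w (Store r r1) (R, M) = (R, M(R r := R r1))"

text \<open>\<open>exec w p \<sigma> t \<sigma>'\<close>: started in \<open>\<sigma>\<close>, the program \<open>p\<close> halts in \<open>\<sigma>'\<close> after exactly \<open>t\<close> time
  units.\<close>

inductive exec :: "nat \<Rightarrow> program \<Rightarrow> state \<Rightarrow> nat \<Rightarrow> state \<Rightarrow> bool" for w :: nat where
  Instr: "exec w (Instr i) \<sigma> 1 (step w i \<sigma>)"
| Seq: "exec w p \<sigma> t \<sigma>' \<Longrightarrow> exec w q \<sigma>' u \<sigma>'' \<Longrightarrow> exec w (Seq p q) \<sigma> (t + u) \<sigma>''"
| IfTrue: "fst \<sigma> r1 < fst \<sigma> r2 \<Longrightarrow> exec w p \<sigma> t \<sigma>' \<Longrightarrow> exec w (IfLess r1 r2 p q) \<sigma> (t + 1) \<sigma>'"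
| IfFalse: "\<not> fst \<sigma> r1 < fst \<sigma> r2 \<Longrightarrow> exec w q \<sigma> t \<sigma>' \<Longrightarrow> exec w (IfLess r1 r2 p q) \<sigma> (t + 1) \<sigma>'"
| WhileTrue: "fst \<sigma> r1 < fst \<sigma> r2 \<Longrightarrow> exec w p \<sigma> t \<sigma>' \<Longrightarrow> exec w (WhileLess r1 r2 p) \<sigma>' u \<sigma>'' \<Longrightarrow>
    exec w (WhileLess r1 r2 p) \<sigma> (t + u + 1) \<sigma>''"
| WhileFalse: "\<not> fst \<sigma> r1 < fst \<sigma> r2 \<Longrightarrow> exec w (WhileLess r1 r2 p) \<sigma> 1 \<sigma>"


section \<open>Input and output format\<close>

text \<open>The tree is written in preorder. Each node takes two words: a tag (0 positive literal,
  1 negative literal, 2 AND, 3 OR), then the variable index or the number of children.\<close>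

fun encode :: "formula \<Rightarrow> nat list" where
  "encode (Lit b i) = [if b then 0 else 1, i]"
| "encode (And Fs) = [2, length Fs] @ concat (map encode Fs)"
| "encode (Or Fs) = [3, length Fs] @ concat (map encode Fs)"

text \<open>Register 0 holds the number of variables, register 1 the length of the encoding, and the
  encoding itself occupies the memory from address 0 on. Everything else is 0. Reducing modulo
  \<open>2 ^ w\<close> makes every entry a word; it changes nothing once \<open>w\<close> is large enough for the input.\<close>

definition input_state :: "nat \<Rightarrow> nat \<Rightarrow> formula \<Rightarrow> state" where
  "input_state w n F =
     ((\<lambda>_. 0)(0 := n mod 2 ^ w, 1 := length (encode F) mod 2 ^ w),
      (\<lambda>a. if a < length (encode F) then (encode F ! a) mod 2 ^ w else 0))"

definition signed :: "nat \<Rightarrow> nat \<Rightarrow> int" where  \<comment> \<open>two's complement\<close>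
  "signed w x = (if 2 * x < 2 ^ w then int x else int x - 2 ^ w)"

text \<open>A curve is stored as an array with four words per vertex: signed numerator and unsigned
  nonzero denominator of the first coordinate, then the same for the second.\<close>

definition stored_curve :: "nat \<Rightarrow> (nat \<Rightarrow> nat) \<Rightarrow> nat \<Rightarrow> curve \<Rightarrow> bool" where
  "stored_curve w M a P \<longleftrightarrow>
     (\<forall>i<length P. M (a + 4*i + 1) \<noteq> 0 \<and> M (a + 4*i + 3) \<noteq> 0 \<and>
        P ! i = (real_of_int (signed w (M (a + 4*i))) / real (M (a + 4*i + 1)),
                 real_of_int (signed w (M (a + 4*i + 2))) / real (M (a + 4*i + 3))))"

text \<open>Output convention: registers 0 and 1 hold the addresses of \<open>P\<close> and \<open>Q\<close>, register 2 holds
  their common number of vertices.\<close>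

definition output_curves :: "nat \<Rightarrow> state \<Rightarrow> curve \<Rightarrow> curve \<Rightarrow> bool" where
  "output_curves w \<sigma> P Q \<longleftrightarrow>
     length P = fst \<sigma> 2 \<and> length Q = fst \<sigma> 2 \<and>
     stored_curve w (snd \<sigma>) (fst \<sigma> 0) P \<and> stored_curve w (snd \<sigma>) (fst \<sigma> 1) Q"

text \<open>\<open>computes_curves K p n F P Q T\<close>: on words of any length \<open>w \<ge> K * (1 + log N)\<close>, where \<open>N\<close> is the
  number of vertices, the program \<open>p\<close> outputs \<open>P\<close> and \<open>Q\<close> on input \<open>(n, F)\<close> within time \<open>T\<close>.\<close>

definition computes_curves ::
    "real \<Rightarrow> program \<Rightarrow> nat \<Rightarrow> formula \<Rightarrow> curve \<Rightarrow> curve \<Rightarrow> real \<Rightarrow> bool" where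
  "computes_curves K p n F P Q T \<longleftrightarrow>
     (\<forall>w. real w \<ge> K * (1 + log 2 (real (length P))) \<longrightarrow>
        (\<exists>t \<sigma>. exec w p (input_state w n F) t \<sigma> \<and> real t \<le> T \<and> output_curves w \<sigma> P Q))"

end

theory Submission
  imports Defs
begin

text \<open>The vertices of both curves stand for intervals of integers. They are realised by points near
  \<open>(0, 0)\<close> for \<open>P\<close> and near \<open>(0, 1)\<close> for \<open>Q\<close>, with the centre of the interval as first coordinate and its
  squared radius as offset in the second, up to scaling, so that nested intervals are within
  distance 1 and disjoint ones are not. Hence every node of the formula can own a range of integers, and
      vertices of unrelated
  nodes never match.

  For fixed assignments to the two halves of the variables, a literal is one vertex on either curve,
  with equal intervals exactly if the literal holds, and an AND gate is concatenation. For an OR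
  gate, \<open>P\<close> consists of blocks \<open>t s P\<^sub>i\<close> and \<open>Q\<close> of blocks \<open>d d Q\<^sub>j\<close> enclosed by \<open>a v\<close> and \<open>v' a\<close>. As
  \<open>a\<close> matches everything inside, \<open>P\<close> can advance to any \<open>s\<close>; only \<open>s\<close> matches \<open>v\<close>, so \<open>Q\<close> starts its
  blocks while \<open>P\<close> waits at some \<open>s\<close>; only \<open>t\<close> matches \<open>v'\<close>, so in between some \<open>P\<^sub>i\<close> must be traversed
  together with some \<open>Q\<^sub>j\<close>. The same gadget, with one block for each partial assignment, expresses
  satisfiability.

  All these blocks are copies of one template, up to the shifts of the literals. The program computes
  the template from the preorder encoding with an explicit stack, and then copies it once per block
  number, whose bits determine the shifts. The range of an OR gate is unknown when the gate is
  opened, so its vertices refer to memory slots that are filled in when the gate is closed.\<close>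

section \<open>Traversals of abstract curves\<close>

text \<open>The plane offers room for arbitrarily many independent nodes because only second-order
  terms count. Next to a pair of points at distance 1, a horizontal move of order \<open>1/M\<close>
  changes the squared distance by order \<open>1/M^2\<close>, and a vertical offset of that order
  can compensate it. Hence the unit distance tests the sign of an integer quadratic form in the end
  points of two intervals, with denominators polynomial in the length of the template, and words of
  \<open>O(log N)\<close> bits suffice. "Traversable iff true" is too weak for an induction over the
  formula, since a traversal could enter or leave a gadget in its middle. The invariant therefore
  also says that the first and last vertex of \<open>P\<close> match nothing of \<open>Q\<close>
  except possibly its first and last vertex. A literal tests the parity of the sum of a bit of the
  \<open>P\<close> block number and a bit of the \<open>Q\<close> block number. So the induction
  works for arbitrary pairs of numbers, and the split of the variables into halves enters only at
  the root. The program has no nested loops: each round of each loop has constant cost, so the time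
  bound reduces to counting rounds.\<close>

inductive trav :: "('a \<Rightarrow> 'b \<Rightarrow> bool) \<Rightarrow> 'a list \<Rightarrow> 'b list \<Rightarrow> bool" for m where
  single: "m x y \<Longrightarrow> trav m [x] [y]"
| row: "m x y \<Longrightarrow> trav m xs (y # ys) \<Longrightarrow> trav m (x # xs) (y # ys)"
| col: "m x y \<Longrightarrow> trav m (x # xs) ys \<Longrightarrow> trav m (x # xs) (y # ys)"
| diag: "m x y \<Longrightarrow> trav m xs ys \<Longrightarrow> trav m (x # xs) (y # ys)"

lemma trav_nonempty: "trav m xs ys \<Longrightarrow> xs \<noteq> [] \<and> ys \<noteq> []"
  by (induction rule: trav.induct) auto

lemma trav_swap: "trav m xs ys \<Longrightarrow> trav (\<lambda>y x. m x y) ys xs"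
proof (induction rule: trav.induct)
  case (single x y)
  then show ?case by (simp add: trav.single)
next
  case (row x y xs ys)
  then show ?case using trav.col[of "\<lambda>y x. m x y" y x ys xs] by simp
next
  case (col x y xs ys)
  then show ?case using trav.row[of "\<lambda>y x. m x y" y x ys xs] by simp
next
  case (diag x y xs ys)
  then show ?case using trav.diag[of "\<lambda>y x. m x y" y x ys xs] by simp
qed

lemma trav_append:
  "trav m xs ys \<Longrightarrow> trav m xs' ys' \<Longrightarrow> trav m (xs @ xs') (ys @ ys')"
  by (induction rule: trav.induct) (auto intro: trav.intros)

lemma trav_Cons_match: "trav m (x # xs) (y # ys) \<Longrightarrow> m x y"
  by (erule trav.cases) auto

text \<open>A traversal cannot jump over a row, so it can be cut at a pair in that row, and the pair
  belongs to both pieces. The soundness proofs take traversals apart by this cut and its mirror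
  image for columns.\<close>

lemma trav_row_split:
  "trav m (xs @ x # xs') ys \<Longrightarrow>
    \<exists>us y vs. ys = us @ y # vs \<and> trav m (xs @ [x]) (us @ [y]) \<and> trav m (x # xs') (y # vs)"
proof (induction "xs @ x # xs'" ys arbitrary: xs rule: trav.induct)
  case (single x1 y1)
  then have "xs = []" "x = x1" "xs' = []" by (auto simp: Cons_eq_append_conv)
  then show ?case using single
    by (intro exI[of _ "[]"] exI[of _ y1]) (auto intro: trav.intros)
next
  case (row x1 y1 zs ys)
  show ?case
  proof (cases xs)
    case Nil
    with row.hyps(2,4) row.hyps(1) show ?thesis
      by (intro exI[of _ "[]"] exI[of _ y1] exI[of _ ys]) (auto intro: trav.intros)
  next
    case (Cons a bs)
    with row.hyps have "zs = bs @ x # xs'" "x1 = a" by auto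
    from row.hyps(3)[OF this(1)] obtain us y vs where
      *: "y1 # ys = us @ y # vs" "trav m (bs @ [x]) (us @ [y])" "trav m (x # xs') (y # vs)"
      by blast
    have "trav m (x1 # bs @ [x]) (us @ [y])"
      using * row.hyps(1) by (cases us) (auto intro: trav.intros)
    with * Cons \<open>x1 = a\<close> show ?thesis by auto
  qed
next
  case (col x1 y1 zs ys)
  from col.hyps(3)[OF col.hyps(4)] obtain us y vs where
    *: "ys = us @ y # vs" "trav m (xs @ [x]) (us @ [y])" "trav m (x # xs') (y # vs)"
    by blast
  have "trav m (xs @ [x]) (y1 # us @ [y])"
    using *(2) col.hyps(1,4) by (cases xs) (auto intro: trav.intros)
  with * show ?case by (intro exI[of _ "y1 # us"]) auto
next
  case (diag x1 y1 zs ys)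
  show ?case
  proof (cases xs)
    case Nil
    with diag.hyps show ?thesis
      by (intro exI[of _ "[]"] exI[of _ y1] exI[of _ ys]) (auto intro: trav.intros)
  next
    case (Cons a bs)
    with diag.hyps have "zs = bs @ x # xs'" "x1 = a" by auto
    from diag.hyps(3)[OF this(1)] obtain us y vs where
      *: "ys = us @ y # vs" "trav m (bs @ [x]) (us @ [y])" "trav m (x # xs') (y # vs)"
      by blast
    have "trav m (x1 # bs @ [x]) (y1 # us @ [y])"
      using * diag.hyps(1) by (auto intro: trav.intros)
    with * Cons \<open>x1 = a\<close> show ?thesis by (intro exI[of _ "y1 # us"]) auto
  qed
qed

lemma trav_col_split:
  assumes "trav m xs (ys @ y # ys')"
  shows "\<exists>us x vs. xs = us @ x # vs \<and> trav m (us @ [x]) (ys @ [y]) \<and> trav m (x # vs) (y # ys')"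
proof -
  obtain us x vs where "xs = us @ x # vs" "trav (\<lambda>y x. m x y) (ys @ [y]) (us @ [x])"
    "trav (\<lambda>y x. m x y) (y # ys') (x # vs)"
    using trav_row_split[OF trav_swap[OF assms]] by blast
  then show ?thesis using trav_swap[of "\<lambda>y x. m x y"] by blast
qed

lemma trav_col_matched: "trav m xs ys \<Longrightarrow> y \<in> set ys \<Longrightarrow> \<exists>x\<in>set xs. m x y"
  by (induction rule: trav.induct) auto

lemma trav_last_match: "trav m xs ys \<Longrightarrow> m (last xs) (last ys)"
  by (induction rule: trav.induct) (auto dest: trav_nonempty)

lemma trav_hd_match: "trav m xs ys \<Longrightarrow> m (hd xs) (hd ys)"
  by (induction rule: trav.induct) auto

lemma trav_singleton_row: "ys \<noteq> [] \<Longrightarrow> \<forall>y\<in>set ys. m x y \<Longrightarrow> trav m [x] ys"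
  by (induction ys rule: list_nonempty_induct) (auto intro: trav.intros)

lemma trav_singleton_col: "xs \<noteq> [] \<Longrightarrow> \<forall>x\<in>set xs. m x y \<Longrightarrow> trav m xs [y]"
  by (induction xs rule: list_nonempty_induct) (auto intro: trav.intros)

text \<open>The hypotheses force every traversal through two pairs: \<open>last xs\<close> can be
  visited only with \<open>last ys\<close>, and \<open>hd xs'\<close> only with
  \<open>hd ys'\<close>. This is the AND gate.\<close>

lemma trav_append_iff:
  assumes ne: "xs \<noteq> []" "xs' \<noteq> []" "ys \<noteq> []" "ys' \<noteq> []"
    and last: "\<forall>y\<in>set (butlast ys) \<union> set ys'. \<not> m (last xs) y"
    and hd: "\<forall>y\<in>set ys \<union> set (tl ys'). \<not> m (hd xs') y"
  shows "trav m (xs @ xs') (ys @ ys') \<longleftrightarrow> trav m xs ys \<and> trav m xs' ys'"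
proof
  assume "trav m (xs @ xs') (ys @ ys')"
  moreover have "xs @ xs' = butlast xs @ last xs # xs'" using ne by simp
  ultimately obtain us y vs where 1: "ys @ ys' = us @ y # vs"
    "trav m (butlast xs @ [last xs]) (us @ [y])" "trav m (last xs # xs') (y # vs)"
    using trav_row_split by metis
  have my: "m (last xs) y" using trav_Cons_match 1(3) by fast
  have ysl: "ys = butlast ys @ [last ys]" using ne by simp
  \<comment> \<open>The value \<open>y\<close> occurs neither in \<open>butlast ys\<close> nor in
    \<open>ys'\<close>, which pins the cut to the end of \<open>ys\<close>.\<close>
  have "us @ [y] = ys \<and> vs = ys'"
  proof -
    have "butlast ys @ last ys # ys' = us @ y # vs" using 1(1) ysl ne by (metis append_Cons append_assoc
        append_Nil)
    moreover have "y \<notin> set (butlast ys)" "y \<notin> set ys'" using my last by auto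
    ultimately have "butlast ys = us \<and> last ys = y \<and> ys' = vs"
      by (auto simp: append_eq_append_conv2 append_eq_Cons_conv Cons_eq_append_conv)
    then show ?thesis using ysl by metis
  qed
  then have 2: "us @ [y] = ys" "vs = ys'" by auto
  have "trav m ([last xs] @ hd xs' # tl xs') (y # ys')" using 1(3) 2 ne by simp
  then obtain us2 y2 vs2 where 3: "y # ys' = us2 @ y2 # vs2" "trav m (hd xs' # tl xs') (y2 # vs2)"
    using trav_row_split by metis
  have my2: "m (hd xs') y2" using trav_Cons_match 3(2) by fast
  have "y \<in> set ys" using 2 by auto
  then have "us2 \<noteq> []" using 3(1) my2 hd by auto
  then obtain us3 where us3: "us2 = y # us3" "ys' = us3 @ y2 # vs2"
    using 3(1) by (cases us2) auto
  have "us3 = []"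
  proof (rule ccontr)
    assume "us3 \<noteq> []"
    then have "y2 \<in> set (tl ys')" using us3 by (cases us3) auto
    then show False using my2 hd by auto
  qed
  then show "trav m xs ys \<and> trav m xs' ys'" using 1(2) 2 3(2) us3 ne by auto
qed (simp add: trav_append)

section \<open>The OR gadget on abstract curves\<close>

text \<open>A stretch of columns without \<open>d\<close> cannot cross a block boundary. In the
  application, the stretch is visited together with one \<open>xs\<close>, none of whose vertices
  matches \<open>d\<close>.\<close>

lemma sublist_of_block:
  assumes "concat (map (\<lambda>y. d # d # y) yss) = us @ zs @ vs" "zs \<noteq> []" "d \<notin> set zs"
  shows "\<exists>ys\<in>set yss. \<exists>us' vs'. ys = us' @ zs @ vs'"
  using assms(1)
proof (induction yss arbitrary: us)
  case Nil
  then show ?case using assms by auto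
next
  case (Cons ys yss)
  let ?c = "concat (map (\<lambda>y. d # d # y) yss)"
  have eq: "d # d # ys @ ?c = us @ zs @ vs" using Cons.prems by simp
  obtain us' where us: "us = d # d # us'" and eq': "ys @ ?c = us' @ zs @ vs"
    using eq assms(2,3) by (cases us; cases zs; cases "tl us") auto
  consider (a) ws where "us' = ys @ ws" "?c = ws @ zs @ vs"
    | (b) ws where "ys = us' @ ws" "ws @ ?c = zs @ vs" 
    using eq' by (auto simp: append_eq_append_conv2)
  then show ?case
  proof cases
    case a
    then show ?thesis using Cons.IH by auto
  next
    case b
    from b(2) have "(\<exists>w. ws = zs @ w) \<or> (\<exists>w. zs = ws @ w \<and> ?c = w @ vs \<and> w \<noteq> [])"
      unfolding append_eq_append_conv2 by (metis append_Nil2)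
    then consider (c) w where "ws = zs @ w" | (e) w where "zs = ws @ w" "?c = w @ vs" "w \<noteq> []"
      by blast
    then show ?thesis
    proof cases
      case c
      then show ?thesis using b by auto
    next
      case e
      then have "hd w = d" by (cases yss) (auto simp: Cons_eq_append_conv)
      then have "d \<in> set zs" using e by (cases w) auto
      then show ?thesis using assms by simp
    qed
  qed
qed

text \<open>\<open>Q\<close> will be "matches \<open>v\<close>". Every other row being excluded, the
  row found must be the \<open>s\<close> in front of some block, so that this block comes
  next.\<close>

lemma block_of_start:
  assumes "concat (map (\<lambda>x. t # s # x) xss) @ cs = us @ r # vs" "Q r" "\<not> Q t" "\<forall>c\<in>set cs. \<not> Q c"
    "\<forall>xs\<in>set xss. \<forall>x\<in>set xs. \<not> Q x"
  shows "r = s \<and> (\<exists>xs\<in>set xss. \<exists>ws. vs = xs @ ws)"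
  using assms
proof (induction xss arbitrary: us)
  case Nil
  then show ?case by auto
next
  case (Cons xs xss)
  let ?c = "concat (map (\<lambda>x. t # s # x) xss) @ cs"
  have eq: "t # s # xs @ ?c = us @ r # vs" using Cons.prems(1) by simp
  then consider "us = [t]" "r = s" "vs = xs @ ?c" | us' where "us = t # s # us'" "xs @ ?c = us' @ r # vs"
    using Cons.prems(2,3) by (auto simp: Cons_eq_append_conv)
  then show ?case
  proof cases
    case 1
    then show ?thesis by auto
  next
    case 2
    have "r \<notin> set xs" using Cons.prems by auto
    then obtain us'' where "?c = us'' @ r # vs"
      using 2(2) by (auto simp: append_eq_append_conv2 Cons_eq_append_conv append_eq_Cons_conv)
    from Cons.IH[OF this] Cons.prems show ?thesis by auto
  qed
qed

text \<open>The doubled \<open>t\<close> at both ends, like the doubled \<open>d\<close> of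
  \<open>or_cols\<close>, keeps the two lists parallel position by position, so that one template
  cell can hold a vertex of each curve.\<close>

definition or_rows :: "'a \<Rightarrow> 'a \<Rightarrow> 'a \<Rightarrow> 'a \<Rightarrow> 'a list list \<Rightarrow> 'a list" where
  "or_rows st s t en xss = [st, t, t] @ concat (map (\<lambda>x. t # s # x) xss) @ [t, t, en]"

definition or_cols :: "'b \<Rightarrow> 'b \<Rightarrow> 'b \<Rightarrow> 'b \<Rightarrow> 'b \<Rightarrow> 'b \<Rightarrow> 'b list list \<Rightarrow> 'b list" where
  "or_cols st a v d v' en yss = [st, a, v] @ concat (map (\<lambda>y. d # d # y) yss) @ [v', a, en]"

lemma trav_or_sound:
  assumes tr: "trav m (or_rows st s t en xss) (or_cols st' a v d v' en' yss)"
    and v: "\<not> m st v" "\<not> m t v" "\<not> m en v" "\<forall>xs\<in>set xss. \<forall>x\<in>set xs. \<not> m x v"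
    and v': "\<not> m s v'" "\<forall>xs\<in>set xss. \<forall>x\<in>set xs. \<not> m x v'"
    and d: "\<forall>xs\<in>set xss. \<forall>x\<in>set xs. \<not> m x d"
    and ne: "\<forall>xs\<in>set xss. xs \<noteq> []"
    and ends: "\<forall>xs\<in>set xss. \<forall>ys\<in>set yss.
      (\<forall>y\<in>set (tl ys). \<not> m (hd xs) y) \<and> (\<forall>y\<in>set (butlast ys). \<not> m (last xs) y)"
  shows "\<exists>xs\<in>set xss. \<exists>ys\<in>set yss. trav m xs ys"
proof -
  let ?mid = "concat (map (\<lambda>y. d # d # y) yss)"
  let ?rows = "concat (map (\<lambda>x. t # s # x) xss) @ [t, t, en]"
  have "trav m (or_rows st s t en xss) ([st', a] @ v # (?mid @ [v', a, en']))"
    using tr by (simp add: or_cols_def)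
  from trav_col_split[OF this] obtain us r vs where
    1: "or_rows st s t en xss = us @ r # vs" "trav m (r # vs) (v # ?mid @ [v', a, en'])" by blast
  have mr: "m r v" using trav_Cons_match 1(2) by fast
  have "\<exists>us'. ?rows = us' @ r # vs"
    using 1(1) mr v unfolding or_rows_def by (auto simp: Cons_eq_append_conv)
  then obtain us' where "?rows = us' @ r # vs" by blast
  from block_of_start[OF this, of "\<lambda>x. m x v"] mr v
  obtain xs ws where r: "r = s" and xs: "xs \<in> set xss" "vs = xs @ ws" by auto
  have xsne: "xs \<noteq> []" using ne xs by auto
  have "trav m ((s # butlast xs) @ last xs # ws) (v # ?mid @ [v', a, en'])"
  proof -
    have "(s # butlast xs) @ last xs # ws = s # (butlast xs @ [last xs]) @ ws" by simp
    also have "\<dots> = r # vs" using r xs xsne by (subst append_butlast_last_id) auto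
    finally show ?thesis using 1(2) by simp
  qed
  from trav_row_split[OF this] obtain us2 c vs2 where
    2: "v # ?mid @ [v', a, en'] = us2 @ c # vs2" "trav m (s # xs) (us2 @ [c])"
    using xsne by auto
  \<comment> \<open>While \<open>P\<close> runs through \<open>s\<close> and \<open>xs\<close>, the
    column \<open>v'\<close> cannot be visited, so all columns visited meanwhile lie before
    it.\<close>
  have nv': "v' \<notin> set (us2 @ [c])"
    using trav_col_matched[OF 2(2)] v' xs by fastforce
  have mc: "m (last xs) c" using trav_last_match[OF 2(2)] xsne by simp
  have "c \<noteq> v" using mc v xs xsne by auto
  then obtain us3 where us3: "us2 = v # us3" "?mid @ [v', a, en'] = (us3 @ [c]) @ vs2"
    using 2(1) by (cases us2) auto
  obtain mid2 where mid2: "?mid = (us3 @ [c]) @ mid2"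
    using us3(2) nv' us3(1) unfolding append_eq_append_conv2
    by (auto simp: Cons_eq_append_conv)
  have "trav m ([s] @ hd xs # tl xs) (v # us3 @ [c])" using 2(2) us3 xsne by simp
  from trav_row_split[OF this] obtain us4 c1 vs4 where
    4: "v # us3 @ [c] = us4 @ c1 # vs4" "trav m xs (c1 # vs4)"
    using xsne by auto
  have mc1: "m (hd xs) c1" using trav_hd_match[OF 4(2)] by simp
  then have "c1 \<noteq> v" using v xs xsne by auto
  then obtain us5 where us5: "us3 @ [c] = us5 @ c1 # vs4"
    using 4(1) by (cases us4) auto
  \<comment> \<open>The columns \<open>c1 # vs4\<close> visited during \<open>xs\<close> avoid
    \<open>d\<close> and thus lie inside one block \<open>ys\<close>. By the condition on the ends
    they start at its first vertex and stop at its last one.\<close>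
  have dn: "d \<notin> set (c1 # vs4)" using trav_col_matched[OF 4(2)] d xs by blast
  have "?mid = us5 @ (c1 # vs4) @ mid2" using mid2 us5 by simp
  from sublist_of_block[OF this _ dn] obtain ys us6 vs6 where
    ys: "ys \<in> set yss" "ys = us6 @ (c1 # vs4) @ vs6" by auto
  have "us6 = []"
  proof (rule ccontr)
    assume "us6 \<noteq> []"
    then have "c1 \<in> set (tl ys)" using ys by (cases us6) auto
    then show False using mc1 ends xs ys by blast
  qed
  moreover have "vs6 = []"
  proof (rule ccontr)
    assume "vs6 \<noteq> []"
    then have "last (c1 # vs4) \<in> set (butlast ys)" using ys
      by (auto simp: butlast_append)
    then show False using trav_last_match[OF 4(2)] ends xs ys by blast
  qed
  ultimately show ?thesis using 4(2) xs ys by auto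
qed

lemma trav_or_complete:
  assumes xs: "xs \<in> set xss" and ys: "ys \<in> set yss" and tr: "trav m xs ys"
    and st: "m st st'" and en: "m en en'"
    and a: "m s a" "m t a" "\<forall>xs\<in>set xss. \<forall>x\<in>set xs. m x a"
    and s: "m s v" "m s d" "\<forall>ys\<in>set yss. \<forall>y\<in>set ys. m s y"
    and t: "m t v'" "m t d" "\<forall>ys\<in>set yss. \<forall>y\<in>set ys. m t y"
  shows "trav m (or_rows st s t en xss) (or_cols st' a v d v' en' yss)"
proof -
  obtain xss1 xss2 where x: "xss = xss1 @ xs # xss2" using xs split_list by metis
  obtain yss1 yss2 where y: "yss = yss1 @ ys # yss2" using ys split_list by metis
  let ?r1 = "[t, t] @ concat (map (\<lambda>x. t # s # x) xss1) @ [t]"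
  let ?r2 = "concat (map (\<lambda>x. t # s # x) xss2) @ [t, t]"
  let ?c1 = "v # concat (map (\<lambda>y. d # d # y) yss1) @ [d, d]"
  let ?c2 = "concat (map (\<lambda>y. d # d # y) yss2) @ [v']"
  \<comment> \<open>The \<open>t\<close> after the chosen block waits through the remaining columns
    up to \<open>v'\<close>, and some row must be left over for the closing \<open>a\<close>. If the
    chosen block is the last one, this takes both of the final \<open>t\<close>.\<close>
  have r2: "?r2 = t # tl ?r2" "tl ?r2 \<noteq> []" by (cases xss2; simp)+
  have setr2: "set (tl ?r2) \<subseteq> set ?r2" by (cases ?r2) auto
  have 1: "trav m ?r1 [a]" by (rule trav_singleton_col) (use a x in auto)
  have 2: "trav m [s] ?c1" by (rule trav_singleton_row) (use s y in auto)
  have 3: "trav m [t] ?c2" by (rule trav_singleton_row) (use t y in auto)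
  have "\<forall>x\<in>set ?r2. m x a" using a x by auto
  then have "\<forall>x\<in>set (tl ?r2). m x a" using setr2 by blast
  then have 4: "trav m (tl ?r2) [a]" using r2(2) by (intro trav_singleton_col)
  have "trav m ([st] @ ?r1 @ [s] @ xs @ [t] @ tl ?r2 @ [en]) ([st'] @ [a] @ ?c1 @ ys @ ?c2 @ [a] @ [en'])"
    by (intro trav_append 1 2 3 4 tr trav.single st en)
  moreover have "[st] @ ?r1 @ [s] @ xs @ [t] @ tl ?r2 @ [en] = or_rows st s t en xss"
  proof -
    have "[t] @ tl ?r2 = ?r2" using r2 by simp
    then have "[st] @ ?r1 @ [s] @ xs @ ([t] @ tl ?r2) @ [en] = or_rows st s t en xss"
      unfolding or_rows_def x by simp
    then show ?thesis by simp
  qed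
  moreover have "[st'] @ [a] @ ?c1 @ ys @ ?c2 @ [a] @ [en'] = or_cols st' a v d v' en' yss"
    unfolding or_cols_def y by simp
  ultimately show ?thesis by simp
qed

section \<open>Frechet distance and intervals\<close>

text \<open>The first time unit is spent at vertex 1, then \<open>f\<close> is replayed. With
  \<open>c = 1\<close> vertex 1 is a new vertex put in front; with \<open>c = 0\<close> the old
  first vertex is held one unit longer.\<close>

definition delay :: "nat \<Rightarrow> (nat \<Rightarrow> nat) \<Rightarrow> nat \<Rightarrow> nat" where
  "delay c f t = (if t \<le> 1 then 1 else f (t - 1) + c)"

lemma shift_onto:
  fixes f :: "nat \<Rightarrow> nat"
  assumes "mono_on {1..k} f" "f ` {1..k} = {1..n}" "n \<ge> 1" "c \<le> 1"
  shows "mono_on {1..k+1} (delay c f)" and "delay c f ` {1..k+1} = {1..n+c}"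
proof -
  let ?g = "delay c f"
  have f1: "f t \<ge> 1" if "t \<in> {1..k}" for t
  proof -
    have "f t \<in> f ` {1..k}" using that by (rule imageI)
    then show ?thesis unfolding assms(2) by simp
  qed
  show "mono_on {1..k+1} ?g"
  proof (rule mono_onI)
    fix r s assume rs: "r \<in> {1..k+1}" "s \<in> {1..k+1}" "r \<le> (s::nat)"
    show "?g r \<le> ?g s"
    proof (cases "r \<le> 1")
      case True
      have "1 \<le> ?g s"
      proof (cases "s \<le> 1")
        case False
        then have "s - 1 \<in> {1..k}" using rs by auto
        from f1[OF this] show ?thesis using False by (simp add: delay_def)
      qed (simp add: delay_def)
      then show ?thesis using True by (simp add: delay_def)
    next
      case False
      then have "f (r - 1) \<le> f (s - 1)"
        using rs assms(1) by (intro mono_onD[OF assms(1)]) auto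
      then show ?thesis using False rs by (auto simp: delay_def)
    qed
  qed
  have "{1..k+1} = insert 1 (Suc ` {1..k})"
    unfolding image_Suc_atLeastAtMost by auto
  then have "?g ` {1..k+1} = insert (?g 1) ((?g \<circ> Suc) ` {1..k})"
    by (simp only: image_insert image_comp)
  also have "\<dots> = insert 1 ((\<lambda>t. f t + c) ` {1..k})"
    by (intro arg_cong2[of _ _ _ _ insert] image_cong) (auto simp: delay_def)
  also have "(\<lambda>t. f t + c) ` {1..k} = (\<lambda>x. x + c) ` {1..n}"
    unfolding assms(2)[symmetric] by (simp add: image_image)
  also have "insert 1 \<dots> = {1..n+c}" using assms(3,4) by auto
  finally show "?g ` {1..k+1} = {1..n+c}" .
qed

lemma traversal_shift:
  assumes "traversal n m \<phi> \<psi>" "n \<ge> 1" "m \<ge> 1" "c + c' = 1"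
  shows "traversal (n + c) (m + c') (delay c \<phi>) (delay c' \<psi>)"
proof -
  have k: "n + c + (m + c') = n + m + 1" using assms by simp
  have tr: "mono_on {1..n+m} \<phi>" "\<phi> ` {1..n+m} = {1..n}" "mono_on {1..n+m} \<psi>" "\<psi> ` {1..n+m} = {1..m}"
    using assms(1) unfolding traversal_def by auto
  have "c \<le> 1" "c' \<le> 1" using assms(4) by auto
  then show ?thesis
    using shift_onto[OF tr(1,2) assms(2)] shift_onto[OF tr(3,4) assms(3)]
    unfolding traversal_def k by blast
qed

lemma stays_within_shift:
  assumes "stays_within P Q \<phi> \<psi> \<delta>" "traversal (length P) (length Q) \<phi> \<psi>"
    "norm (hd (us @ P) - hd (vs @ Q)) \<le> \<delta>" "length us + length vs = 1" "P \<noteq> []" "Q \<noteq> []"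
  shows "stays_within (us @ P) (vs @ Q) (delay (length us) \<phi>) (delay (length vs) \<psi>) \<delta>"
  unfolding stays_within_def
proof (intro ballI)
  fix t assume t: "t \<in> {1..length (us @ P) + length (vs @ Q)}"
  show "norm ((us @ P) ! (delay (length us) \<phi> t - 1) - (vs @ Q) ! (delay (length vs) \<psi> t - 1)) \<le> \<delta>"
  proof (cases "t \<le> 1")
    case True
    have "us @ P \<noteq> []" "vs @ Q \<noteq> []" using assms by auto
    then show ?thesis using True assms(3) by (simp add: hd_conv_nth delay_def)
  next
    case False
    then have u: "t - 1 \<in> {1..length P + length Q}" using t assms(4) by auto
    have "\<phi> (t - 1) \<in> {1..length P}" "\<psi> (t - 1) \<in> {1..length Q}"
      using assms(2) u unfolding traversal_def by blast+
    moreover from this have "\<phi> (t - 1) + length us - 1 = length us + (\<phi> (t - 1) - 1)"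
      "\<psi> (t - 1) + length vs - 1 = length vs + (\<psi> (t - 1) - 1)" by auto
    ultimately show ?thesis using False u assms(1)
      unfolding stays_within_def by (simp only: delay_def nth_append_length_plus if_False)
  qed
qed

lemma trav_imp_traversal:
  assumes "trav (\<lambda>p q. norm (p - q) \<le> \<delta>) P Q"
  shows "\<exists>\<phi> \<psi>. traversal (length P) (length Q) \<phi> \<psi> \<and> stays_within P Q \<phi> \<psi> \<delta>"
  using assms
proof (induction rule: trav.induct)
  case (single x y)
  have "{1..2} = {1, 2::nat}" by auto
  then show ?case using single
    by (intro exI[of _ "\<lambda>_. 1"]) (auto simp: traversal_def stays_within_def mono_on_def)
next
  case (row x y xs ys)
  then obtain \<phi> \<psi> where *: "traversal (length xs) (length (y # ys)) \<phi> \<psi>"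
    "stays_within xs (y # ys) \<phi> \<psi> \<delta>" by blast
  have "xs \<noteq> []" using row.hyps trav_nonempty by blast
  then show ?case
    using traversal_shift[OF *(1), of 1 0] stays_within_shift[OF *(2,1), of "[x]" "[]"] row.hyps
    by (intro exI[of _ "delay 1 \<phi>"] exI[of _ "delay 0 \<psi>"]) (simp add: Suc_le_eq)
next
  case (col x y xs ys)
  then obtain \<phi> \<psi> where *: "traversal (length (x # xs)) (length ys) \<phi> \<psi>"
    "stays_within (x # xs) ys \<phi> \<psi> \<delta>" by blast
  have "ys \<noteq> []" using col.hyps trav_nonempty by blast
  then show ?case
    using traversal_shift[OF *(1), of 0 1] stays_within_shift[OF *(2,1), of "[]" "[y]"] col.hyps
    by (intro exI[of _ "delay 0 \<phi>"] exI[of _ "delay 1 \<psi>"]) (simp add: Suc_le_eq)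
next
  case (diag x y xs ys)
  then obtain \<phi> \<psi> where *: "traversal (length xs) (length ys) \<phi> \<psi>"
    "stays_within xs ys \<phi> \<psi> \<delta>" by blast
  have ne: "xs \<noteq> []" "ys \<noteq> []" using diag.hyps trav_nonempty by blast+
  \<comment> \<open>A simultaneous step adds a vertex to both curves and hence two time units, so
    the new first pair is held for both of them.\<close>
  let ?\<phi> = "delay 0 (delay 1 \<phi>)" and ?\<psi> = "delay 0 (delay 1 \<psi>)"
  have len: "length xs \<ge> 1" "length ys \<ge> 1" using ne by (auto simp: Suc_le_eq)
  have k: "length (x # xs) + length (y # ys) = length xs + length ys + 1 + 1" by simp
  have tr: "mono_on {1..length xs + length ys} \<phi>" "\<phi> ` {1..length xs + length ys} = {1..length xs}"
    "mono_on {1..length xs + length ys} \<psi>" "\<psi> ` {1..length xs + length ys} = {1..length ys}"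
    using *(1) unfolding traversal_def by auto
  have "traversal (length (x # xs)) (length (y # ys)) ?\<phi> ?\<psi>"
    unfolding traversal_def k
    using shift_onto[OF shift_onto[OF tr(1,2) len(1), of 1], of 0]
      shift_onto[OF shift_onto[OF tr(3,4) len(2), of 1], of 0] by (simp del: One_nat_def)
  moreover have "stays_within (x # xs) (y # ys) ?\<phi> ?\<psi> \<delta>"
    unfolding stays_within_def
  proof (intro ballI)
    fix t assume t: "t \<in> {1..length (x # xs) + length (y # ys)}"
    show "norm ((x # xs) ! (?\<phi> t - 1) - (y # ys) ! (?\<psi> t - 1)) \<le> \<delta>"
    proof (cases "t \<le> 2")
      case True
      then show ?thesis using t diag.hyps by (auto simp: delay_def)
    next
      case False
      then have u: "t - 1 - 1 \<in> {1..length xs + length ys}" using t by auto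
      have "\<phi> (t - 1 - 1) \<in> {1..length xs}" "\<psi> (t - 1 - 1) \<in> {1..length ys}"
        using tr(2,4) u by blast+
      then have "?\<phi> t - 1 = Suc (\<phi> (t - 1 - 1) - 1)" "?\<psi> t - 1 = Suc (\<psi> (t - 1 - 1) - 1)"
        using False by (auto simp: delay_def)
      then show ?thesis using *(2) u unfolding stays_within_def by (simp only: nth_Cons_Suc)
    qed
  qed
  ultimately show ?case by blast
qed

text \<open>Being monotone and onto leaves no room to skip a value. This is why a traversal advances
  by at most one vertex per curve and time unit.\<close>

lemma onto_step:
  fixes f :: "nat \<Rightarrow> nat"
  assumes "mono_on {1..k} f" "f ` {1..k} = {1..n}" "t \<ge> 1" "t < k"
  shows "f (Suc t) = f t \<or> f (Suc t) = Suc (f t)"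
proof (rule ccontr)
  assume "\<not> ?thesis"
  moreover have "f t \<le> f (Suc t)" using assms by (intro mono_onD[OF assms(1)]) auto
  ultimately have 1: "f t < Suc (f t)" "Suc (f t) < f (Suc t)" by auto
  have "f (Suc t) \<in> {1..n}" using assms by (metis atLeastAtMost_iff imageI le_SucI Suc_leI)
  then have "Suc (f t) \<in> f ` {1..k}" using 1 assms(2) by auto
  then obtain s where s: "s \<in> {1..k}" "f s = Suc (f t)" by auto
  have "s \<le> t \<Longrightarrow> f s \<le> f t" using s assms by (intro mono_onD[OF assms(1)]) auto
  moreover have "Suc t \<le> s \<Longrightarrow> f (Suc t) \<le> f s" using s assms by (intro mono_onD[OF assms(1)]) auto
  ultimately show False using s 1 by linarith
qed

lemma onto_ends:
  fixes f :: "nat \<Rightarrow> nat"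
  assumes "mono_on {1..k} f" "f ` {1..k} = {1..n}" "n \<ge> 1"
  shows "f 1 = 1" "f k = n"
proof -
  have "1 \<in> f ` {1..k}" "n \<in> f ` {1..k}" using assms by auto
  then obtain s t where st: "s \<in> {1..k}" "f s = 1" "t \<in> {1..k}" "f t = n" by auto
  have "f 1 \<in> {1..n}" "f k \<in> {1..n}"
    unfolding assms(2)[symmetric] using st by auto
  moreover have "f 1 \<le> f s" "f t \<le> f k" using st by (intro mono_onD[OF assms(1)]; simp)+
  ultimately show "f 1 = 1" "f k = n" using st by auto
qed

lemma traversal_imp_trav:
  assumes ne: "P \<noteq> []" "Q \<noteq> []"
    and tr: "traversal (length P) (length Q) \<phi> \<psi>" and st: "stays_within P Q \<phi> \<psi> \<delta>"
  shows "trav (\<lambda>p q. norm (p - q) \<le> \<delta>) P Q"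
proof -
  let ?k = "length P + length Q"
  let ?m = "\<lambda>p q. norm (p - q) \<le> \<delta>"
  have trs: "mono_on {1..?k} \<phi>" "\<phi> ` {1..?k} = {1..length P}" "mono_on {1..?k} \<psi>"
    "\<psi> ` {1..?k} = {1..length Q}" using tr unfolding traversal_def by auto
  have len: "length P \<ge> 1" "length Q \<ge> 1" using ne by (auto simp: Suc_le_eq)
  have ran: "\<phi> t \<in> {1..length P}" "\<psi> t \<in> {1..length Q}" if "t \<in> {1..?k}" for t
    using that trs(2,4) by blast+
  have dr: "drop (\<phi> t - 1) P = P ! (\<phi> t - 1) # drop (\<phi> t) P"
    "drop (\<psi> t - 1) Q = Q ! (\<psi> t - 1) # drop (\<psi> t) Q" if "t \<in> {1..?k}" for t
    using ran[OF that] Cons_nth_drop_Suc[of "\<phi> t - 1" P] Cons_nth_drop_Suc[of "\<psi> t - 1" Q] by auto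
  \<comment> \<open>Backward induction on time. A unit in which neither curve moves leaves the claim
    unchanged; the other three cases are the rules \<open>row\<close>, \<open>col\<close> and
    \<open>diag\<close>.\<close>
  have main: "trav ?m (drop (\<phi> t - 1) P) (drop (\<psi> t - 1) Q)" if "1 \<le> t" "t \<le> ?k" for t
    using that(2,1)
  proof (induction t rule: inc_induct)
    case base
    have "\<phi> ?k = length P" "\<psi> ?k = length Q" using onto_ends trs len by auto
    moreover have k: "?k \<in> {1..?k}" using len by auto
    ultimately show ?case using dr[OF k] bspec[OF st[unfolded stays_within_def] k]
      by (auto intro!: trav.single)
  next
    case (step t)
    have t: "t \<in> {1..?k}" using step by auto
    have mt: "?m (P ! (\<phi> t - 1)) (Q ! (\<psi> t - 1))" using st t unfolding stays_within_def by auto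
    have IH: "trav ?m (drop (\<phi> (Suc t) - 1) P) (drop (\<psi> (Suc t) - 1) Q)" using step by auto
    have a: "\<phi> (Suc t) = \<phi> t \<or> \<phi> (Suc t) = Suc (\<phi> t)" "\<psi> (Suc t) = \<psi> t \<or> \<psi> (Suc t) = Suc (\<psi> t)"
      using onto_step[OF trs(1,2)] onto_step[OF trs(3,4)] step by auto
    then show ?case using IH dr[OF t] mt by (auto intro: trav.intros)
  qed
  have "\<phi> 1 = 1" "\<psi> 1 = 1" using onto_ends trs len by auto
  then show ?thesis using main[of 1] len by simp
qed

lemma traversal_exists:
  assumes "n \<ge> 1" "m \<ge> 1" shows "\<exists>\<phi> \<psi>. traversal n m \<phi> \<psi>"
proof -
  have "min n ` {1..n+m} = {1..n}"
  proof
    show "{1..n} \<subseteq> min n ` {1..n+m}"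
    proof
      fix x assume "x \<in> {1..n}"
      then show "x \<in> min n ` {1..n+m}" by (intro image_eqI[of _ _ x]) auto
    qed
  qed (use assms in auto)
  moreover have "(\<lambda>t. max 1 (t - n)) ` {1..n+m} = {1..m}"
  proof
    show "{1..m} \<subseteq> (\<lambda>t. max 1 (t - n)) ` {1..n+m}"
    proof
      fix x assume "x \<in> {1..m}"
      then show "x \<in> (\<lambda>t. max 1 (t - n)) ` {1..n+m}" by (intro image_eqI[of _ _ "x + n"]) auto
    qed
  qed (use assms in auto)
  ultimately have "traversal n m (min n) (\<lambda>t. max 1 (t - n))"
    unfolding traversal_def mono_on_def by (auto simp: min_def max_def)
  then show ?thesis by blast
qed

text \<open>The least element in the definition of the distance exists because each traversal has a cost
  among the finitely many distances of vertex pairs.\<close>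

lemma frechet_dist_le_iff:
  assumes ne: "P \<noteq> []" "Q \<noteq> []"
  shows "frechet_dist P Q \<le> \<delta> \<longleftrightarrow> trav (\<lambda>p q. norm (p - q) \<le> \<delta>) P Q"
proof -
  let ?T = "traversal (length P) (length Q)"
  let ?ok = "\<lambda>\<delta>. \<exists>\<phi> \<psi>. ?T \<phi> \<psi> \<and> stays_within P Q \<phi> \<psi> \<delta>"
  let ?d = "\<lambda>\<phi> \<psi> t. norm (P ! (\<phi> t - 1) - Q ! (\<psi> t - 1))"
  let ?I = "{1..length P + length Q}"
  define cost where "cost = (\<lambda>(\<phi>, \<psi>). Max (?d \<phi> \<psi> ` ?I))"
  let ?C = "cost ` {(\<phi>, \<psi>). ?T \<phi> \<psi>}"
  have ine: "?I \<noteq> {}" using ne by (auto simp: Suc_le_eq)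
  have sw: "stays_within P Q \<phi> \<psi> e \<longleftrightarrow> cost (\<phi>, \<psi>) \<le> e" for \<phi> \<psi> e
    unfolding stays_within_def cost_def using ine by (auto simp: Max_le_iff)
  have "?C \<subseteq> (\<lambda>(i, j). norm (P ! i - Q ! j)) ` ({..<length P} \<times> {..<length Q})"
  proof
    fix c assume "c \<in> ?C"
    then obtain \<phi> \<psi> where tr: "?T \<phi> \<psi>" and "c = Max (?d \<phi> \<psi> ` ?I)" unfolding cost_def by auto
    moreover have "Max (?d \<phi> \<psi> ` ?I) \<in> ?d \<phi> \<psi> ` ?I" using ine by (intro Max_in) auto
    ultimately obtain t where t: "t \<in> ?I" "c = ?d \<phi> \<psi> t" by blast
    have "\<phi> t \<in> {1..length P}" "\<psi> t \<in> {1..length Q}"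
      using tr t unfolding traversal_def by blast+
    then show "c \<in> (\<lambda>(i, j). norm (P ! i - Q ! j)) ` ({..<length P} \<times> {..<length Q})"
      using t by (intro image_eqI[of _ _ "(\<phi> t - 1, \<psi> t - 1)"]) auto
  qed
  then have fin: "finite ?C" by (rule finite_subset) auto
  have "?C \<noteq> {}" using traversal_exists[of "length P" "length Q"] ne by (auto simp: Suc_le_eq)
  then have min: "Min ?C \<in> ?C" "\<And>c. c \<in> ?C \<Longrightarrow> Min ?C \<le> c" using fin by (auto intro: Min_in)
  have ok_iff: "?ok e \<longleftrightarrow> Min ?C \<le> e" for e
  proof
    assume "?ok e"
    then obtain \<phi> \<psi> where "?T \<phi> \<psi>" "cost (\<phi>, \<psi>) \<le> e" unfolding sw by blast
    moreover from this have "Min ?C \<le> cost (\<phi>, \<psi>)" by (intro min(2)) auto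
    ultimately show "Min ?C \<le> e" by linarith
  next
    assume *: "Min ?C \<le> e"
    obtain \<phi> \<psi> where "?T \<phi> \<psi>" "Min ?C = cost (\<phi>, \<psi>)" using min(1) by blast
    then show "?ok e" unfolding sw using * by metis
  qed
  have "frechet_dist P Q = Min ?C"
    unfolding frechet_dist_def ok_iff by (rule Least_equality) auto
  then show ?thesis
    using ok_iff[of \<delta>] trav_imp_traversal[of \<delta> P Q] traversal_imp_trav[OF ne] by metis
qed

section \<open>Intervals realised as points of the plane\<close>

definition matches :: "nat \<times> nat \<Rightarrow> nat \<times> nat \<Rightarrow> bool" where
  "matches = (\<lambda>(L, R) (l, r). (int L - int l) * (int R - int r) + (int L - int r) * (int R - int l) \<le> 0)"

lemma matches_inside:
  assumes "L \<le> l \<and> l \<le> r \<and> r \<le> R \<or> l \<le> L \<and> L \<le> R \<and> R \<le> r"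
  shows "matches (L, R) (l, r)"
proof -
  have "(int L - int l) * (int R - int r) \<le> 0" "(int L - int r) * (int R - int l) \<le> 0"
    using assms by (auto simp: mult_le_0_iff)
  then show ?thesis unfolding matches_def by simp
qed

lemma not_matches_disjoint:
  assumes "L \<le> R" "l \<le> r" "R < l \<or> r < L"
  shows "\<not> matches (L, R) (l, r)"
proof -
  have "(int L - int l) * (int R - int r) > 0" "(int L - int r) * (int R - int l) > 0"
    using assms by (auto simp: zero_less_mult_iff)
  then show ?thesis unfolding matches_def by simp
qed

definition pvert :: "nat \<Rightarrow> nat \<times> nat \<Rightarrow> real \<times> real" where
  "pvert X = (\<lambda>(L, R). (real (L + R) / real (X * X), real ((R - L) * (R - L)) / real (2 * (X * X * (X *
      X)))))"

text \<open>The \<open>- 1\<close> puts the threshold between two integers: it leaves a margin that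
  the fourth-order term of the squared distance cannot use up.\<close>

definition qvert :: "nat \<Rightarrow> nat \<times> nat \<Rightarrow> real \<times> real" where
  "qvert X = (\<lambda>(l, r). (real (l + r) / real (X * X),
     real (2 * (X * X * (X * X)) - 1 - (r - l) * (r - l)) / real (2 * (X * X * (X * X)))))"

text \<open>The squared distance is \<open>1 + (2 z - 1 + e) / M\<^sup>2\<close> with \<open>0 \<le> e \<le> 1\<close>, where \<open>M = X\<^sup>2\<close> and \<open>z\<close> is the
  integer whose sign decides whether the intervals match.\<close>

lemma dist_le_1_iff_matches:
  assumes "L \<le> R" "R < X" "l \<le> r" "r < X"
  shows "norm (pvert X (L, R) - qvert X (l, r)) \<le> 1 \<longleftrightarrow> matches (L, R) (l, r)"
proof -
  define M where "M = real X * real X"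
  define h k where "h = real R - real L" and "k = real r - real l"
  define z where "z = (int L - int l) * (int R - int r) + (int L - int r) * (int R - int l)"
  define e where "e = h * h + k * k + 1"
  have X1: "real X \<ge> 1" using assms by linarith
  then have M1: "M \<ge> 1" unfolding M_def using mult_mono[of 1 "real X" 1 "real X"] by simp
  have hk: "0 \<le> h" "h \<le> real X - 1" "0 \<le> k" "k \<le> real X - 1"
    unfolding h_def k_def using assms by linarith+
  then have "h * h \<le> (real X - 1) * (real X - 1)" "k * k \<le> (real X - 1) * (real X - 1)"
    by (auto intro: mult_mono)
  then have e: "0 \<le> e" "e \<le> 2 * M" "k * k + 1 \<le> M * 2"
    unfolding e_def M_def using hk X1 mult_mono[OF X1 X1] by (auto simp: algebra_simps)
  \<comment> \<open>The numerator in \<open>qvert\<close> is a subtraction of natural numbers; this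
    bound makes it exact.\<close>
  have nk: "(r - l) * (r - l) + 1 \<le> 2 * (X * X * (X * X))"
  proof -
    have "(r - l) * (r - l) \<le> (X - 1) * (X - 1)" using assms by (intro mult_mono) auto
    also have "\<dots> + 1 \<le> X * X" using assms by (cases X) (auto)
    also have "X * X \<le> 2 * (X * X * (X * X))" by (cases X) auto
    finally show ?thesis by simp
  qed
  have rk: "real ((R - L) * (R - L)) = h * h" "real ((r - l) * (r - l)) = k * k"
    unfolding h_def k_def using assms by (simp_all add: of_nat_diff)
  have rq: "real (2 * (X * X * (X * X)) - 1 - (r - l) * (r - l)) = 2 * (M * M) - 1 - k * k"
    unfolding M_def rk(2)[symmetric] using nk by (simp add: of_nat_diff)
  have dx: "fst (pvert X (L, R) - qvert X (l, r)) = (real L + real R - real l - real r) / M"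
    unfolding pvert_def qvert_def M_def by (simp add: diff_divide_distrib add_divide_distrib)
  have dy: "snd (pvert X (L, R) - qvert X (l, r)) = e / (2 * (M * M)) - 1"
  proof -
    have "snd (pvert X (L, R) - qvert X (l, r)) = h * h / (2 * (M * M)) - (2 * (M * M) - 1 - k * k) / (2
        * (M * M))"
      unfolding pvert_def qvert_def split snd_diff snd_conv rk rq by (simp add: M_def)
    then show ?thesis using M1 unfolding e_def by (simp add: field_simps)
  qed
  have zz: "(real L + real R - real l - real r)\<^sup>2 = h * h + k * k + 2 * real_of_int z"
    unfolding h_def k_def z_def by (simp add: algebra_simps power2_eq_square)
  have "(norm (pvert X (L, R) - qvert X (l, r)))\<^sup>2 =
    ((real L + real R - real l - real r) / M)\<^sup>2 + (e / (2 * (M * M)) - 1)\<^sup>2"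
    unfolding dx[symmetric] dy[symmetric] norm_prod_def by simp
  also have "\<dots> = (h * h + k * k + 2 * real_of_int z) / (M * M) + (e / (2 * (M * M)) - 1)\<^sup>2"
    unfolding power_divide zz by (simp add: power2_eq_square)
  also have "\<dots> = 1 + (2 * real_of_int z - 1 + e * e / (4 * (M * M))) / (M * M)"
    using M1 unfolding e_def by (simp add: field_simps power2_eq_square)
  finally have norm: "(norm (pvert X (L, R) - qvert X (l, r)))\<^sup>2 =
    1 + (2 * real_of_int z - 1 + e * e / (4 * (M * M))) / (M * M)" .
  have "e * e \<le> (2 * M) * (2 * M)" using e by (intro mult_mono) auto
  then have f: "0 \<le> e * e / (4 * (M * M))" "e * e / (4 * (M * M)) \<le> 1" using M1 by (auto simp: field_simps)
  have "norm (pvert X (L, R) - qvert X (l, r)) \<le> 1 \<longleftrightarrow> (norm (pvert X (L, R) - qvert X (l, r)))\<^sup>2 \<le> 1"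
    by (simp add: abs_square_le_1)
  also have "\<dots> \<longleftrightarrow> 2 * real_of_int z - 1 + e * e / (4 * (M * M)) \<le> 0"
    unfolding norm using mult_mono[OF M1 M1] M1 by (simp add: divide_le_0_iff) 
  also have "\<dots> \<longleftrightarrow> z \<le> 0"
  proof
    assume "2 * real_of_int z - 1 + e * e / (4 * (M * M)) \<le> 0"
    then have "real_of_int z \<le> 1 / 2" using f by linarith
    then show "z \<le> 0" by linarith
  next
    assume "z \<le> 0"
    then have "real_of_int z \<le> 0" by simp
    then show "2 * real_of_int z - 1 + e * e / (4 * (M * M)) \<le> 0" using f by linarith
  qed
  finally show ?thesis unfolding matches_def z_def by simp
qed

section \<open>The two curves of a formula\<close>

text \<open>A cell \<open>(pl, ph, ql, qh, pw, sg)\<close> describes a vertex \<open>[pl, ph]\<close> of \<open>P\<close> and a vertex \<open>[ql, qh]\<close> of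
  \<open>Q\<close>, each shifted by 0 or 1 depending on the bit of the block number with weight \<open>pw\<close>. As
  \<open>x div 0 = 0\<close>, a cell with \<open>pw = 0\<close> and \<open>sg = 0\<close> is never shifted.\<close>

type_synonym cell = "nat \<times> nat \<times> nat \<times> nat \<times> nat \<times> nat"

definition plabel :: "nat \<Rightarrow> cell \<Rightarrow> nat \<times> nat" where
  "plabel x = (\<lambda>(pl, ph, ql, qh, pw, sg). (pl + (x div pw) mod 2, ph + (x div pw) mod 2))"

definition qlabel :: "nat \<Rightarrow> cell \<Rightarrow> nat \<times> nat" where
  "qlabel y = (\<lambda>(pl, ph, ql, qh, pw, sg). (ql + (y div pw + sg) mod 2, qh + (y div pw + sg) mod 2))"

fun glen :: "formula \<Rightarrow> nat" where
  "glen (Lit b i) = 1"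
| "glen (And Fs) = sum_list (map glen Fs)"
| "glen (Or Fs) = 6 + sum_list (map (\<lambda>F. 2 + glen F) Fs)"

lemma glen_pos: "formula_over n F \<Longrightarrow> 1 \<le> glen F"
proof (induction F)
  case (And Fs)
  then obtain F Gs where "Fs = F # Gs" by (cases Fs) auto
  then show ?case using And.IH[of F] And.prems by (auto intro: trans_le_add1)
qed auto

text \<open>Template position \<open>p\<close> owns the labels \<open>2p\<close> and
  \<open>2p+1\<close>, so that a literal can be shifted by one without leaving its range.\<close>

definition leaf :: "nat \<Rightarrow> cell" where
  "leaf p = (2*p, 2*p, 2*p, 2*p, 0, 0)"

text \<open>The tail starts at position \<open>r\<close>, and the children lie in the labels from
  \<open>2p+6\<close> to \<open>2r-1\<close>. The guards are the points \<open>v = 2p+4\<close> and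
  \<open>v' = 2r\<close>, and \<open>d = 2p+5\<close>. Hence \<open>s = [2p+4, 2r-1]\<close> misses
  only \<open>v'\<close>, \<open>t = [2p+5, 2r]\<close> misses only \<open>v\<close>, and
  \<open>a = [2p+4, 2r]\<close> contains all of this.\<close>

definition or_head :: "nat \<Rightarrow> nat \<Rightarrow> cell list" where
  "or_head p r = [leaf p, (2*p+5, 2*r, 2*p+4, 2*r, 0, 0), (2*p+5, 2*r, 2*p+4, 2*p+4, 0, 0)]"

definition or_sep :: "nat \<Rightarrow> nat \<Rightarrow> cell list" where
  "or_sep p r = [(2*p+5, 2*r, 2*p+5, 2*p+5, 0, 0), (2*p+4, 2*r-1, 2*p+5, 2*p+5, 0, 0)]"

definition or_tail :: "nat \<Rightarrow> nat \<Rightarrow> cell list" where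
  "or_tail p r = [(2*p+5, 2*r, 2*r, 2*r, 0, 0), (2*p+5, 2*r, 2*p+4, 2*r, 0, 0), leaf (r+2)]"

definition or_end :: "nat \<Rightarrow> formula list \<Rightarrow> nat" where
  "or_end p Fs = p + 3 + sum_list (map (\<lambda>F. 2 + glen F) Fs)"

text \<open>The position of a node in the list is also its range of labels, so disjointness of
  ranges needs no separate bookkeeping. The argument \<open>k\<close> of \<open>kids\<close> is the
  number of positions reserved in front of each child for the separators of an OR gate.\<close>

function tmpl :: "nat \<Rightarrow> formula \<Rightarrow> cell list" and kids :: "nat \<Rightarrow> nat \<Rightarrow> formula list \<Rightarrow> cell list list" where
  "tmpl p (Lit b i) = [(2*p, 2*p, 2*p, 2*p, 2 ^ (i - 1), of_bool b)]"
| "tmpl p (And Fs) = concat (kids 0 p Fs)"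
| "tmpl p (Or Fs) = or_head p (or_end p Fs) @
     concat (map (\<lambda>c. or_sep p (or_end p Fs) @ c) (kids 2 (p + 3) Fs)) @ or_tail p (or_end p Fs)"
| "kids k p [] = []"
| "kids k p (F # Fs) = tmpl (p + k) F # kids k (p + k + glen F) Fs"
  by pat_completeness auto
termination
  by (relation "Wellfounded.measure (\<lambda>x. case x of Inl (p, F) \<Rightarrow> size F | Inr (k, p, Fs) \<Rightarrow> size_list size
      Fs)") auto

lemma kids_lengths:
  assumes "\<And>F p. F \<in> set Fs \<Longrightarrow> length (tmpl p F) = glen F"
  shows "map length (kids k p Fs) = map glen Fs"
  using assms by (induction Fs arbitrary: p) auto

lemma length_tmpl [simp]: "length (tmpl p F) = glen F"
proof (induction F arbitrary: p)
  case (And Fs)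
  then show ?case by (simp add: length_concat kids_lengths)
next
  case (Or Fs)
  have "map (\<lambda>c. Suc (Suc (length c))) (kids k q Fs) = map (\<lambda>F. 2 + glen F) Fs" for k q
    using Or by (induction Fs arbitrary: q) auto
  then show ?case by (simp add: length_concat comp_def or_head_def or_sep_def or_tail_def)
qed simp

lemma kids_cells:
  assumes "c \<in> set (kids k p Fs)"
  shows "\<exists>q F. F \<in> set Fs \<and> c = tmpl q F \<and> p + k \<le> q \<and> q + glen F \<le> p + sum_list (map (\<lambda>F. k + glen F) Fs)"
  using assms
proof (induction Fs arbitrary: p)
  case (Cons F Fs)
  show ?case
  proof (cases "c = tmpl (p + k) F")
    case True
    then show ?thesis by (intro exI[of _ "p + k"] exI[of _ F]) auto
  next
    case False
    then obtain q G where "G \<in> set Fs \<and> c = tmpl q G \<and> p + k + glen F + k \<le> q \<and>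
      q + glen G \<le> p + k + glen F + sum_list (map (\<lambda>F. k + glen F) Fs)"
      using Cons by fastforce
    then show ?thesis by (intro exI[of _ q] exI[of _ G]) auto
  qed
qed simp

text \<open>In an OR gate, \<open>P\<close> may stop at one child and \<open>Q\<close> at another.
  Unless they are the same child, their ranges are disjoint and they cannot be traversed
  together.\<close>

lemma kids_pairs:
  assumes "c \<in> set (kids k p Fs)" "c' \<in> set (kids k p Fs)"
  shows "\<exists>q F q' F'. F \<in> set Fs \<and> F' \<in> set Fs \<and> c = tmpl q F \<and> c' = tmpl q' F' \<and>
    (q = q' \<and> F = F' \<or> q + glen F \<le> q' \<or> q' + glen F' \<le> q)"
  using assms
proof (induction Fs arbitrary: p)
  case (Cons F Fs)
  let ?p = "p + k + glen F"
  consider "c = tmpl (p + k) F" "c' = tmpl (p + k) F"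
    | "c = tmpl (p + k) F" "c' \<in> set (kids k ?p Fs)"
    | "c \<in> set (kids k ?p Fs)" "c' = tmpl (p + k) F"
    | "c \<in> set (kids k ?p Fs)" "c' \<in> set (kids k ?p Fs)"
    using Cons.prems by auto
  then show ?case
  proof cases
    case 1
    then show ?thesis by (intro exI[of _ "p + k"] exI[of _ F]) auto
  next
    case 2
    from kids_cells[OF 2(2)] obtain q G where "G \<in> set Fs" "c' = tmpl q G" "?p + k \<le> q" by blast
    then show ?thesis using 2 by (intro exI[of _ "p + k"] exI[of _ F] exI[of _ q] exI[of _ G]) auto
  next
    case 3
    from kids_cells[OF 3(1)] obtain q G where "G \<in> set Fs" "c = tmpl q G" "?p + k \<le> q" by blast
    then show ?thesis using 3 by (intro exI[of _ q] exI[of _ G] exI[of _ "p + k"] exI[of _ F]) auto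
  next
    case 4
    from Cons.IH[OF 4] show ?thesis by (metis list.set_intros(2))
  qed
qed simp

lemma kids_member: "F \<in> set Fs \<Longrightarrow> \<exists>q. tmpl q F \<in> set (kids k p Fs)"
  by (induction Fs arbitrary: p) auto

section \<open>Gadgets and their composition\<close>

text \<open>The bounds are template positions while the entries are labels, hence the factor
  2.\<close>

definition confined :: "nat \<Rightarrow> nat \<Rightarrow> (nat \<times> nat) list \<Rightarrow> bool" where
  "confined a b xs \<longleftrightarrow> (\<forall>(l, r)\<in>set xs. 2 * a \<le> l \<and> l \<le> r \<and> r < 2 * b)"

lemma confined_mono: "confined a b xs \<Longrightarrow> a' \<le> a \<Longrightarrow> b \<le> b' \<Longrightarrow> confined a' b' xs"
  unfolding confined_def by fastforce

lemma confined_append [simp]: "confined a b (xs @ ys) \<longleftrightarrow> confined a b xs \<and> confined a b ys"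
  unfolding confined_def by auto

lemma confined_separate:
  assumes "confined a b xs" "confined a' b' ys" "x \<in> set xs" "y \<in> set ys" "b \<le> a' \<or> b' \<le> a"
  shows "\<not> matches x y"
proof -
  obtain L R l r where xy: "x = (L, R)" "y = (l, r)" by (cases x; cases y) blast
  have "2 * a \<le> L" "L \<le> R" "R < 2 * b" "2 * a' \<le> l" "l \<le> r" "r < 2 * b'"
    using assms(1-4) unfolding confined_def xy by auto
  then show ?thesis using assms(5) unfolding xy by (intro not_matches_disjoint) auto
qed

text \<open>This fixes where a traversal may enter and leave a gadget. Both gates ask for it, and
  restricting the two ends of \<open>P\<close> is enough for them.\<close>

definition ends_match_ends :: "(nat \<times> nat) list \<Rightarrow> (nat \<times> nat) list \<Rightarrow> bool" where
  "ends_match_ends xs ys \<longleftrightarrow> xs \<noteq> [] \<and> ys \<noteq> [] \<and>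
     (\<forall>y\<in>set (tl ys). \<not> matches (hd xs) y) \<and> (\<forall>y\<in>set (butlast ys). \<not> matches (last xs) y)"

definition is_gadget :: "nat \<Rightarrow> nat \<Rightarrow> bool \<Rightarrow> (nat \<times> nat) list \<Rightarrow> (nat \<times> nat) list \<Rightarrow> bool" where
  "is_gadget a b v xs ys \<longleftrightarrow> confined a b xs \<and> confined a b ys \<and> ends_match_ends xs ys \<and>
     (trav matches xs ys \<longleftrightarrow> v)"

lemma is_gadget_append:
  assumes "is_gadget a b v xs ys" "is_gadget b c v' xs' ys'" "a \<le> b" "b \<le> c"
  shows "is_gadget a c (v \<and> v') (xs @ xs') (ys @ ys')"
proof -
  have ne: "xs \<noteq> []" "ys \<noteq> []" "xs' \<noteq> []" "ys' \<noteq> []"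
    using assms unfolding is_gadget_def ends_match_ends_def by auto
  have 1: "\<not> matches x y" if "x \<in> set xs" "y \<in> set ys'" for x y
    using assms(1,2) that unfolding is_gadget_def by (intro confined_separate[of a b xs b c ys']) auto
  have 2: "\<not> matches x y" if "x \<in> set xs'" "y \<in> set ys" for x y
    using assms(1,2) that unfolding is_gadget_def by (intro confined_separate[of b c xs' a b ys]) auto
  have e: "\<forall>y\<in>set (tl ys). \<not> matches (hd xs) y" "\<forall>y\<in>set (butlast ys). \<not> matches (last xs) y"
    "\<forall>y\<in>set (tl ys'). \<not> matches (hd xs') y" "\<forall>y\<in>set (butlast ys'). \<not> matches (last xs') y"
    using assms unfolding is_gadget_def ends_match_ends_def by auto
  have far: "\<forall>y\<in>set ys'. \<not> matches (hd xs) y \<and> \<not> matches (last xs) y"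
    "\<forall>y\<in>set ys. \<not> matches (hd xs') y \<and> \<not> matches (last xs') y"
    using 1[OF hd_in_set[OF ne(1)]] 1[OF last_in_set[OF ne(1)]]
      2[OF hd_in_set[OF ne(3)]] 2[OF last_in_set[OF ne(3)]] by blast+
  then have "trav matches (xs @ xs') (ys @ ys') \<longleftrightarrow> trav matches xs ys \<and> trav matches xs' ys'"
    using ne e by (intro trav_append_iff) blast+
  moreover have "ends_match_ends (xs @ xs') (ys @ ys')"
  proof -
    have "\<forall>y\<in>set (tl (ys @ ys')). \<not> matches (hd (xs @ xs')) y"
      using ne e(1) far(1) by (simp add: ball_Un)
    moreover have "\<forall>y\<in>set (butlast (ys @ ys')). \<not> matches (last (xs @ xs')) y"
      using ne e(4) far(2) by (simp add: butlast_append ball_Un)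
    ultimately show ?thesis unfolding ends_match_ends_def using ne by simp
  qed
  moreover have "confined a c (xs @ xs')" "confined a c (ys @ ys')"
    using assms confined_mono[of a b _ a c] confined_mono[of b c _ a c] unfolding is_gadget_def by simp_all
  ultimately show ?thesis using assms unfolding is_gadget_def by blast
qed

lemma and_gadget:
  assumes "\<And>F p. F \<in> set Fs \<Longrightarrow> is_gadget p (p + glen F) (eval \<alpha> F) (map f (tmpl p F)) (map g (tmpl p F))"
    and "Fs \<noteq> []"
  shows "is_gadget p (p + sum_list (map glen Fs)) (\<forall>F\<in>set Fs. eval \<alpha> F)
    (map f (concat (kids 0 p Fs))) (map g (concat (kids 0 p Fs)))"
  using assms(2,1)
proof (induction Fs arbitrary: p rule: list_nonempty_induct)
  case (single F)
  then show ?case by simp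
next
  case (cons F Fs)
  have "is_gadget p (p + glen F + sum_list (map glen Fs)) (eval \<alpha> F \<and> (\<forall>F\<in>set Fs. eval \<alpha> F))
    (map f (tmpl p F) @ map f (concat (kids 0 (p + glen F) Fs)))
    (map g (tmpl p F) @ map g (concat (kids 0 (p + glen F) Fs)))"
    by (intro is_gadget_append[where b = "p + glen F"] cons) (auto intro: cons)
  then show ?case by (simp add: add.assoc)
qed

lemma plabel_or:
  "map (plabel x) (or_head p r @ concat (map (\<lambda>c. or_sep p r @ c) cs) @ or_tail p r) =
    or_rows (2*p, 2*p) (2*p+4, 2*r-1) (2*p+5, 2*r) (2*r+4, 2*r+4) (map (map (plabel x)) cs)"
  by (simp add: or_rows_def or_head_def or_sep_def or_tail_def leaf_def plabel_def map_concat comp_def)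

lemma qlabel_or:
  "map (qlabel y) (or_head p r @ concat (map (\<lambda>c. or_sep p r @ c) cs) @ or_tail p r) =
    or_cols (2*p, 2*p) (2*p+4, 2*r) (2*p+4, 2*p+4) (2*p+5, 2*p+5) (2*r, 2*r) (2*r+4, 2*r+4)
      (map (map (qlabel y)) cs)"
  by (simp add: or_cols_def or_head_def or_sep_def or_tail_def leaf_def qlabel_def map_concat comp_def)

text \<open>The two families of blocks are arbitrary because the gadget serves twice: in a formula
  they come from the children of one gate, at the root from the copies of the template for all
  partial assignments.\<close>

lemma or_gadget:
  assumes xss: "\<And>xs. xs \<in> set xss \<Longrightarrow> confined (p + 3) r xs"
    and yss: "\<And>ys. ys \<in> set yss \<Longrightarrow> confined (p + 3) r ys"
    and ends: "\<And>xs ys. xs \<in> set xss \<Longrightarrow> ys \<in> set yss \<Longrightarrow> ends_match_ends xs ys"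
    and r: "p + 3 \<le> r" and ne: "yss \<noteq> []"
  shows "is_gadget p (r + 3) (\<exists>xs\<in>set xss. \<exists>ys\<in>set yss. trav matches xs ys)
    (or_rows (2*p, 2*p) (2*p+4, 2*r-1) (2*p+5, 2*r) (2*r+4, 2*r+4) xss)
    (or_cols (2*p, 2*p) (2*p+4, 2*r) (2*p+4, 2*p+4) (2*p+5, 2*p+5) (2*r, 2*r) (2*r+4, 2*r+4) yss)"
    (is "is_gadget _ _ _ ?P ?Q")
proof -
  have x: "2 * p + 6 \<le> L \<and> L \<le> R \<and> R < 2 * r" if "xs \<in> set xss" "(L, R) \<in> set xs" for xs L R
    using xss[OF that(1)] that(2) unfolding confined_def by auto
  have y: "2 * p + 6 \<le> L \<and> L \<le> R \<and> R < 2 * r" if "xs \<in> set yss" "(L, R) \<in> set xs" for xs L R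
    using yss[OF that(1)] that(2) unfolding confined_def by auto
  have "confined p (r + 3) ?P" unfolding confined_def or_rows_def using r by (auto dest: x)
  moreover have "confined p (r + 3) ?Q" unfolding confined_def or_cols_def using r by (auto dest: y)
  moreover have "ends_match_ends ?P ?Q"
  proof -
    have "\<not> matches (2*p, 2*p) y" if "y \<in> set (tl ?Q)" for y
    proof -
      obtain l q where lq: "y = (l, q)" by (cases y)
      have "2 * p < l \<and> l \<le> q" using that r unfolding or_cols_def lq by (auto split: if_splits dest: y)
      then show ?thesis unfolding lq by (intro not_matches_disjoint) auto
    qed
    moreover have "\<not> matches (2*r+4, 2*r+4) y" if "y \<in> set (butlast ?Q)" for y
    proof -
      obtain l q where lq: "y = (l, q)" by (cases y)
      have "l \<le> q \<and> q < 2 * r + 4" using that r unfolding or_cols_def lq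
        by (auto simp: butlast_append split: if_splits dest: y)
      then show ?thesis unfolding lq by (intro not_matches_disjoint) auto
    qed
    ultimately show ?thesis unfolding ends_match_ends_def by (simp add: or_rows_def or_cols_def)
  qed
  moreover have "trav matches ?P ?Q \<longleftrightarrow> (\<exists>xs\<in>set xss. \<exists>ys\<in>set yss. trav matches xs ys)"
  proof
    have far: "\<not> matches z (2*p+4, 2*p+4) \<and> \<not> matches z (2*r, 2*r) \<and> \<not> matches z (2*p+5, 2*p+5)"
      if "xs \<in> set xss" "z \<in> set xs" for xs z
    proof -
      obtain L R where z: "z = (L, R)" by (cases z)
      show ?thesis using x[OF that(1), of L R] that(2) unfolding z
        by (intro conjI not_matches_disjoint) auto
    qed
    have fix1: "\<not> matches (2*p, 2*p) (2*p+4, 2*p+4)" "\<not> matches (2*p+5, 2*r) (2*p+4, 2*p+4)"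
      "\<not> matches (2*r+4, 2*r+4) (2*p+4, 2*p+4)" "\<not> matches (2*p+4, 2*r-1) (2*r, 2*r)"
      using r by (intro not_matches_disjoint; simp)+
    assume "trav matches ?P ?Q"
    then show "\<exists>xs\<in>set xss. \<exists>ys\<in>set yss. trav matches xs ys"
    proof (rule trav_or_sound)
      show "\<forall>xs\<in>set xss. xs \<noteq> []" using ends ne unfolding ends_match_ends_def
        by (meson list.set_sel(1))
    qed (use fix1 far ends in \<open>auto simp: ends_match_ends_def\<close>)
  next
    assume "\<exists>xs\<in>set xss. \<exists>ys\<in>set yss. trav matches xs ys"
    then obtain xs ys where *: "xs \<in> set xss" "ys \<in> set yss" "trav matches xs ys" by blast
    have inA: "matches z (2*p+4, 2*r)" if "xs \<in> set xss" "z \<in> set xs" for xs z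
    proof -
      obtain L R where z: "z = (L, R)" by (cases z)
      show ?thesis using x[OF that(1), of L R] that(2) unfolding z by (intro matches_inside) auto
    qed
    have inST: "matches (2*p+4, 2*r-1) z \<and> matches (2*p+5, 2*r) z" if "ys \<in> set yss" "z \<in> set ys" for ys z
    proof -
      obtain L R where z: "z = (L, R)" by (cases z)
      show ?thesis using y[OF that(1), of L R] that(2) unfolding z by (intro conjI matches_inside) auto
    qed
    show "trav matches ?P ?Q"
      by (rule trav_or_complete[OF *]) (use r inA inST in \<open>auto intro!: matches_inside\<close>)
  qed
  ultimately show ?thesis unfolding is_gadget_def by simp
qed

lemma is_gadget_disjoint:
  assumes "is_gadget a b v xs ys'" "is_gadget a' b' v' xs' ys" "b \<le> a' \<or> b' \<le> a"
  shows "\<not> trav matches xs ys" "ends_match_ends xs ys"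
proof -
  have sep: "\<not> matches x y" if "x \<in> set xs" "y \<in> set ys" for x y
    using assms that unfolding is_gadget_def by (intro confined_separate[of a b xs a' b' ys]) auto
  have ne: "xs \<noteq> []" "ys \<noteq> []" using assms unfolding is_gadget_def ends_match_ends_def by auto
  show "\<not> trav matches xs ys" using trav_hd_match[of matches xs ys] sep ne by (metis list.set_sel(1))
  show "ends_match_ends xs ys" unfolding ends_match_ends_def
    using ne sep[OF hd_in_set[OF ne(1)]] sep[OF last_in_set[OF ne(1)]]
    by (meson in_set_butlastD list.set_sel(2))
qed

text \<open>The bits of \<open>x\<close> and \<open>y\<close> together form the assignment: below, \<open>x\<close> only has low bits and \<open>y\<close> only
  high ones.\<close>

definition assignment :: "nat \<Rightarrow> nat \<Rightarrow> nat \<Rightarrow> bool" where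
  "assignment x y i \<longleftrightarrow> odd (x div 2 ^ (i - 1) + y div 2 ^ (i - 1))"

text \<open>At a literal, \<open>P\<close> is shifted by a bit of \<open>x\<close> and
  \<open>Q\<close> by that bit of \<open>y\<close> plus \<open>b\<close> modulo 2; the two points
  coincide exactly if the sum of both bits has the parity of \<open>b\<close>. This does not depend
  on which number owns the variable, so \<open>x\<close> and \<open>y\<close> can be
  arbitrary.\<close>

lemma tmpl_gadget:
  assumes "formula_over n F"
  shows "is_gadget p (p + glen F) (eval (assignment x y) F) (map (plabel x) (tmpl p F)) (map (qlabel y)
      (tmpl p F))"
  using assms
proof (induction F arbitrary: p)
  case (Lit b i)
  let ?a = "x div 2 ^ (i - 1)" and ?b = "y div 2 ^ (i - 1)"
  have m: "matches (u, u) (v, v) \<longleftrightarrow> u = v" for u v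
    using matches_inside[of u v v u] not_matches_disjoint[of u u v v] by (cases u v rule: linorder_cases) auto
  have tr: "trav matches [u] [v] \<longleftrightarrow> matches u v" for u v
    using trav_hd_match[of matches "[u]" "[v]"] trav.single[of matches u v] by auto
  have "?a mod 2 = (?b + of_bool b) mod 2 \<longleftrightarrow> assignment x y i = b"
    unfolding assignment_def by (cases b) (auto simp: mod2_eq_if)
  then show ?case
    by (auto simp: is_gadget_def ends_match_ends_def confined_def plabel_def qlabel_def tr m)
next
  case (And Fs)
  then have "is_gadget p (p + sum_list (map glen Fs)) (\<forall>F\<in>set Fs. eval (assignment x y) F)
    (map (plabel x) (concat (kids 0 p Fs))) (map (qlabel y) (concat (kids 0 p Fs)))"
    by (intro and_gadget And.IH) auto
  then show ?case by simp
next
  case (Or Fs)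
  let ?r = "or_end p Fs" and ?\<alpha> = "assignment x y"
  let ?xss = "map (map (plabel x)) (kids 2 (p + 3) Fs)" and ?yss = "map (map (qlabel y)) (kids 2 (p + 3) Fs)"
  have ov: "formula_over n F" if "F \<in> set Fs" for F using that Or.prems by auto
  have G: "is_gadget q (q + glen F) (eval ?\<alpha> F) (map (plabel x) (tmpl q F)) (map (qlabel y) (tmpl q F))"
    if "F \<in> set Fs" for F q using Or.IH that ov by auto
  have wi: "confined (p + 3) ?r (map (plabel x) c) \<and> confined (p + 3) ?r (map (qlabel y) c)"
    if c: "c \<in> set (kids 2 (p + 3) Fs)" for c
  proof -
    from kids_cells[OF c] obtain q F where
      "F \<in> set Fs" "c = tmpl q F" "p + 3 + 2 \<le> q" "q + glen F \<le> ?r"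
      unfolding or_end_def by auto
    then show ?thesis using G[of F q] confined_mono[of q "q + glen F" _ "p + 3" ?r]
      unfolding is_gadget_def by simp
  qed
  have pairs: "ends_match_ends (map (plabel x) c) (map (qlabel y) c') \<and>
      (trav matches (map (plabel x) c) (map (qlabel y) c') \<longrightarrow> (\<exists>F\<in>set Fs. eval ?\<alpha> F))"
    if c: "c \<in> set (kids 2 (p + 3) Fs)" "c' \<in> set (kids 2 (p + 3) Fs)" for c c'
  proof -
    from kids_pairs[OF c] obtain q F q' F' where
      F: "F \<in> set Fs" "F' \<in> set Fs" "c = tmpl q F" "c' = tmpl q' F'" and
      d: "q = q' \<and> F = F' \<or> q + glen F \<le> q' \<or> q' + glen F' \<le> q" by blast
    show ?thesis
    proof (cases "q = q' \<and> F = F'")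
      case True
      then show ?thesis using F G[of F q] unfolding is_gadget_def by auto
    next
      case False
      then show ?thesis using is_gadget_disjoint[OF G[OF F(1), of q] G[OF F(2), of q']] d F by auto
    qed
  qed
  have "is_gadget p (?r + 3) (\<exists>xs\<in>set ?xss. \<exists>ys\<in>set ?yss. trav matches xs ys)
    (map (plabel x) (tmpl p (Or Fs))) (map (qlabel y) (tmpl p (Or Fs)))"
    unfolding tmpl.simps plabel_or qlabel_or
  proof (rule or_gadget)
    show "p + 3 \<le> ?r" unfolding or_end_def by simp
    show "?yss \<noteq> []" using Or.prems by (cases Fs) auto
  qed (use wi pairs in auto)
  moreover have "(\<exists>xs\<in>set ?xss. \<exists>ys\<in>set ?yss. trav matches xs ys) \<longleftrightarrow> (\<exists>F\<in>set Fs. eval ?\<alpha> F)"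
  proof
    assume "\<exists>F\<in>set Fs. eval ?\<alpha> F"
    then obtain F where F: "F \<in> set Fs" "eval ?\<alpha> F" by blast
    from kids_member[OF F(1)] obtain q where "tmpl q F \<in> set (kids 2 (p + 3) Fs)" by blast
    then show "\<exists>xs\<in>set ?xss. \<exists>ys\<in>set ?yss. trav matches xs ys"
      using G[OF F(1), of q] F(2) unfolding is_gadget_def by auto
  qed (use pairs in auto)
  moreover have "?r + 3 = p + glen (Or Fs)" unfolding or_end_def by simp
  ultimately show ?case by simp
qed

section \<open>Two half assignments and the root gadget\<close>

lemma eval_cong:
  assumes "formula_over n F" "\<forall>i. 1 \<le> i \<and> i \<le> n \<longrightarrow> \<alpha> i = \<beta> i"
  shows "eval \<alpha> F = eval \<beta> F"
  using assms(1)
proof (induction F)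
  case (Lit b i)
  then show ?case using assms(2) by simp
qed simp_all

lemma nat_with_bits: "\<exists>a::nat. a < 2 ^ h \<and> (\<forall>k. bit a k \<longleftrightarrow> k < h \<and> \<beta> k)"
proof -
  let ?a = "horner_sum of_bool 2 (map \<beta> [0..<h]) :: nat"
  have "?a < 2 ^ h" using horner_sum_of_bool_2_less[of "map \<beta> [0..<h]", where 'a = nat] by simp
  moreover have "bit ?a k \<longleftrightarrow> k < h \<and> \<beta> k" for k
    by (subst bit_horner_sum_bit_iff) auto
  ultimately show ?thesis by blast
qed

text \<open>\<open>a\<close> carries the first \<open>h\<close> variables and \<open>b\<close> the
  remaining ones. After shifting \<open>b\<close> by \<open>h\<close> bits the supports are
  disjoint, so the parity of the sum of two bits is just the bit of the owner.\<close>

lemma assignment_surj: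
  assumes "n \<le> 2 * h"
  shows "\<exists>a<2^h. \<exists>b<2^h. \<forall>i. 1 \<le> i \<and> i \<le> n \<longrightarrow> assignment a (b * 2 ^ h) i = \<alpha> i"
proof -
  obtain a :: nat where a: "a < 2 ^ h" "\<forall>k. bit a k \<longleftrightarrow> k < h \<and> \<alpha> (Suc k)"
    using nat_with_bits[of h "\<lambda>k. \<alpha> (Suc k)"] by blast
  obtain b :: nat where b: "b < 2 ^ h" "\<forall>k. bit b k \<longleftrightarrow> k < h \<and> \<alpha> (Suc (h + k))"
    using nat_with_bits[of h "\<lambda>k. \<alpha> (Suc (h + k))"] by blast
  have "assignment a (b * 2 ^ h) i = \<alpha> i" if i: "1 \<le> i" "i \<le> n" for i
  proof -
    have "assignment a (b * 2 ^ h) i \<longleftrightarrow> (bit a (i - 1) \<noteq> bit (push_bit h b) (i - 1))"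
      unfolding assignment_def bit_iff_odd push_bit_eq_mult even_add by blast
    also have "bit (push_bit h b) (i - 1) \<longleftrightarrow> h \<le> i - 1 \<and> bit b (i - 1 - h)"
      by (simp add: bit_push_bit_iff)
    also have "(bit a (i - 1) \<noteq> (h \<le> i - 1 \<and> bit b (i - 1 - h))) \<longleftrightarrow> \<alpha> i"
    proof (cases "h \<le> i - 1")
      case True
      then have "i - 1 - h < h" "Suc (h + (i - 1 - h)) = i" using i assms by auto
      then show ?thesis using True a(2) b(2) by auto
    next
      case False
      then have "i - 1 < h" "Suc (i - 1) = i" using i by auto
      then show ?thesis using False a(2) by auto
    qed
    finally show ?thesis .
  qed
  with a(1) b(1) show ?thesis by (intro exI[of _ a] exI[of _ b] conjI) auto
qed

text \<open>An OR gate at position 0 with the single child \<open>F\<close>, cut where the copied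
  part begins and ends. Head and separators take positions 0 to 4, so \<open>F\<close> starts at
  5.\<close>

definition big_cells :: "formula \<Rightarrow> (cell list \<times> cell list \<times> cell list)" where
  "big_cells F = (or_head 0 (5 + glen F), or_sep 0 (5 + glen F) @ tmpl 5 F, or_tail 0 (5 + glen F))"

definition plabels :: "nat \<Rightarrow> formula \<Rightarrow> (nat \<times> nat) list" where
  "plabels h F = (let (u, v, w) = big_cells F in
     map (plabel 0) u @ concat (map (\<lambda>a. map (plabel a) v) [0..<2^h]) @ map (plabel 0) w)"

definition qlabels :: "nat \<Rightarrow> formula \<Rightarrow> (nat \<times> nat) list" where
  "qlabels h F = (let (u, v, w) = big_cells F in
     map (qlabel 0) u @ concat (map (\<lambda>b. map (qlabel (b * 2^h)) v) [0..<2^h]) @ map (qlabel 0) w)"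

text \<open>All copies of \<open>F\<close> share one range of labels. Hence, unlike different
  children of an inner OR gate, any block of \<open>P\<close> can meet any block of
  \<open>Q\<close>, which gives the choice of both half assignments.\<close>

lemma labels_gadget:
  assumes F: "formula_over n F" and n: "n \<le> 2 * h"
  shows "is_gadget 0 (8 + glen F) (satisfiable F) (plabels h F) (qlabels h F)"
proof -
  let ?r = "5 + glen F"
  let ?xss = "map (\<lambda>a. map (plabel a) (tmpl 5 F)) [0..<2^h]"
  let ?yss = "map (\<lambda>b. map (qlabel (b * 2^h)) (tmpl 5 F)) [0..<2^h]"
  have P: "plabels h F = or_rows (2*0, 2*0) (2*0+4, 2*?r-1) (2*0+5, 2*?r) (2*?r+4, 2*?r+4) ?xss"
    by (simp add: plabels_def big_cells_def or_rows_def or_head_def or_sep_def or_tail_def leaf_def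
        plabel_def comp_def)
  have Q: "qlabels h F = or_cols (2*0, 2*0) (2*0+4, 2*?r) (2*0+4, 2*0+4) (2*0+5, 2*0+5) (2*?r, 2*?r)
      (2*?r+4, 2*?r+4) ?yss"
    by (simp add: qlabels_def big_cells_def or_cols_def or_head_def or_sep_def or_tail_def leaf_def
        qlabel_def comp_def)
  note G = tmpl_gadget[OF F, of 5]
  have "is_gadget 0 (?r + 3) (\<exists>xs\<in>set ?xss. \<exists>ys\<in>set ?yss. trav matches xs ys) (plabels h F) (qlabels h F)"
    unfolding P Q by (rule or_gadget)
      (use G confined_mono[of 5 "5 + glen F" _ 3 "5 + glen F"] in \<open>auto simp: is_gadget_def\<close>)
  moreover have "(\<exists>xs\<in>set ?xss. \<exists>ys\<in>set ?yss. trav matches xs ys) \<longleftrightarrow> satisfiable F"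
  proof
    assume "\<exists>xs\<in>set ?xss. \<exists>ys\<in>set ?yss. trav matches xs ys"
    then show "satisfiable F" using G unfolding is_gadget_def satisfiable_def by fastforce
  next
    assume "satisfiable F"
    then obtain \<alpha> where \<alpha>: "eval \<alpha> F" unfolding satisfiable_def by blast
    obtain a b where ab: "a < 2^h" "b < 2^h" "\<forall>i. 1 \<le> i \<and> i \<le> n \<longrightarrow> assignment a (b * 2 ^ h) i = \<alpha> i"
      using assignment_surj[OF n] by blast
    have "eval (assignment a (b * 2 ^ h)) F" using \<alpha> eval_cong[OF F ab(3)] by blast
    then have "trav matches (map (plabel a) (tmpl 5 F)) (map (qlabel (b * 2 ^ h)) (tmpl 5 F))"
      using G unfolding is_gadget_def by blast
    then show "\<exists>xs\<in>set ?xss. \<exists>ys\<in>set ?yss. trav matches xs ys" using ab(1,2)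
      by (intro bexI[of _ "map (plabel a) (tmpl 5 F)"] bexI[of _ "map (qlabel (b * 2 ^ h)) (tmpl 5 F)"]) auto
  qed
  ultimately show ?thesis by (simp add: add.commute)
qed

lemma trav_map: "trav m (map f xs) (map g ys) \<longleftrightarrow> trav (\<lambda>x y. m (f x) (g y)) xs ys"
proof
  assume "trav m (map f xs) (map g ys)"
  then show "trav (\<lambda>x y. m (f x) (g y)) xs ys"
  proof (induction "map f xs" "map g ys" arbitrary: xs ys rule: trav.induct)
    case (single x y)
    then show ?case by (auto intro: trav.single)
  next
    case (row x y as bs)
    then obtain x' xs' where "xs = x' # xs'" by auto
    moreover obtain y' ys' where "ys = y' # ys'" using row by auto
    ultimately show ?case using row by (auto intro: trav.row)
  next
    case (col x y as bs)
    then obtain x' xs' where "xs = x' # xs'" by auto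
    moreover obtain y' ys' where "ys = y' # ys'" using col by auto
    ultimately show ?case using col by (auto intro: trav.col)
  next
    case (diag x y as bs)
    then obtain x' xs' where "xs = x' # xs'" by auto
    moreover obtain y' ys' where "ys = y' # ys'" using diag by auto
    ultimately show ?case using diag by (auto intro: trav.diag)
  qed
next
  assume "trav (\<lambda>x y. m (f x) (g y)) xs ys"
  then show "trav m (map f xs) (map g ys)"
    by (induction rule: trav.induct) (auto intro: trav.intros)
qed

lemma trav_cong:
  assumes "\<And>x y. x \<in> set xs \<Longrightarrow> y \<in> set ys \<Longrightarrow> m x y = m' x y"
  shows "trav m xs ys \<longleftrightarrow> trav m' xs ys"
proof -
  have "trav m xs ys \<Longrightarrow> (\<And>x y. x \<in> set xs \<Longrightarrow> y \<in> set ys \<Longrightarrow> m x y = m' x y) \<Longrightarrow> trav m' xs ys"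
    for m m' :: "'a \<Rightarrow> 'b \<Rightarrow> bool" by (induction rule: trav.induct) (auto intro: trav.intros)
  then show ?thesis using assms by metis
qed

text \<open>All labels are below \<open>X\<close> because the root gadget is confined to the
  positions below \<open>8 + glen F\<close>.\<close>

lemma frechet_labels:
  assumes F: "formula_over n F" and n: "n \<le> 2 * h"
  defines "X \<equiv> 2 * (8 + glen F)"
  shows "frechet_dist (map (pvert X) (plabels h F)) (map (qvert X) (qlabels h F)) \<le> 1 \<longleftrightarrow> satisfiable F"
proof -
  note G = labels_gadget[OF F n]
  have "plabels h F \<noteq> []" "qlabels h F \<noteq> []" using G unfolding is_gadget_def ends_match_ends_def by auto
  then have "frechet_dist (map (pvert X) (plabels h F)) (map (qvert X) (qlabels h F)) \<le> 1 \<longleftrightarrow>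
    trav (\<lambda>p q. norm (pvert X p - qvert X q) \<le> 1) (plabels h F) (qlabels h F)"
    by (simp add: frechet_dist_le_iff trav_map)
  also have "\<dots> \<longleftrightarrow> trav matches (plabels h F) (qlabels h F)"
  proof (rule trav_cong)
    fix x y assume "x \<in> set (plabels h F)" "y \<in> set (qlabels h F)"
    moreover obtain L R l r where xy: "x = (L, R)" "y = (l, r)" by (cases x; cases y) blast
    ultimately have "L \<le> R \<and> R < X" "l \<le> r \<and> r < X"
      using G unfolding is_gadget_def confined_def X_def by auto
    then show "(norm (pvert X x - qvert X y) \<le> 1) = matches x y"
      unfolding xy by (intro dist_le_1_iff_matches) auto
  qed
  also have "\<dots> \<longleftrightarrow> satisfiable F" using G unfolding is_gadget_def by simp
  finally show ?thesis .
qed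

section \<open>Semantics of straight-line programs and loops\<close>

text \<open>No loop body of the program contains a loop, so its effect is a function of the state
  and its cost has a constant bound, for which \<open>cost\<close> adds both branches of a
  conditional. The values of \<open>cost\<close> and \<open>sem\<close> at a loop are
  dummies.\<close>

fun while_free :: "program \<Rightarrow> bool" where
  "while_free (Instr i) = True"
| "while_free (Seq p q) = (while_free p \<and> while_free q)"
| "while_free (IfLess r1 r2 p q) = (while_free p \<and> while_free q)"
| "while_free (WhileLess r1 r2 p) = False"

fun cost :: "program \<Rightarrow> nat" where
  "cost (Instr i) = 1"
| "cost (Seq p q) = cost p + cost q"
| "cost (IfLess r1 r2 p q) = cost p + cost q + 1"
| "cost (WhileLess r1 r2 p) = 0"

fun sem :: "nat \<Rightarrow> program \<Rightarrow> state \<Rightarrow> state" where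
  "sem w (Instr i) \<sigma> = step w i \<sigma>"
| "sem w (Seq p q) \<sigma> = sem w q (sem w p \<sigma>)"
| "sem w (IfLess r1 r2 p q) \<sigma> = (if fst \<sigma> r1 < fst \<sigma> r2 then sem w p \<sigma> else sem w q \<sigma>)"
| "sem w (WhileLess r1 r2 p) \<sigma> = \<sigma>"

lemma exec_while_free: "while_free p \<Longrightarrow> \<exists>t\<le>cost p. exec w p \<sigma> t (sem w p \<sigma>)"
proof (induction p arbitrary: \<sigma>)
  case (Instr i)
  have "exec w (Instr i) \<sigma> 1 (sem w (Instr i) \<sigma>)" unfolding sem.simps by (rule exec.Instr)
  then show ?case by (intro exI[of _ 1]) simp
next
  case (Seq p q)
  obtain t where t: "t \<le> cost p" "exec w p \<sigma> t (sem w p \<sigma>)" using Seq.IH(1)[of \<sigma>] Seq.prems by auto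
  obtain u where u: "u \<le> cost q" "exec w q (sem w p \<sigma>) u (sem w q (sem w p \<sigma>))"
    using Seq.IH(2)[of "sem w p \<sigma>"] Seq.prems by auto
  have "exec w (Seq p q) \<sigma> (t + u) (sem w (Seq p q) \<sigma>)" unfolding sem.simps using t u by (intro exec.Seq)
  then show ?case using t u by (intro exI[of _ "t + u"]) simp
next
  case (IfLess r1 r2 p q)
  obtain t where t: "t \<le> cost p" "exec w p \<sigma> t (sem w p \<sigma>)" using IfLess.IH(1)[of \<sigma>] IfLess.prems by auto
  obtain u where u: "u \<le> cost q" "exec w q \<sigma> u (sem w q \<sigma>)" using IfLess.IH(2)[of \<sigma>] IfLess.prems by auto
  show ?case
  proof (cases "fst \<sigma> r1 < fst \<sigma> r2")
    case True
    then have "exec w (IfLess r1 r2 p q) \<sigma> (t + 1) (sem w (IfLess r1 r2 p q) \<sigma>)"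
      using exec.IfTrue[OF True t(2)] by simp
    then show ?thesis using t by (intro exI[of _ "t + 1"]) simp
  next
    case False
    then have "exec w (IfLess r1 r2 p q) \<sigma> (u + 1) (sem w (IfLess r1 r2 p q) \<sigma>)"
      using exec.IfFalse[OF False u(2)] by simp
    then show ?thesis using u by (intro exI[of _ "u + 1"]) simp
  qed
qed simp

fun iterate :: "nat \<Rightarrow> nat \<Rightarrow> nat \<Rightarrow> program \<Rightarrow> nat \<Rightarrow> state \<Rightarrow> state \<Rightarrow> bool" where
  "iterate w r1 r2 p 0 \<sigma> \<sigma>' \<longleftrightarrow> \<sigma> = \<sigma>'"
| "iterate w r1 r2 p (Suc k) \<sigma> \<sigma>' \<longleftrightarrow> fst \<sigma> r1 < fst \<sigma> r2 \<and> iterate w r1 r2 p k (sem w p \<sigma>) \<sigma>'"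

lemma iterate_trans:
  "iterate w r1 r2 p j \<sigma> \<sigma>' \<Longrightarrow> iterate w r1 r2 p k \<sigma>' \<sigma>'' \<Longrightarrow> iterate w r1 r2 p (j + k) \<sigma> \<sigma>''"
  by (induction j arbitrary: \<sigma>) auto

lemma iterate_invariant:
  assumes "I 0 \<sigma>" "\<And>t \<sigma>. t < k \<Longrightarrow> I t \<sigma> \<Longrightarrow> fst \<sigma> r1 < fst \<sigma> r2 \<and> I (Suc t) (sem w p \<sigma>)"
  shows "\<exists>\<sigma>'. iterate w r1 r2 p k \<sigma> \<sigma>' \<and> I k \<sigma>'"
  using assms
proof (induction k arbitrary: \<sigma> I)
  case (Suc k)
  have "\<exists>\<sigma>'. iterate w r1 r2 p k (sem w p \<sigma>) \<sigma>' \<and> I (Suc k) \<sigma>'"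
  proof (rule Suc.IH)
    show "I (Suc 0) (sem w p \<sigma>)" using Suc.prems(2)[of 0 \<sigma>] Suc.prems(1) by blast
    show "fst \<sigma> r1 < fst \<sigma> r2 \<and> I (Suc (Suc t)) (sem w p \<sigma>)" if "t < k" "I (Suc t) \<sigma>" for t \<sigma>
      using Suc.prems(2)[of "Suc t" \<sigma>] that by blast
  qed
  moreover have "fst \<sigma> r1 < fst \<sigma> r2" using Suc.prems(2)[of 0 \<sigma>] Suc.prems(1) by blast
  ultimately show ?case by simp
qed auto

lemma exec_while:
  assumes "while_free p" "iterate w r1 r2 p k \<sigma> \<sigma>'" "\<not> fst \<sigma>' r1 < fst \<sigma>' r2"
  shows "\<exists>t\<le>k * (cost p + 1) + 1. exec w (WhileLess r1 r2 p) \<sigma> t \<sigma>'"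
  using assms(2)
proof (induction k arbitrary: \<sigma>)
  case 0
  then have "exec w (WhileLess r1 r2 p) \<sigma> 1 \<sigma>'" using assms(3) exec.WhileFalse[of \<sigma> r1 r2 w p] by simp
  then show ?case by (intro exI[of _ 1]) simp
next
  case (Suc k)
  obtain t where t: "t \<le> cost p" "exec w p \<sigma> t (sem w p \<sigma>)" using exec_while_free assms(1) by blast
  obtain u where u: "u \<le> k * (cost p + 1) + 1" "exec w (WhileLess r1 r2 p) (sem w p \<sigma>) u \<sigma>'"
    using Suc.IH[of "sem w p \<sigma>"] Suc.prems by fastforce
  have "exec w (WhileLess r1 r2 p) \<sigma> (t + u + 1) \<sigma>'"
    using exec.WhileTrue[OF _ t(2) u(2)] Suc.prems by simp
  then show ?case using t u by (intro exI[of _ "t + u + 1"]) auto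
qed

section \<open>Arithmetic without overflow, registers and the output of cells\<close>

text \<open>These rules replace the modular equations, which are withdrawn from simplification
  below. Symbolic execution then yields plain arithmetic, but only where the absence of overflow has
  been proved.\<close>

lemma add_word [simp]: "x + y < 2 ^ w \<Longrightarrow> arith_op w Add x y = x + y" by simp
lemma sub_word [simp]:
  assumes "y \<le> x" "x < 2 ^ w" shows "arith_op w Sub x y = x - y"
proof -
  have "int x < int (2 ^ w)" using assms(2) by (simp only: of_nat_less_iff)
  then have "int x - int y < int (2 ^ w)" by linarith
  then have "int x - int y < 2 ^ w" unfolding of_nat_power of_nat_numeral .
  moreover have "0 \<le> int x - int y" using assms(1) by simp
  ultimately have this: "int x - int y < 2 ^ w" "0 \<le> int x - int y" by this+
  from mod_pos_pos_trivial[OF this(2,1)] show ?thesis using assms(1)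
    unfolding arith_op.simps by simp
qed
lemma mul_word [simp]: "x * y < 2 ^ w \<Longrightarrow> arith_op w Mul x y = x * y" by simp

declare arith_op.simps(1-3) [simp del]

abbreviation (input) cst where "cst r k \<equiv> Instr (Const r k)"
abbreviation (input) ar where "ar f r a b \<equiv> Instr (Arith f r a b)"
abbreviation (input) ld where "ld r a \<equiv> Instr (Load r a)"
abbreviation (input) st where "st a r \<equiv> Instr (Store a r)"
notation Seq (infixr ";;" 60)

text \<open>Registers 0 to 2 serve input and output, 3 to 8 hold constants, 9 to 24 are working
  registers of the parser, and 25 to 28 survive parsing. With this order two comparisons express
  what the parser preserves.\<close>

abbreviation (input) "rZ \<equiv> 3 :: nat"
abbreviation (input) "rOne \<equiv> 4 :: nat"
abbreviation (input) "rTwo \<equiv> 5 :: nat"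
abbreviation (input) "rFour \<equiv> 6 :: nat"
abbreviation (input) "rSix \<equiv> 7 :: nat"
abbreviation (input) "rEight \<equiv> 8 :: nat"
abbreviation (input) "rSP \<equiv> 9 :: nat"
abbreviation (input) "rIP \<equiv> 10 :: nat"
abbreviation (input) "rTP \<equiv> 11 :: nat"
abbreviation (input) "rLab \<equiv> 12 :: nat"
abbreviation (input) "rT2 \<equiv> 13 :: nat"
abbreviation (input) "rAd \<equiv> 14 :: nat"
abbreviation (input) "rRem \<equiv> 15 :: nat"
abbreviation (input) "rQ \<equiv> 16 :: nat"
abbreviation (input) "rTag \<equiv> 17 :: nat"
abbreviation (input) "rK \<equiv> 18 :: nat"
abbreviation (input) "rPw \<equiv> 19 :: nat"
abbreviation (input) "rSg \<equiv> 20 :: nat"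
abbreviation (input) "rS \<equiv> 21 :: nat"
abbreviation (input) "rT \<equiv> 22 :: nat"
abbreviation (input) "rA6 \<equiv> 23 :: nat"
abbreviation (input) "rA7 \<equiv> 24 :: nat"
abbreviation (input) "rSB \<equiv> 25 :: nat"
abbreviation (input) "rTB \<equiv> 26 :: nat"
abbreviation (input) "rH \<equiv> 27 :: nat"
abbreviation (input) "rC \<equiv> 28 :: nat"

text \<open>Since upper ends are stored as addresses, passing \<open>rTP\<close> or
  \<open>rT2\<close> for one of them refers to the lower end in the same cell and makes the interval
  a point.\<close>

definition emit :: "nat \<Rightarrow> nat \<Rightarrow> nat \<Rightarrow> nat \<Rightarrow> nat \<Rightarrow> nat \<Rightarrow> program" where
  "emit a b c d e f = ar Add rT2 rTP rTwo ;; st rTP a ;; ar Add rAd rTP rOne ;; st rAd b ;;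
     ar Add rAd rAd rOne ;; st rAd c ;; ar Add rAd rAd rOne ;; st rAd d ;; ar Add rAd rAd rOne ;; st rAd e ;;
     ar Add rAd rAd rOne ;; st rAd f ;; ar Add rTP rTP rEight ;; ar Add rLab rLab rTwo"

definition put_cell :: "(nat \<Rightarrow> nat) \<Rightarrow> nat \<Rightarrow> nat \<Rightarrow> nat \<Rightarrow> nat \<Rightarrow> nat \<Rightarrow> nat \<Rightarrow> nat \<Rightarrow> nat \<Rightarrow> nat" where
  "put_cell M x a b c d e f = M(x := a, x + 1 := b, x + 2 := c, x + 3 := d, x + 4 := e, x + 5 := f)"

definition small_consts :: "(nat \<Rightarrow> nat) \<Rightarrow> bool" where
  "small_consts R \<longleftrightarrow> R rZ = 0 \<and> R rOne = 1 \<and> R rTwo = 2 \<and> R rFour = 4 \<and> R rSix = 6 \<and> R rEight = 8"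

lemma put_cell_Suc: "put_cell M x a b c d e f = M(x := a, Suc x := b, Suc (Suc x) := c,
    Suc (Suc (Suc x)) := d, Suc (Suc (Suc (Suc x))) := e, Suc (Suc (Suc (Suc (Suc x)))) := f)"
  by (simp add: put_cell_def eval_nat_numeral)

lemma sem_emit:
  assumes "small_consts R" "R rTP + 8 < 2 ^ w" "R rLab + 2 < 2 ^ w" "rAd \<notin> {a, b, c, d, e, f}"
  shows "sem w (emit a b c d e f) (R, M) =
    (R(rT2 := R rTP + 2, rAd := Suc (Suc (Suc (Suc (Suc (R rTP))))), rTP := R rTP + 8, rLab := R rLab + 2),
     let R' = R(rT2 := R rTP + 2) in put_cell M (R rTP) (R' a) (R' b) (R' c) (R' d) (R' e) (R' f))"
  using assms by (simp add: emit_def small_consts_def put_cell_Suc Let_def)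

section \<open>Parsing the formula\<close>

text \<open>A cell occupies eight words. Upper ends are stored indirectly, as addresses in the range from
  \<open>lo\<close> to \<open>hi\<close>; the last two words of the first cell of an OR gate are such slots.\<close>

definition cell_stored :: "(nat \<Rightarrow> nat) \<Rightarrow> nat \<Rightarrow> nat \<Rightarrow> nat \<Rightarrow> cell \<Rightarrow> bool" where
  "cell_stored M lo hi x = (\<lambda>(pl, ph, ql, qh, pw, sg).
     M x = pl \<and> lo \<le> M (x + 1) \<and> M (x + 1) < hi \<and> M (M (x + 1)) = ph \<and>
     M (x + 2) = ql \<and> lo \<le> M (x + 3) \<and> M (x + 3) < hi \<and> M (M (x + 3)) = qh \<and>
     M (x + 4) = pw \<and> M (x + 5) = sg)"

fun cells_stored :: "(nat \<Rightarrow> nat) \<Rightarrow> nat \<Rightarrow> nat \<Rightarrow> nat \<Rightarrow> cell list \<Rightarrow> bool" where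
  "cells_stored M lo hi x [] = True"
| "cells_stored M lo hi x (c # cs) = (cell_stored M lo hi x c \<and> cells_stored M lo hi (x + 8) cs)"

lemma cells_stored_append: "cells_stored M lo hi x (cs @ cs') \<longleftrightarrow> cells_stored M lo hi x cs \<and> cells_stored
    M lo hi (x + 8 * length cs) cs'"
  by (induction cs arbitrary: x) (auto simp: algebra_simps)

lemma cells_stored_mono: "cells_stored M lo hi x cs \<Longrightarrow> lo' \<le> lo \<Longrightarrow> hi \<le> hi' \<Longrightarrow> cells_stored M lo' hi' x cs"
  by (induction cs arbitrary: x) (auto simp: cell_stored_def)

lemma cells_stored_cong:
  assumes "cells_stored M lo hi x cs" "\<And>y. lo \<le> y \<Longrightarrow> y < hi \<Longrightarrow> M' y = M y" "lo \<le> x" "x + 8 * length cs \<le> hi"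
  shows "cells_stored M' lo hi x cs"
  using assms(1,3,4)
proof (induction cs arbitrary: x)
  case (Cons c cs)
  have "M' (x + i) = M (x + i)" if "i < 8" for i using assms(2)[of "x + i"] Cons.prems that by auto
  from this[of 0] this[of 1] this[of 2] this[of 3] this[of 4] this[of 5]
    \<open>cells_stored M lo hi x (c # cs)\<close>
  have "cell_stored M' lo hi x c" using assms(2)[of "M (x + 1)"] assms(2)[of "M (x + 3)"]
    unfolding cells_stored.simps cell_stored_def by (auto split: prod.splits)
  then show ?case using Cons by auto
qed simp

lemma cells_stored_nth: "cells_stored M lo hi x cs \<Longrightarrow> i < length cs \<Longrightarrow> cell_stored M lo hi (x + 8 * i) (cs ! i)"
proof (induction cs arbitrary: x i)
  case (Cons c cs)
  show ?case
  proof (cases i)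
    case (Suc j)
    then have "cell_stored M lo hi (x + 8 + 8 * j) (cs ! j)" using Cons by auto
    then show ?thesis using Suc by (simp add: algebra_simps)
  qed (use Cons in auto)
qed simp

text \<open>Word 0 of the first cell of the gate is its label \<open>2p\<close>, so the address in
  \<open>rQ\<close> is enough to recover the lower ends of \<open>s\<close> and \<open>t\<close> as
  well as the two slots.\<close>

definition or_addresses :: program where
  "or_addresses = ld rS rQ ;; ar Add rS rS rFour ;; ar Add rT rS rOne ;; ar Add rA6 rQ rSix ;; ar Add
      rA7 rA6 rOne"

definition sep_code :: program where
  "sep_code = or_addresses ;; emit rT rA7 rT rT2 rZ rZ ;; emit rS rA6 rT rT2 rZ rZ"

definition head_code :: program where
  "head_code = ar Add rQ rTP rZ ;; emit rLab rTP rLab rT2 rZ rZ ;; or_addresses ;;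
     emit rT rA7 rS rA7 rZ rZ ;; emit rT rA7 rS rT2 rZ rZ"

text \<open>On entry \<open>rLab\<close> is \<open>2r\<close>, the value that was unknown when the
  gate was opened; the slots receive \<open>2r - 1\<close> for \<open>s\<close> and
  \<open>2r\<close> for \<open>t\<close> and \<open>a\<close>. The first two cells raise
  \<open>rLab\<close> by 4, so the last cell is the point \<open>2r + 4\<close>.\<close>

definition tail_code :: program where
  "tail_code = or_addresses ;; st rA7 rLab ;; ar Sub rK rLab rOne ;; st rA6 rK ;;
     emit rT rA7 rLab rT2 rZ rZ ;; emit rT rA7 rS rA7 rZ rZ ;; emit rLab rTP rLab rT2 rZ rZ"

lemma sem_or_addresses:
  assumes "small_consts R" "R rQ + 7 < 2 ^ w" "M (R rQ) + 5 < 2 ^ w"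
  shows "sem w or_addresses (R, M) =
    (R(rS := M (R rQ) + 4, rT := M (R rQ) + 5, rA6 := R rQ + 6, rA7 := R rQ + 7), M)"
proof -
  have "sem w or_addresses (R, M) =
    (R(rS := M (R rQ) + 4, rT := Suc (M (R rQ) + 4), rA6 := R rQ + 6, rA7 := Suc (R rQ + 6)), M)"
    using assms by (simp add: or_addresses_def small_consts_def)
  moreover have "Suc (M (R rQ) + 4) = M (R rQ) + 5" "Suc (R rQ + 6) = R rQ + 7" by simp_all
  ultimately show ?thesis by (simp only:)
qed

lemma put_cell_other: "y < x \<or> x + 6 \<le> y \<Longrightarrow> put_cell M x a b c d e f y = M y"
  by (auto simp: put_cell_def)

definition advance :: "nat \<Rightarrow> (nat \<Rightarrow> nat) \<Rightarrow> (nat \<Rightarrow> nat) \<Rightarrow> bool" where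
  "advance k R R' \<longleftrightarrow> (\<forall>r. r < rSP \<or> rA7 < r \<longrightarrow> R' r = R r) \<and> R' rSP = R rSP \<and> R' rIP = R rIP \<and>
     R' rTP = R rTP + 8 * k \<and> R' rLab = R rLab + 2 * k"

definition sep_pair :: "nat \<Rightarrow> nat \<Rightarrow> nat \<Rightarrow> cell list" where
  "sep_pair b hS hT = [(b+5, hT, b+5, b+5, 0, 0), (b+4, hS, b+5, b+5, 0, 0)]"

text \<open>The slots are not filled yet. Quantifying over the values \<open>hS\<close> and
  \<open>hT\<close> that they will receive describes the cells as they will read once the gate is
  closed.\<close>

lemma sem_sep:
  assumes c: "small_consts R" and A: "R rTP = A" "A + 16 < 2 ^ w" and l: "R rLab + 4 < 2 ^ w"
    and q: "R rQ = q" "q + 8 \<le> A" "M q = b" "b + 5 < 2 ^ w"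
  shows "\<exists>R' M'. sem w sep_code (R, M) = (R', M') \<and> advance 2 R R' \<and>
    (\<forall>y. y < A \<or> A + 16 \<le> y \<longrightarrow> M' y = M y) \<and>
    (\<forall>hS hT. cells_stored (M'(q + 6 := hS, q + 7 := hT)) q (A + 16) A (sep_pair b hS hT))"
proof -
  \<comment> \<open>In this form simplification sees that the slots at \<open>q + 6\<close> and
    \<open>q + 7\<close> lie below the new cells.\<close>
  obtain e where e: "A = q + 8 + e" using q(2) le_Suc_ex by blast
  define M' where "M' = put_cell (put_cell M A (b+5) (q+7) (b+5) (A+2) 0 0) (A+8) (b+4) (q+6) (b+5) (10
      + A) 0 0"
  have "sem w sep_code (R, M) = (fst (sem w sep_code (R, M)), M') \<and> advance 2 R (fst (sem w sep_code (R, M)))"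
    using c A l q unfolding sep_code_def M'_def
    by (simp add: sem_or_addresses sem_emit small_consts_def Let_def advance_def)
  moreover have "\<forall>y. y < A \<or> A + 16 \<le> y \<longrightarrow> M' y = M y"
    unfolding M'_def by (simp add: put_cell_other)
  moreover have "cells_stored (M'(q + 6 := hS, q + 7 := hT)) q (A + 16) A (sep_pair b hS hT)" for hS hT
    unfolding M'_def sep_pair_def e by (simp add: cell_stored_def put_cell_def)
  ultimately show ?thesis by blast
qed

lemma sem_head:
  assumes c: "small_consts R" and A: "R rTP = A" "A + 24 < 2 ^ w" and l: "R rLab = b" "b + 6 < 2 ^ w"
  shows "\<exists>R' M'. sem w head_code (R, M) = (R', M') \<and> advance 3 R R' \<and>
    (\<forall>y. y < A \<or> A + 24 \<le> y \<longrightarrow> M' y = M y) \<and> M' A = b \<and>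
    (\<forall>hS hT. cells_stored (M'(A + 6 := hS, A + 7 := hT)) A (A + 24) A
      [(b, b, b, b, 0, 0), (b+5, hT, b+4, hT, 0, 0), (b+5, hT, b+4, b+4, 0, 0)])"
proof -
  define M' where "M' = put_cell (put_cell (put_cell M A b A b (A+2) 0 0)
    (A+8) (b+5) (A+7) (b+4) (A+7) 0 0) (16 + A) (b+5) (A+7) (b+4) (18 + A) 0 0"
  have MA: "put_cell M A b A b (A+2) 0 0 A = b" by (simp add: put_cell_def)
  have "sem w head_code (R, M) = (fst (sem w head_code (R, M)), M') \<and> advance 3 R (fst (sem w head_code
      (R, M)))"
    using c A l MA unfolding head_code_def M'_def
    by (simp add: sem_or_addresses sem_emit small_consts_def Let_def advance_def)
  moreover have "\<forall>y. y < A \<or> A + 24 \<le> y \<longrightarrow> M' y = M y"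
    unfolding M'_def by (simp add: put_cell_other)
  moreover have "M' A = b" unfolding M'_def by (simp add: put_cell_def)
  moreover have "cells_stored (M'(A + 6 := hS, A + 7 := hT)) A (A + 24) A
      [(b, b, b, b, 0, 0), (b+5, hT, b+4, hT, 0, 0), (b+5, hT, b+4, b+4, 0, 0)]" for hS hT
    unfolding M'_def by (simp add: cell_stored_def put_cell_def)
  ultimately show ?thesis by blast
qed

lemma sem_tail:
  assumes c: "small_consts R" and A: "R rTP = A" "A + 24 < 2 ^ w" and l: "R rLab = l" "l + 6 < 2 ^ w" "0 < l"
    and q: "R rQ = q" "q + 8 \<le> A" "M q = b" "b + 5 < 2 ^ w"
  shows "\<exists>R' M'. sem w tail_code (R, M) = (R', M') \<and> advance 3 R R' \<and>
    (\<forall>y. y < A \<or> A + 24 \<le> y \<longrightarrow> M' y = (M(q + 6 := l - 1, q + 7 := l)) y) \<and>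
    cells_stored M' q (A + 24) A
      [(b+5, l, l, l, 0, 0), (b+5, l, b+4, l, 0, 0), (l + 4, l + 4, l + 4, l + 4, 0, 0)]"
proof -
  obtain e where e: "A = q + 8 + e" using q(2) le_Suc_ex by blast
  define M' where "M' = put_cell (put_cell (put_cell (M(q + 6 := l - 1, q + 7 := l)) A (b+5) (q+7) l
      (A+2) 0 0)
    (A+8) (b+5) (q+7) (b+4) (q+7) 0 0) (16 + A) (Suc (Suc (Suc (Suc l)))) (16 + A) (Suc (Suc (Suc (Suc
        l)))) (18 + A) 0 0"
  have u: "M(q + 7 := l, q + 6 := l - 1) = M(q + 6 := l - 1, q + 7 := l)" by (simp add: fun_upd_twist)
  have "sem w tail_code (R, M) = (fst (sem w tail_code (R, M)), M') \<and> advance 3 R (fst (sem w tail_code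
      (R, M)))"
    using c A l q u unfolding tail_code_def M'_def
    by (simp add: sem_or_addresses sem_emit small_consts_def Let_def advance_def)
  moreover have "\<forall>y. y < A \<or> A + 24 \<le> y \<longrightarrow> M' y = (M(q + 6 := l - 1, q + 7 := l)) y"
    unfolding M'_def by (simp add: put_cell_other)
  moreover have "cells_stored M' q (A + 24) A
      [(b+5, l, l, l, 0, 0), (b+5, l, b+4, l, 0, 0), (l + 4, l + 4, l + 4, l + 4, 0, 0)]"
    unfolding M'_def e by (simp add: cell_stored_def put_cell_def)
  ultimately show ?thesis by blast
qed

section \<open>The parsing loop and its invariants\<close>

text \<open>The memory as it will read after the enclosing gate has been closed. The value
  \<open>q = 0\<close> stands for an AND gate, which has no slots.\<close>

definition patch :: "(nat \<Rightarrow> nat) \<Rightarrow> nat \<Rightarrow> nat \<Rightarrow> nat \<Rightarrow> nat \<Rightarrow> nat" where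
  "patch M q hS hT = (if q = 0 then M else M(q + 6 := hS, q + 7 := hT))"

text \<open>Register 1 holds the length of the encoding, and the weight of variable \<open>i\<close>
  is looked up in a table that starts right behind it. So a literal takes constant time although
  there is no shift instruction.\<close>

definition token_code :: program where
  "token_code = IfLess rTag rTwo
     (ar Add rAd 1 rK ;; ld rPw rAd ;; ar Sub rSg rOne rTag ;; emit rLab rTP rLab rT2 rPw rSg)
     (ar Add rSP rSP rTwo ;; st rSP rK ;; ar Add rAd rSP rOne ;;
      IfLess rTwo rTag (st rAd rTP ;; head_code) (st rAd rZ))"

text \<open>Each round either reads one token as the next child of the top frame or closes a frame
  without missing children. Setting \<open>rAd\<close> to 0 stands for an empty branch.\<close>

definition parse_body :: program where
  "parse_body = ld rRem rSP ;; ar Add rAd rSP rOne ;; ld rQ rAd ;;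
    IfLess rZ rRem
     (ar Sub rRem rRem rOne ;; st rSP rRem ;; IfLess rZ rQ sep_code (cst rAd 0) ;;
      ld rTag rIP ;; ar Add rIP rIP rOne ;; ld rK rIP ;; ar Add rIP rIP rOne ;;
      token_code)
     (IfLess rZ rQ tail_code (cst rAd 0) ;; ar Sub rSP rSP rTwo)"

text \<open>Here \<open>R0\<close> are the initial registers, \<open>TB\<close> is the address of the template, \<open>sp\<close> that of the top
  stack frame, \<open>ip\<close> that of the next token, and \<open>p\<close> is the next template position. A frame consists
  of the number of missing children and of the address of the first cell of an OR gate, or 0 for
  an AND gate.\<close>

definition parse_regs :: "(nat \<Rightarrow> nat) \<Rightarrow> nat \<Rightarrow> (nat \<Rightarrow> nat) \<Rightarrow> nat \<Rightarrow> nat \<Rightarrow> nat \<Rightarrow> bool" where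
  "parse_regs R0 TB R sp ip p \<longleftrightarrow> (\<forall>r. r < rSP \<or> rA7 < r \<longrightarrow> R r = R0 r) \<and>
     R rSP = sp \<and> R rIP = ip \<and> R rTP = TB + 8 * p \<and> R rLab = 2 * p"

lemma parse_regs_consts: "parse_regs R0 TB R sp ip p \<Longrightarrow> small_consts R0 \<Longrightarrow> small_consts R"
  by (simp add: parse_regs_def small_consts_def)

lemma parse_regs_advance:
  "parse_regs R0 TB R sp ip p \<Longrightarrow> advance k R R' \<Longrightarrow> parse_regs R0 TB R' sp ip (p + k)"
  by (auto simp: parse_regs_def advance_def)

text \<open>What parsing a child may touch below its own cells: the counter in the frame of its
  parent, and the stack above that frame.\<close>

definition unchanged :: "nat \<Rightarrow> nat \<Rightarrow> nat \<Rightarrow> (nat \<Rightarrow> nat) \<Rightarrow> (nat \<Rightarrow> nat) \<Rightarrow> bool" where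
  "unchanged TB sp A M M' \<longleftrightarrow> (\<forall>y<A. y \<noteq> sp \<longrightarrow> \<not> (sp + 2 \<le> y \<and> y < TB) \<longrightarrow> M' y = M y)"

definition sep_cells :: "nat \<Rightarrow> nat \<Rightarrow> nat \<Rightarrow> nat \<Rightarrow> cell list" where
  "sep_cells q b hS hT = (if q = 0 then [] else sep_pair b hS hT)"

definition sep_len :: "nat \<Rightarrow> nat" where "sep_len q = (if q = 0 then 0 else 2)"

lemma length_sep_cells [simp]: "length (sep_cells q b hS hT) = sep_len q"
  by (simp add: sep_cells_def sep_len_def sep_pair_def)

lemma sem_optional_sep:
  assumes c: "small_consts R" and A: "R rTP = A" "A + 16 < 2 ^ w" and l: "R rLab + 4 < 2 ^ w"
    and q: "R rQ = q" "q = 0 \<or> q + 8 \<le> A" "q = 0 \<or> M q + 5 < 2 ^ w"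
  shows "\<exists>R' M'. sem w (IfLess rZ rQ sep_code (cst rAd 0)) (R, M) = (R', M') \<and> advance (sep_len q) R R' \<and>
    (\<forall>y. y < A \<or> A + 8 * sep_len q \<le> y \<longrightarrow> M' y = M y) \<and>
    (\<forall>hS hT. cells_stored (patch M' q hS hT) (if q = 0 then A else q) (A + 8 * sep_len q) A (sep_cells q
        (M q) hS hT))"
proof (cases "q = 0")
  case True
  then show ?thesis using c q(1)
    by (simp add: small_consts_def advance_def sep_len_def sep_cells_def)
next
  case False
  then show ?thesis using sem_sep[OF c A l q(1)] q c
    by (simp add: small_consts_def sep_len_def sep_cells_def patch_def)
qed

context
  fixes w n len TB Lmax :: nat and R0 :: "nat \<Rightarrow> nat"
  assumes R0: "small_consts R0" "R0 1 = len"
    and word: "TB + 8 * Lmax + 32 < 2 ^ w" "2 * Lmax + 32 < 2 ^ w"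
begin

text \<open>The bound \<open>sp + 2 + length ts \<le> TB\<close> is preserved because opening a gate
  consumes two words of the input and pushes two words on the stack; it keeps the stack from running
  into the template. \<open>M (sp + 1)\<close> is the first cell of the enclosing OR gate, or
  0.\<close>

definition ready :: "(nat \<Rightarrow> nat) \<Rightarrow> (nat \<Rightarrow> nat) \<Rightarrow> nat \<Rightarrow> nat \<Rightarrow> nat \<Rightarrow> nat list \<Rightarrow> nat \<Rightarrow> bool" where
  "ready R M sp ip p ts g \<longleftrightarrow> parse_regs R0 TB R sp ip p \<and> R rSB < sp \<and>
     (\<forall>j<length ts. M (ip + j) = ts ! j) \<and> ip + length ts \<le> len \<and>
     (\<forall>i. 1 \<le> i \<and> i \<le> n \<longrightarrow> M (len + i) = 2 ^ (i - 1)) \<and> len + n < sp \<and>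
     sp + 2 + length ts \<le> TB \<and>
     (M (sp + 1) = 0 \<or> TB \<le> M (sp + 1) \<and> M (sp + 1) + 8 \<le> TB + 8 * p \<and> M (M (sp + 1)) \<le> 2 * p) \<and>
     p + g \<le> Lmax \<and> M sp \<le> Lmax"

text \<open>\<open>length ts\<close> rounds suffice because a gate takes one round to open and one
  to close, and has two words of its own. The cells \<open>cs\<close> depend on the values that the
  slots of the enclosing gate will receive, and \<open>c\<close> is the number of children still
  missing afterwards.\<close>

definition parsed :: "nat \<Rightarrow> nat \<Rightarrow> nat \<Rightarrow> nat list \<Rightarrow> (nat \<Rightarrow> nat \<Rightarrow> cell list) \<Rightarrow> nat \<Rightarrow> nat \<Rightarrow> state \<Rightarrow> state \<Rightarrow>
    bool" where
  "parsed sp ip p ts cs g c \<sigma> \<sigma>' \<longleftrightarrow> (\<exists>k\<le>length ts. iterate w rSB rSP parse_body k \<sigma> \<sigma>') \<and>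
     parse_regs R0 TB (fst \<sigma>') sp (ip + length ts) (p + g) \<and> snd \<sigma>' sp = c \<and>
     unchanged TB sp (TB + 8 * p) (snd \<sigma>) (snd \<sigma>') \<and>
     (let q = snd \<sigma> (sp + 1) in
        \<forall>hS hT. cells_stored (patch (snd \<sigma>') q hS hT) (if q = 0 then TB + 8 * p else q) (TB + 8 * (p +
            g)) (TB + 8 * p) (cs hS hT))"

lemma close_frame:
  assumes "parse_regs R0 TB R sp ip p" "R rSB < sp" "2 \<le> sp" "sp + 1 < 2 ^ w"
    "M sp = 0" "M (sp + 1) = q" "q = 0 \<or> p + 3 \<le> Lmax" 
    "q = 0 \<or> TB \<le> q \<and> q + 8 \<le> TB + 8 * p \<and> M q \<le> 2 * p \<and> 0 < p"
  shows "\<exists>R' M'. iterate w rSB rSP parse_body 1 (R, M) (R', M') \<and>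
    parse_regs R0 TB R' (sp - 2) ip (p + (if q = 0 then 0 else 3)) \<and>
    (\<forall>y<TB + 8 * p. M' y = patch M q (2 * p - 1) (2 * p) y) \<and>
    (q \<noteq> 0 \<longrightarrow> cells_stored M' q (TB + 8 * (p + 3)) (TB + 8 * p)
      [(M q + 5, 2*p, 2*p, 2*p, 0, 0), (M q + 5, 2*p, M q + 4, 2*p, 0, 0), (2*p+4, 2*p+4, 2*p+4, 2*p+4,
          0, 0)])"
proof -
  note c = parse_regs_consts[OF assms(1) R0(1)]
  define R1 where "R1 = R(rRem := 0, rAd := Suc sp, rQ := q)"
  have pr: "parse_regs R0 TB R1 sp ip p" using assms(1) unfolding parse_regs_def R1_def by simp
  have c1: "small_consts R1" using c unfolding small_consts_def R1_def by simp
  have sem: "sem w parse_body (R, M) =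
    sem w (ar Sub rSP rSP rTwo) (sem w (IfLess rZ rQ tail_code (cst rAd 0)) (R1, M))"
    using assms c unfolding parse_body_def R1_def small_consts_def parse_regs_def by simp
  have it: "iterate w rSB rSP parse_body 1 (R, M) (sem w parse_body (R, M))"
    using assms(1,2) unfolding parse_regs_def One_nat_def by simp
  have sub: "sem w (ar Sub rSP rSP rTwo) (R', M') = (R'(rSP := sp - 2), M')" if "parse_regs R0 TB R' sp
      ip p'" for R' M' p'
    using that R0(1) assms(3,4) unfolding parse_regs_def small_consts_def by simp
  have upd: "parse_regs R0 TB (R'(rSP := sp - 2)) (sp - 2) ip p'" if "parse_regs R0 TB R' sp ip p'" for R' p'
    using that unfolding parse_regs_def by simp
  show ?thesis
  proof (cases "q = 0")
    case True
    then have tl: "sem w (IfLess rZ rQ tail_code (cst rAd 0)) (R1, M) = (R1(rAd := 0), M)"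
      using c1 unfolding small_consts_def R1_def by simp
    have pr': "parse_regs R0 TB (R1(rAd := 0)) sp ip p" using pr unfolding parse_regs_def by simp
    show ?thesis using it upd[OF pr'] True unfolding sem tl sub[OF pr'] by (auto simp: patch_def)
  next
    case False
    have R1: "R1 rTP = TB + 8 * p" "R1 rLab = 2 * p" "R1 rQ = q" using pr unfolding parse_regs_def
        R1_def by simp_all
    have q: "q + 8 \<le> TB + 8 * p" "M q + 5 < 2 ^ w" "0 < 2 * p" using False assms word by auto
    have wd: "TB + 8 * p + 24 < 2 ^ w" "2 * p + 6 < 2 ^ w" using assms(7) word False by auto
    from sem_tail[where b = "M q" and M = M, OF c1 R1(1) wd(1) R1(2) wd(2) q(3) R1(3) q(1) refl q(2)]
        obtain R' M' where t:
      "sem w tail_code (R1, M) = (R', M')" "advance 3 R1 R'"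
      "\<forall>y. y < TB + 8 * p \<or> TB + 8 * p + 24 \<le> y \<longrightarrow> M' y = (M(q + 6 := 2 * p - 1, q + 7 := 2 * p)) y"
      "cells_stored M' q (TB + 8 * p + 24) (TB + 8 * p)
       [(M q + 5, 2*p, 2*p, 2*p, 0, 0), (M q + 5, 2*p, M q + 4, 2*p, 0, 0), (2*p+4, 2*p+4, 2*p+4, 2*p+4,
           0, 0)]"
      by blast
    have tl: "sem w (IfLess rZ rQ tail_code (cst rAd 0)) (R1, M) = (R', M')"
      using c1 R1(3) False t(1) unfolding small_consts_def by simp
    note pr' = parse_regs_advance[OF pr t(2)]
    show ?thesis using it upd[OF pr'] False t(3,4) unfolding sem tl sub[OF pr']
      by (intro exI[of _ "R'(rSP := sp - 2)"] exI[of _ M']) (auto simp: patch_def algebra_simps)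
  qed
qed

text \<open>The point between reading a token and acting on it, when the separators of the enclosing
  OR gate have already been written.\<close>

definition fetched :: "(nat \<Rightarrow> nat) \<Rightarrow> (nat \<Rightarrow> nat) \<Rightarrow> nat \<Rightarrow> nat \<Rightarrow> nat \<Rightarrow> nat \<Rightarrow> nat list \<Rightarrow>
    (nat \<Rightarrow> nat) \<Rightarrow> (nat \<Rightarrow> nat) \<Rightarrow> bool" where
  "fetched R M sp ip p c ts R1 M1 \<longleftrightarrow> (let q = M (sp + 1); p1 = p + sep_len (M (sp + 1)) in
    sem w parse_body (R, M) = sem w token_code (R1, M1) \<and>
    parse_regs R0 TB R1 sp (ip + 2) p1 \<and> R1 rTag = ts ! 0 \<and> R1 rK = ts ! 1 \<and> M1 sp = c \<and>
    (\<forall>y. y \<noteq> sp \<and> (y < TB + 8 * p \<or> TB + 8 * p1 \<le> y) \<longrightarrow> M1 y = M y) \<and>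
    (\<forall>hS hT. cells_stored (patch M1 q hS hT) (if q = 0 then TB + 8 * p else q) (TB + 8 * p1) (TB + 8 * p)
      (sep_cells q (M q) hS hT)))"

lemma fetchedD:
  assumes "fetched R M sp ip p c ts R1 M1"
  shows "sem w parse_body (R, M) = sem w token_code (R1, M1)"
    "parse_regs R0 TB R1 sp (ip + 2) (p + sep_len (M (sp + 1)))"
    "R1 rTag = ts ! 0" "R1 rK = ts ! 1" "M1 sp = c"
    "\<forall>y. y \<noteq> sp \<and> (y < TB + 8 * p \<or> TB + 8 * (p + sep_len (M (sp + 1))) \<le> y) \<longrightarrow> M1 y = M y"
    "\<forall>hS hT. cells_stored (patch M1 (M (sp + 1)) hS hT) (if M (sp + 1) = 0 then TB + 8 * p else M (sp + 1))
      (TB + 8 * (p + sep_len (M (sp + 1)))) (TB + 8 * p) (sep_cells (M (sp + 1)) (M (M (sp + 1))) hS hT)"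
  using assms unfolding fetched_def Let_def by blast+

lemma fetch_token:
  assumes rd: "ready R M sp ip p ts g" and ts: "length ts \<ge> 2" and M: "M sp = Suc c" and g: "g \<ge> sep_len
      (M (sp + 1))"
  shows "\<exists>R1 M1. fetched R M sp ip p c ts R1 M1"
proof -
  define q p1 where "q = M (sp + 1)" and "p1 = p + sep_len (M (sp + 1))"
  have pr: "parse_regs R0 TB R sp ip p" and stack: "len + n < sp" "sp + 2 + length ts \<le> TB"
    and tok: "\<forall>j<length ts. M (ip + j) = ts ! j" "ip + length ts \<le> len"
    and par: "q = 0 \<or> TB \<le> q \<and> q + 8 \<le> TB + 8 * p \<and> M q \<le> 2 * p" and pL: "p + g \<le> Lmax"
    using rd unfolding ready_def q_def by auto
  note c0 = parse_regs_consts[OF pr R0(1)]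
  define R' M' where "R' = R(rAd := Suc sp, rQ := q, rRem := c)" and "M' = M(sp := c)"
  have pr': "parse_regs R0 TB R' sp ip p" using pr unfolding parse_regs_def R'_def by simp
  have c': "small_consts R'" using c0 unfolding small_consts_def R'_def by simp
  have Mq: "q \<noteq> 0 \<Longrightarrow> M' q = M q" using par stack unfolding M'_def by auto
  have R': "R' rTP = TB + 8 * p" "R' rQ = q" "R' rLab = 2 * p"
    using pr' unfolding parse_regs_def R'_def by auto
  have "\<exists>R2 M2. sem w (IfLess rZ rQ sep_code (cst rAd 0)) (R', M') = (R2, M2) \<and> advance (sep_len q) R' R2 \<and>
    (\<forall>y. y < TB + 8 * p \<or> TB + 8 * p + 8 * sep_len q \<le> y \<longrightarrow> M2 y = M' y) \<and>
    (\<forall>hS hT. cells_stored (patch M2 q hS hT) (if q = 0 then TB + 8 * p else q) (TB + 8 * p + 8 * sep_len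
        q) (TB + 8 * p) (sep_cells q (M' q) hS hT))"
  proof (rule sem_optional_sep)
    show "TB + 8 * p + 16 < 2 ^ w" "R' rLab + 4 < 2 ^ w" using pL word R' by auto
    show "q = 0 \<or> q + 8 \<le> TB + 8 * p" "q = 0 \<or> M' q + 5 < 2 ^ w" using par pL word Mq by (cases "q = 0";
        simp)+
  qed (use c' R' in auto)
  then obtain R2 M2 where s: "sem w (IfLess rZ rQ sep_code (cst rAd 0)) (R', M') = (R2, M2)" "advance
      (sep_len q) R' R2"
    "\<forall>y. y < TB + 8 * p \<or> TB + 8 * p1 \<le> y \<longrightarrow> M2 y = M' y"
    "\<forall>hS hT. cells_stored (patch M2 q hS hT) (if q = 0 then TB + 8 * p else q) (TB + 8 * p1) (TB + 8 *
        p) (sep_cells q (M' q) hS hT)"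
    unfolding p1_def q_def by (auto simp: algebra_simps)
  have sc: "sep_cells q (M' q) = sep_cells q (M q)" using Mq by (auto simp: sep_cells_def fun_eq_iff)
  have pr2: "parse_regs R0 TB R2 sp ip p1" using parse_regs_advance[OF pr' s(2)] unfolding p1_def q_def .
  have c2: "small_consts R2" using parse_regs_consts[OF pr2 R0(1)] .
  define R1 where "R1 = R2(rTag := ts ! 0, rK := ts ! 1, rIP := Suc (Suc ip))"
  have tk: "M2 ip = ts ! 0" "M2 (Suc ip) = ts ! 1"
    using s(3) tok stack ts unfolding M'_def by (auto dest: spec[of _ 0] spec[of _ 1])
  have ipw: "ip + 2 < 2 ^ w" "sp + 1 < 2 ^ w" "c < 2 ^ w" "Suc c < 2 ^ w"
    using tok stack ts word M rd unfolding ready_def by auto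
  have "sem w parse_body (R, M) = sem w token_code
      (sem w (ld rTag rIP ;; ar Add rIP rIP rOne ;; ld rK rIP ;; ar Add rIP rIP rOne)
      (sem w (IfLess rZ rQ sep_code (cst rAd 0)) (R', M')))"
    using c0 pr M ipw unfolding parse_body_def R'_def M'_def small_consts_def parse_regs_def q_def
    by simp
  also have "sem w (ld rTag rIP ;; ar Add rIP rIP rOne ;; ld rK rIP ;; ar Add rIP rIP rOne)
      (sem w (IfLess rZ rQ sep_code (cst rAd 0)) (R', M')) = (R1, M2)"
    unfolding s(1) R1_def using c2 pr2 tk ipw unfolding small_consts_def parse_regs_def by simp
  finally have "sem w parse_body (R, M) = sem w token_code (R1, M2)" .
  moreover have "parse_regs R0 TB R1 sp (ip + 2) p1" "R1 rTag = ts ! 0" "R1 rK = ts ! 1"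
    using pr2 unfolding R1_def parse_regs_def by simp_all
  moreover have "M2 sp = c" using s(3) stack unfolding M'_def by simp
  moreover have "\<forall>y. y \<noteq> sp \<and> (y < TB + 8 * p \<or> TB + 8 * p1 \<le> y) \<longrightarrow> M2 y = M y"
    using s(3) unfolding M'_def by auto
  ultimately have "fetched R M sp ip p c ts R1 M2"
    using s(4)[unfolded sc] unfolding fetched_def Let_def q_def p1_def by blast
  then show ?thesis by blast
qed

lemma ready_prefix: "ready R M sp ip p (ts @ ts') (g + g') \<Longrightarrow> ready R M sp ip p ts g"
  unfolding ready_def by (auto simp: nth_append split: if_splits)

lemma parsed_unchanged:
  assumes "parsed sp ip p ts cs g c \<sigma> \<sigma>'" "y < TB + 8 * p" "y \<noteq> sp" "\<not> (sp + 2 \<le> y \<and> y < TB)"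
  shows "snd \<sigma>' y = snd \<sigma> y"
  using assms unfolding parsed_def unchanged_def by blast

lemma ready_parent:
  assumes "ready R M sp ip p ts g" "parsed sp ip p ts' cs g' c (R, M) \<sigma>"
  shows "snd \<sigma> (sp + 1) = M (sp + 1)" "M (sp + 1) \<noteq> 0 \<Longrightarrow> snd \<sigma> (M (sp + 1)) = M (M (sp + 1))"
  using assms(1) parsed_unchanged[OF assms(2), of "sp + 1"] parsed_unchanged[OF assms(2), of "M (sp + 1)"]
  unfolding ready_def by auto

lemma ready_step:
  assumes rd: "ready R M sp ip p (ts @ ts') (g + g')" and pd: "parsed sp ip p ts cs g c (R, M) (R', M')"
    and c: "c \<le> Lmax"
  shows "ready R' M' sp (ip + length ts) (p + g) ts' g'"
proof -
  have low: "M' y = M y" if "y < sp" for y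
    using parsed_unchanged[OF pd, of y] that rd unfolding ready_def by auto
  have tok: "M' (ip + length ts + j) = ts' ! j" if "j < length ts'" for j
  proof -
    have "M (ip + (length ts + j)) = (ts @ ts') ! (length ts + j)"
      using rd that unfolding ready_def by auto
    then show ?thesis using low[of "ip + (length ts + j)"] that rd unfolding ready_def
      by (auto simp: add.assoc)
  qed
  have tab: "M' (len + i) = 2 ^ (i - 1)" if "1 \<le> i" "i \<le> n" for i
    using low[of "len + i"] that rd unfolding ready_def by auto
  have regs: "parse_regs R0 TB R' sp (ip + length ts) (p + g)" "M' sp = c"
    using pd unfolding parsed_def by auto
  moreover have "R' rSB = R rSB" using regs rd unfolding ready_def parse_regs_def by simp
  ultimately show ?thesis
    using tok tab c rd ready_parent[OF rd pd] unfolding ready_def by auto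
qed

lemma parsed_trans:
  assumes rd: "ready R M sp ip p ts0 g0"
    and pd: "parsed sp ip p ts cs g c (R, M) (R', M')"
    and pd': "parsed sp (ip + length ts) (p + g) ts' cs' g' c' (R', M') (R'', M'')"
    and len: "\<And>hS hT. length (cs hS hT) = g" "\<And>hS hT. length (cs' hS hT) = g'"
  shows "parsed sp ip p (ts @ ts') (\<lambda>hS hT. cs hS hT @ cs' hS hT) (g + g') c' (R, M) (R'', M'')"
proof -
  let ?q = "M (sp + 1)"
  let ?lo = "if ?q = 0 then TB + 8 * p else ?q"
  have q': "M' (sp + 1) = ?q" using ready_parent[OF rd pd] by simp
  have sp: "sp < TB" and par: "?q = 0 \<or> TB \<le> ?q \<and> ?q + 8 \<le> TB + 8 * p" using rd unfolding ready_def by auto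
  obtain k k' where k: "k \<le> length ts" "iterate w rSB rSP parse_body k (R, M) (R', M')"
    "k' \<le> length ts'" "iterate w rSB rSP parse_body k' (R', M') (R'', M'')"
    using pd pd' unfolding parsed_def by auto
  have "iterate w rSB rSP parse_body (k + k') (R, M) (R'', M'')" using iterate_trans k by blast
  then have "\<exists>k\<le>length (ts @ ts'). iterate w rSB rSP parse_body k (R, M) (R'', M'')"
    using k by (intro exI[of _ "k + k'"]) auto
  moreover have "unchanged TB sp (TB + 8 * p) M M''"
    using pd pd' unfolding parsed_def unchanged_def by auto
  moreover have "cells_stored (patch M'' ?q hS hT) ?lo (TB + 8 * (p + (g + g'))) (TB + 8 * p) (cs hS hT
      @ cs' hS hT)" for hS hT
  proof -
    \<comment> \<open>Later children leave the cells of earlier ones alone, and the slots are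
      overridden on both sides, so the earlier cells read the same.\<close>
    have eq: "patch M'' ?q hS hT y = patch M' ?q hS hT y" if "?lo \<le> y" "y < TB + 8 * (p + g)" for y
      using parsed_unchanged[OF pd', of y] that sp par unfolding patch_def by (auto split: if_splits)
    have "cells_stored (patch M' ?q hS hT) ?lo (TB + 8 * (p + g)) (TB + 8 * p) (cs hS hT)"
      using pd unfolding parsed_def by (auto simp: Let_def)
    from cells_stored_cong[OF this eq] have "cells_stored (patch M'' ?q hS hT) ?lo (TB + 8 * (p + g))
        (TB + 8 * p) (cs hS hT)"
      using par len by auto
    then have 1: "cells_stored (patch M'' ?q hS hT) ?lo (TB + 8 * (p + (g + g'))) (TB + 8 * p) (cs hS hT)"
      by (rule cells_stored_mono) auto
    have "cells_stored (patch M'' ?q hS hT) (if ?q = 0 then TB + 8 * (p + g) else ?q) (TB + 8 * (p + g +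
        g')) (TB + 8 * (p + g)) (cs' hS hT)"
      using pd' q' unfolding parsed_def by (auto simp: Let_def)
    then have "cells_stored (patch M'' ?q hS hT) ?lo (TB + 8 * (p + (g + g'))) (TB + 8 * (p + g)) (cs' hS hT)"
      by (rule cells_stored_mono) auto
    with 1 show ?thesis unfolding cells_stored_append by (simp add: len algebra_simps)
  qed
  ultimately show ?thesis using pd' unfolding parsed_def by (auto simp: Let_def add.assoc)
qed

text \<open>A child is parsed together with the separators that its parent puts in front of it. So
  the statement is uniform in the kind of the parent, which shows only through
  \<open>sep_len\<close>.\<close>

definition parses :: "formula \<Rightarrow> bool" where
  "parses F \<longleftrightarrow> (\<forall>R M sp ip p c. ready R M sp ip p (encode F) (sep_len (M (sp + 1)) + glen F) \<longrightarrow> M sp = Suc c \<longrightarrow>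
     (\<exists>R' M'. parsed sp ip p (encode F)
       (\<lambda>hS hT. sep_cells (M (sp + 1)) (M (M (sp + 1))) hS hT @ tmpl (p + sep_len (M (sp + 1))) F)
       (sep_len (M (sp + 1)) + glen F) c (R, M) (R', M')))"

lemma parsesD:
  assumes "parses F" "ready R M sp ip p (encode F) (sep_len (M (sp + 1)) + glen F)" "M sp = Suc c"
  shows "\<exists>R' M'. parsed sp ip p (encode F)
       (\<lambda>hS hT. sep_cells (M (sp + 1)) (M (M (sp + 1))) hS hT @ tmpl (p + sep_len (M (sp + 1))) F)
       (sep_len (M (sp + 1)) + glen F) c (R, M) (R', M')"
  using assms unfolding parses_def by blast

definition kid_cells :: "nat \<Rightarrow> nat \<Rightarrow> nat \<Rightarrow> formula list \<Rightarrow> nat \<Rightarrow> nat \<Rightarrow> cell list" where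
  "kid_cells q b p Fs hS hT = concat (map (\<lambda>x. sep_cells q b hS hT @ x) (kids (sep_len q) p Fs))"

lemma kid_cells_Cons: "kid_cells q b p (F # Fs) hS hT =
    (sep_cells q b hS hT @ tmpl (p + sep_len q) F) @ kid_cells q b (p + (sep_len q + glen F)) Fs hS hT"
  by (simp add: kid_cells_def add.assoc)

lemma length_kid_cells [simp]: "length (kid_cells q b p Fs hS hT) = sum_list (map (\<lambda>F. sep_len q + glen
    F) Fs)"
  by (induction Fs arbitrary: p) (simp_all add: kid_cells_Cons del: length_concat, simp add: kid_cells_def)

lemma parse_kids:
  assumes "\<forall>F\<in>set Fs. parses F" "ready R M sp ip p (concat (map encode Fs)) (sum_list (map (\<lambda>F. sep_len
      (M (sp + 1)) + glen F) Fs))"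
    "M sp = length Fs" "length Fs \<le> Lmax"
  shows "\<exists>R' M'. parsed sp ip p (concat (map encode Fs)) (kid_cells (M (sp + 1)) (M (M (sp + 1))) p Fs)
      (sum_list (map (\<lambda>F. sep_len (M (sp + 1)) + glen F) Fs)) 0 (R, M) (R', M')"
  using assms
proof (induction Fs arbitrary: R M ip p)
  case Nil
  have "parsed sp ip p [] (\<lambda>_ _. []) 0 0 (R, M) (R, M)"
    using Nil unfolding parsed_def ready_def unchanged_def by (auto simp: Let_def intro!: exI[of _ 0])
  then show ?case unfolding kid_cells_def by auto
next
  case (Cons F Fs)
  let ?q = "M (sp + 1)" and ?b = "M (M (sp + 1))"
  let ?l = "sep_len ?q + glen F"
  have rd: "ready R M sp ip p (encode F @ concat (map encode Fs)) (?l + sum_list (map (\<lambda>F. sep_len ?q +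
      glen F) Fs))"
    using Cons.prems(2) by simp
  obtain R' M' where 1: "parsed sp ip p (encode F) (\<lambda>hS hT. sep_cells ?q ?b hS hT @ tmpl (p + sep_len ?q) F)
      ?l (length Fs) (R, M) (R', M')"
    using parsesD[OF _ ready_prefix[OF rd], of "length Fs"] Cons.prems(1,3) by auto
  have rd': "ready R' M' sp (ip + length (encode F)) (p + ?l) (concat (map encode Fs)) (sum_list (map
      (\<lambda>F. sep_len ?q + glen F) Fs))"
    using ready_step[OF rd 1] Cons.prems(4) by simp
  have q: "M' (sp + 1) = ?q" using ready_parent[OF rd 1] by simp
  have b: "kid_cells ?q (M' ?q) = kid_cells ?q ?b"
    using ready_parent(2)[OF rd 1] by (auto simp: kid_cells_def sep_cells_def fun_eq_iff)
  have "M' sp = length Fs" using 1 unfolding parsed_def by simp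
  then obtain R'' M'' where 2: "parsed sp (ip + length (encode F)) (p + ?l) (concat (map encode Fs))
      (kid_cells ?q ?b (p + ?l) Fs) (sum_list (map (\<lambda>F. sep_len ?q + glen F) Fs)) 0 (R', M') (R'', M'')"
    using Cons.IH[of R' M' "ip + length (encode F)" "p + ?l"] rd' Cons.prems unfolding q b by auto
  have "parsed sp ip p (encode F @ concat (map encode Fs))
    (\<lambda>hS hT. (sep_cells ?q ?b hS hT @ tmpl (p + sep_len ?q) F) @ kid_cells ?q ?b (p + ?l) Fs hS hT)
    (?l + sum_list (map (\<lambda>F. sep_len ?q + glen F) Fs)) 0 (R, M) (R'', M'')"
    by (rule parsed_trans[OF rd 1 2]) auto
  then show ?case unfolding kid_cells_Cons[symmetric] by auto
qed

text \<open>Joins the round that fetches a token with the rounds that process it. The cells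
  \<open>cs\<close> are given without \<open>patch\<close>: all gates inside are closed by then, and
  their addresses stay within the window of \<open>cs\<close>, away from the slots of the enclosing
  gate.\<close>

lemma parsed_assemble:
  assumes rd: "ready R M sp ip p ts (sep_len q + g)" and q: "q = M (sp + 1)"
    and sem: "sem w parse_body (R, M) = \<sigma>2"
    and it: "iterate w rSB rSP parse_body k \<sigma>2 (R3, M3)" "Suc k \<le> length ts"
    and M1: "\<forall>y. y \<noteq> sp \<and> (y < TB + 8 * p \<or> TB + 8 * (p + sep_len q) \<le> y) \<longrightarrow> M1 y = M y"
    and sep: "\<forall>hS hT. cells_stored (patch M1 q hS hT) (if q = 0 then TB + 8 * p else q) (TB + 8 * (p +
        sep_len q)) (TB + 8 * p)
        (sep_cells q (M q) hS hT)"
    and regs: "parse_regs R0 TB R3 sp (ip + length ts) (p + sep_len q + g)"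
    and M3: "M3 sp = c" "unchanged TB sp (TB + 8 * (p + sep_len q)) M1 M3"
    and cs: "cells_stored M3 (TB + 8 * (p + sep_len q)) (TB + 8 * (p + sep_len q + g)) (TB + 8 * (p +
        sep_len q)) cs"
    and len: "length cs = g"
  shows "parsed sp ip p ts (\<lambda>hS hT. sep_cells q (M q) hS hT @ cs) (sep_len q + g) c (R, M) (R3, M3)"
proof -
  let ?lo = "if q = 0 then TB + 8 * p else q"
  have sp: "sp < TB" and par: "q = 0 \<or> TB \<le> q \<and> q + 8 \<le> TB + 8 * p" using rd q unfolding ready_def by auto
  have "R rSB < R rSP" using rd unfolding ready_def parse_regs_def by auto
  then have "iterate w rSB rSP parse_body (Suc k) (R, M) (R3, M3)" using it(1) sem by simp
  then have "\<exists>k\<le>length ts. iterate w rSB rSP parse_body k (R, M) (R3, M3)" using it(2) by blast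
  moreover have "unchanged TB sp (TB + 8 * p) M M3" using M1 M3(2) unfolding unchanged_def by auto
  moreover have "cells_stored (patch M3 q hS hT) ?lo (TB + 8 * (p + (sep_len q + g))) (TB + 8 * p)
      (sep_cells q (M q) hS hT @ cs)" for hS hT
  proof -
    have eq: "patch M3 q hS hT y = patch M1 q hS hT y" if "?lo \<le> y" "y < TB + 8 * (p + sep_len q)" for y
      using M3(2) that sp par unfolding patch_def unchanged_def by (auto split: if_splits)
    have "cells_stored (patch M3 q hS hT) ?lo (TB + 8 * (p + sep_len q)) (TB + 8 * p) (sep_cells q (M q)
        hS hT)"
      using cells_stored_cong[OF sep[rule_format] eq] par by auto
    then have 1: "cells_stored (patch M3 q hS hT) ?lo (TB + 8 * (p + (sep_len q + g))) (TB + 8 * p)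
        (sep_cells q (M q) hS hT)"
      by (rule cells_stored_mono) auto
    have "cells_stored (patch M3 q hS hT) (TB + 8 * (p + sep_len q)) (TB + 8 * (p + sep_len q + g)) (TB
        + 8 * (p + sep_len q)) cs"
      using par len by (intro cells_stored_cong[OF cs]) (auto simp: patch_def)
    then have "cells_stored (patch M3 q hS hT) ?lo (TB + 8 * (p + (sep_len q + g))) (TB + 8 * (p +
        sep_len q)) cs"
      using par by (rule_tac cells_stored_mono) auto
    with 1 show ?thesis unfolding cells_stored_append by (simp add: algebra_simps)
  qed
  ultimately show ?thesis using regs M3(1) q unfolding parsed_def by (auto simp: Let_def add.assoc)
qed

section \<open>Parsing literals, AND gates and OR gates\<close>

lemma parses_Lit:
  assumes "1 \<le> i" "i \<le> n" shows "parses (Lit b i)"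
  unfolding parses_def
proof (intro allI impI)
  fix R M :: "nat \<Rightarrow> nat" and sp ip p c :: nat
  let ?ts = "encode (Lit b i)" and ?q = "M (sp + 1)"
  let ?p1 = "p + sep_len ?q"
  assume rd: "ready R M sp ip p ?ts (sep_len ?q + glen (Lit b i))" and c: "M sp = Suc c"
  obtain R1 M1 where "fetched R M sp ip p c ?ts R1 M1" using fetch_token[OF rd _ c] by auto
  note f = fetchedD[OF this]
  define A where "A = TB + 8 * ?p1"
  define M3 where "M3 = put_cell M1 A (2 * ?p1) A (2 * ?p1) (Suc (Suc A)) (2 ^ (i - 1)) (of_bool b)"
  have stack: "len + n < sp" "sp + 4 \<le> TB" "?p1 + 1 \<le> Lmax" using rd unfolding ready_def by auto
  have pw: "M1 (len + i) = 2 ^ (i - 1)" using f(6) rd assms stack unfolding ready_def by auto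
  have c1: "small_consts R1" using parse_regs_consts[OF f(2) R0(1)] .
  have R1: "R1 1 = len" "R1 rTP = A" "R1 rLab = 2 * ?p1" using f(2) R0(2) unfolding parse_regs_def A_def
      by auto
  have wd: "len + i < 2 ^ w" "A + 8 < 2 ^ w" "2 * ?p1 + 2 < 2 ^ w" "1 < (2::nat) ^ w"
    using stack word assms unfolding A_def by auto
  define R2 where "R2 = R1(rAd := len + i, rPw := 2 ^ (i - 1), rSg := of_bool b)"
  have c2: "small_consts R2" using c1 unfolding small_consts_def R2_def by simp
  have "sem w parse_body (R, M) = sem w (emit rLab rTP rLab rT2 rPw rSg) (R2, M1)"
    unfolding f(1) R2_def token_code_def using c1 f(3,4) R1 wd pw unfolding small_consts_def by simp
  also have "\<dots> = (R2(rT2 := A + 2, rAd := Suc (Suc (Suc (Suc (Suc A)))), rTP := A + 8, rLab := 2 * ?p1 +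
      2), M3)"
    using sem_emit[OF c2, of w rLab rTP rLab rT2 rPw rSg M1] R1 wd unfolding R2_def M3_def by (simp add:
        Let_def)
  finally obtain R3 where R3: "sem w parse_body (R, M) = (R3, M3)"
    "R3 = R2(rT2 := A + 2, rAd := Suc (Suc (Suc (Suc (Suc A)))), rTP := A + 8, rLab := 2 * ?p1 + 2)" by blast
  have M3: "M3 y = M1 y" if "y < A" for y using that unfolding M3_def by (simp add: put_cell_other)
  have "parsed sp ip p ?ts (\<lambda>hS hT. sep_cells ?q (M ?q) hS hT @ tmpl ?p1 (Lit b i)) (sep_len ?q + 1) c
      (R, M) (R3, M3)"
  proof (rule parsed_assemble[OF _ refl R3(1) _ _ f(6,7)])
    show "parse_regs R0 TB R3 sp (ip + length ?ts) (?p1 + 1)"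
      using f(2) unfolding R3(2) R2_def parse_regs_def A_def by simp
    show "M3 sp = c" "unchanged TB sp (TB + 8 * ?p1) M1 M3"
      using M3 f(5) stack unfolding unchanged_def A_def by auto
    show "cells_stored M3 (TB + 8 * ?p1) (TB + 8 * (?p1 + 1)) (TB + 8 * ?p1) (tmpl ?p1 (Lit b i))"
      unfolding M3_def A_def[symmetric] using A_def by (simp add: cell_stored_def put_cell_def)
    show "iterate w rSB rSP parse_body 0 (R3, M3) (R3, M3)" by simp
  qed (use rd in auto)
  then show "\<exists>R' M'. parsed sp ip p ?ts (\<lambda>hS hT. sep_cells ?q (M ?q) hS hT @ tmpl ?p1 (Lit b i))
       (sep_len ?q + glen (Lit b i)) c (R, M) (R', M')" unfolding glen.simps by blast
qed

lemma length_le_glen: "\<forall>F\<in>set Fs. 1 \<le> glen F \<Longrightarrow> length Fs \<le> sum_list (map glen Fs)"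
  by (induction Fs) auto

lemma parses_And:
  assumes "2 \<le> length Fs" "\<forall>F\<in>set Fs. parses F" "\<forall>F\<in>set Fs. 1 \<le> glen F"
  shows "parses (And Fs)"
  unfolding parses_def
proof (intro allI impI)
  fix R M :: "nat \<Rightarrow> nat" and sp ip p c :: nat
  let ?ts = "encode (And Fs)" and ?q = "M (sp + 1)"
  let ?p1 = "p + sep_len ?q" and ?g = "sum_list (map glen Fs)"
  assume rd: "ready R M sp ip p ?ts (sep_len ?q + glen (And Fs))" and c: "M sp = Suc c"
  obtain R1 M1 where "fetched R M sp ip p c ?ts R1 M1" using fetch_token[OF rd _ c] by auto
  note f = fetchedD[OF this]
  let ?kts = "concat (map encode Fs)"
  have stack: "len + n < sp" "sp + 4 + length ?kts \<le> TB" "?p1 + ?g \<le> Lmax" "ip + 2 + length ?kts \<le> len"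
    and SB: "R0 rSB < sp"
    using rd f(2) unfolding ready_def parse_regs_def by auto
  have c1: "small_consts R1" using parse_regs_consts[OF f(2) R0(1)] .
  note lenFs = length_le_glen[OF assms(3)]
  define R2 where "R2 = R1(rSP := sp + 2, rAd := Suc (sp + 2))"
  define M2 where "M2 = M1(sp + 2 := length Fs, Suc (sp + 2) := 0)"
  have sem: "sem w parse_body (R, M) = (R2, M2)"
    unfolding f(1) R2_def M2_def token_code_def using c1 f(2-4) stack word unfolding small_consts_def
        parse_regs_def by simp
  have tok: "M2 (ip + 2 + j) = ?kts ! j" if "j < length ?kts" for j
  proof -
    have "\<forall>j<length ?ts. M (ip + j) = ?ts ! j" using rd unfolding ready_def by blast
    from this[rule_format, of "2 + j"] have "M (ip + (2 + j)) = ?ts ! (2 + j)" using that by simp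
    then show ?thesis using that stack f(6) unfolding M2_def by (auto simp: add.assoc)
  qed
  have tab: "M2 (len + i) = 2 ^ (i - 1)" if "1 \<le> i" "i \<le> n" for i
    using that stack f(6) rd unfolding M2_def ready_def by auto
  have rd2: "ready R2 M2 (sp + 2) (ip + 2) ?p1 ?kts (sum_list (map (\<lambda>F. sep_len (M2 (sp + 2 + 1)) + glen
      F) Fs))"
    using tok tab f(2) stack SB lenFs unfolding ready_def
    by (auto simp: R2_def M2_def parse_regs_def sep_len_def)
  have "M2 (sp + 2) = length Fs" "M2 (sp + 2 + 1) = 0" "length Fs \<le> Lmax" using stack lenFs unfolding
      M2_def by auto
  with parse_kids[OF assms(2) rd2] obtain R3 M3 where
    k: "parsed (sp + 2) (ip + 2) ?p1 ?kts (kid_cells 0 (M2 0) ?p1 Fs) ?g 0 (R2, M2) (R3, M3)"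
    by (auto simp: sep_len_def)
  have regs3: "parse_regs R0 TB R3 (sp + 2) (ip + 2 + length ?kts) (?p1 + ?g)" and M3sp: "M3 (sp + 2) = 0"
    using k unfolding parsed_def by auto
  have M3q: "M3 (sp + 2 + 1) = 0" using parsed_unchanged[OF k, of "sp + 2 + 1"] stack unfolding M2_def by simp
  obtain R4 M4 where cl: "iterate w rSB rSP parse_body 1 (R3, M3) (R4, M4)"
    "parse_regs R0 TB R4 sp (ip + 2 + length ?kts) (?p1 + ?g)"
    "\<forall>y<TB + 8 * (?p1 + ?g). M4 y = M3 y"
    using close_frame[OF regs3 _ _ _ M3sp M3q] stack SB word regs3 unfolding parse_regs_def patch_def by auto
  obtain k where k': "k \<le> length ?kts" "iterate w rSB rSP parse_body k (R2, M2) (R3, M3)" using k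
      unfolding parsed_def by auto
  have low: "M4 y = M1 y" if "y < TB + 8 * ?p1" "\<not> (sp + 2 \<le> y \<and> y < TB)" for y
    using parsed_unchanged[OF k, of y] cl(3) that stack unfolding M2_def by auto
  have "parsed sp ip p ?ts (\<lambda>hS hT. sep_cells ?q (M ?q) hS hT @ tmpl ?p1 (And Fs)) (sep_len ?q + ?g) c
      (R, M) (R4, M4)"
  proof (rule parsed_assemble[OF _ refl sem _ _ f(6,7)])
    show "iterate w rSB rSP parse_body (k + 1) (R2, M2) (R4, M4)" by (rule iterate_trans[OF k'(2) cl(1)])
    show "parse_regs R0 TB R4 sp (ip + length ?ts) (?p1 + ?g)" using cl(2) by (simp add: algebra_simps)
    show "M4 sp = c" using low[of sp] stack f(5) by auto
    show "unchanged TB sp (TB + 8 * ?p1) M1 M4" using low unfolding unchanged_def by auto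
    have kc: "kid_cells 0 (M2 0) ?p1 Fs hS hT = tmpl ?p1 (And Fs)" for hS hT
      by (simp add: kid_cells_def sep_cells_def sep_len_def)
    have "cells_stored M3 (TB + 8 * ?p1) (TB + 8 * (?p1 + ?g)) (TB + 8 * ?p1) (tmpl ?p1 (And Fs))"
      using k unfolding parsed_def kc by (auto simp: M2_def patch_def Let_def)
    then show "cells_stored M4 (TB + 8 * ?p1) (TB + 8 * (?p1 + ?g)) (TB + 8 * ?p1) (tmpl ?p1 (And Fs))"
      by (rule cells_stored_cong) (use cl(3) in \<open>auto simp del: tmpl.simps\<close>)
    show "length (tmpl ?p1 (And Fs)) = ?g" by (simp del: tmpl.simps)
  qed (use rd k' in auto)
  then show "\<exists>R' M'. parsed sp ip p ?ts (\<lambda>hS hT. sep_cells ?q (M ?q) hS hT @ tmpl ?p1 (And Fs))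
       (sep_len ?q + glen (And Fs)) c (R, M) (R', M')" unfolding glen.simps by blast
qed

text \<open>An OR gate from the moment when its frame and head exist. This is separate from the
  treatment of the token because the root gate also uses it, whose frame and head are set up by
  \<open>layout_code\<close> without any token.\<close>

lemma parse_or_block:
  assumes Fs: "\<forall>F\<in>set Fs. parses F" "length Fs \<le> Lmax" "Fs \<noteq> []"
    and rd: "ready R M sp ip (p + 3) (concat (map encode Fs)) (sum_list (map (\<lambda>F. 2 + glen F) Fs))"
    and fr: "M sp = length Fs" "M (sp + 1) = TB + 8 * p" "M (TB + 8 * p) = 2 * p" "2 \<le> sp"
    and head: "\<forall>hS hT. cells_stored (M(TB + 8 * p + 6 := hS, TB + 8 * p + 7 := hT)) (TB + 8 * p) (TB + 8
        * p + 24) (TB + 8 * p)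
      [(2*p, 2*p, 2*p, 2*p, 0, 0), (2*p+5, hT, 2*p+4, hT, 0, 0), (2*p+5, hT, 2*p+4, 2*p+4, 0, 0)]"
    and room: "p + glen (Or Fs) \<le> Lmax"
  shows "\<exists>k R' M'. k \<le> length (concat (map encode Fs)) + 1 \<and> iterate w rSB rSP parse_body k (R, M) (R', M') \<and>
    parse_regs R0 TB R' (sp - 2) (ip + length (concat (map encode Fs))) (p + glen (Or Fs)) \<and>
    (\<forall>y<TB + 8 * p. y \<noteq> sp \<longrightarrow> \<not> (sp + 2 \<le> y \<and> y < TB) \<longrightarrow> M' y = M y) \<and>
    cells_stored M' (TB + 8 * p) (TB + 8 * (p + glen (Or Fs))) (TB + 8 * p) (tmpl p (Or Fs))"
proof -
  define A r where "A = TB + 8 * p" and "r = or_end p Fs"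
  let ?ts = "concat (map encode Fs)" and ?g = "sum_list (map (\<lambda>F. 2 + glen F) Fs)"
  have stack: "sp + 2 + length ?ts \<le> TB" "R rSB < sp" using rd unfolding ready_def by auto
  have r: "r = p + 3 + ?g" "p + glen (Or Fs) = r + 3" unfolding r_def or_end_def by simp_all
  have A0: "A \<noteq> 0" "TB \<le> A" using stack unfolding A_def by auto
  have sl: "sep_len A = 2" using A0 unfolding sep_len_def by simp
  have M: "M (sp + 1) = A" "M A = 2 * p" using fr unfolding A_def by auto
  have "\<exists>R' M'. parsed sp ip (p + 3) ?ts (kid_cells (M (sp + 1)) (M (M (sp + 1))) (p + 3) Fs)
      (sum_list (map (\<lambda>F. sep_len (M (sp + 1)) + glen F) Fs)) 0 (R, M) (R', M')"
    by (rule parse_kids) (use Fs rd fr(1) M sl in auto)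
  then obtain R3 M3 where k: "parsed sp ip (p + 3) ?ts (kid_cells A (2 * p) (p + 3) Fs) ?g 0 (R, M) (R3, M3)"
    unfolding M sl by auto
  have regs3: "parse_regs R0 TB R3 sp (ip + length ?ts) r" and M3sp: "M3 sp = 0"
    and kids3: "\<And>hS hT. cells_stored (patch M3 A hS hT) A (TB + 8 * r) (TB + 8 * (p + 3)) (kid_cells A
        (2 * p) (p + 3) Fs hS hT)"
    using k A0 M[simplified] unfolding parsed_def r by (auto simp: Let_def)
  have M3q: "M3 (sp + 1) = A" "M3 A = 2 * p" using ready_parent[OF rd k] M A0 by auto
  have SB: "R3 rSB < sp" using stack regs3 rd unfolding ready_def parse_regs_def by auto
  have par: "A = 0 \<or> TB \<le> A \<and> A + 8 \<le> TB + 8 * r \<and> M3 A \<le> 2 * r \<and> 0 < r"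
    using M3q A0 unfolding r A_def by simp
  have room': "A = 0 \<or> r + 3 \<le> Lmax" using room r by simp
  obtain R4 M4 where cl: "iterate w rSB rSP parse_body 1 (R3, M3) (R4, M4)"
    "parse_regs R0 TB R4 (sp - 2) (ip + length ?ts) (r + 3)"
    "\<forall>y<TB + 8 * r. M4 y = patch M3 A (2 * r - 1) (2 * r) y"
    "cells_stored M4 A (TB + 8 * (r + 3)) (TB + 8 * r)
      [(2*p+5, 2*r, 2*r, 2*r, 0, 0), (2*p+5, 2*r, 2*p+4, 2*r, 0, 0), (2*r+4, 2*r+4, 2*r+4, 2*r+4, 0, 0)]"
    using close_frame[OF regs3 SB fr(4) _ M3sp M3q(1) room' par] A0 stack word M3q by auto
  obtain j where j: "j \<le> length ?ts" "iterate w rSB rSP parse_body j (R, M) (R3, M3)" using k unfolding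
      parsed_def by auto
  have "iterate w rSB rSP parse_body (j + 1) (R, M) (R4, M4)" by (rule iterate_trans[OF j(2) cl(1)])
  moreover have "M4 y = M y" if "y < TB + 8 * p" "y \<noteq> sp" "\<not> (sp + 2 \<le> y \<and> y < TB)" for y
    using parsed_unchanged[OF k, of y] cl(3) that r unfolding patch_def A_def by auto
  moreover have "cells_stored M4 A (TB + 8 * (r + 3)) A (tmpl p (Or Fs))"
  proof -
    have "cells_stored (patch M A (2 * r - 1) (2 * r)) A (TB + 8 * (p + 3)) A (or_head p r)"
      using head[rule_format, of "2 * r - 1" "2 * r"] A0 unfolding patch_def A_def or_head_def leaf_def
      by (auto simp: algebra_simps)
    then have "cells_stored M4 A (TB + 8 * (p + 3)) A (or_head p r)"
    proof (rule cells_stored_cong)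
      fix y assume y: "A \<le> y" "y < TB + 8 * (p + 3)"
      then have "M3 y = M y" using parsed_unchanged[OF k, of y] A0 stack by auto
      then show "M4 y = patch M A (2 * r - 1) (2 * r) y" using cl(3) y r unfolding patch_def by auto
    qed (auto simp: or_head_def A_def)
    then have 1: "cells_stored M4 A (TB + 8 * (r + 3)) A (or_head p r)" by (rule cells_stored_mono)
        (simp_all add: r)
    \<comment> \<open>The slots now hold \<open>2r - 1\<close> and \<open>2r\<close>. For these
      values the statement about all \<open>hS\<close> and \<open>hT\<close> turns into the cells of
      the template.\<close>
    have kc: "kid_cells A (2 * p) (p + 3) Fs (2 * r - 1) (2 * r) = concat (map (\<lambda>c. or_sep p r @ c)
        (kids 2 (p + 3) Fs))"
      using A0 by (simp add: kid_cells_def sep_cells_def sl sep_pair_def or_sep_def)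
    have lk: "length (kid_cells A (2 * p) (p + 3) Fs (2 * r - 1) (2 * r)) = ?g" by (simp add: sl)
    have "cells_stored M4 A (TB + 8 * r) (TB + 8 * (p + 3)) (kid_cells A (2 * p) (p + 3) Fs (2 * r - 1)
        (2 * r))"
      by (rule cells_stored_cong[OF kids3]) (use cl(3) in \<open>auto simp only: lk\<close>, simp_all add: A_def r)
    then have 2: "cells_stored M4 A (TB + 8 * (r + 3)) (TB + 8 * (p + 3)) (concat (map (\<lambda>c. or_sep p r @
        c) (kids 2 (p + 3) Fs)))"
      unfolding kc by (rule cells_stored_mono) simp_all
    have e: "2 * (r + 2) = 2 * r + 4" by simp
    have 3: "cells_stored M4 A (TB + 8 * (r + 3)) (TB + 8 * r) (or_tail p r)" using cl(4) unfolding
        or_tail_def leaf_def e .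
    have len: "A + 8 * length (or_head p r) = TB + 8 * (p + 3)"
      "TB + 8 * (p + 3) + 8 * length (concat (map (\<lambda>c. or_sep p r @ c) (kids 2 (p + 3) Fs))) = TB + 8 * r"
      using lk unfolding kc by (simp_all add: or_head_def A_def r)
    show ?thesis unfolding tmpl.simps r_def[symmetric] cells_stored_append len using 1 2 3 by simp
  qed
  ultimately show ?thesis using cl(2) j(1) unfolding r(2) A_def[symmetric]
    by (intro exI[of _ "j + 1"] exI[of _ R4] exI[of _ M4]) (simp del: tmpl.simps)
qed

lemma parses_Or:
  assumes "2 \<le> length Fs" "\<forall>F\<in>set Fs. parses F" "\<forall>F\<in>set Fs. 1 \<le> glen F"
  shows "parses (Or Fs)"
  unfolding parses_def
proof (intro allI impI)
  fix R M :: "nat \<Rightarrow> nat" and sp ip p c :: nat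
  let ?ts = "encode (Or Fs)" and ?q = "M (sp + 1)"
  let ?p1 = "p + sep_len ?q" and ?g = "sum_list (map (\<lambda>F. 2 + glen F) Fs)"
  assume rd: "ready R M sp ip p ?ts (sep_len ?q + glen (Or Fs))" and c: "M sp = Suc c"
  obtain R1 M1 where "fetched R M sp ip p c ?ts R1 M1" using fetch_token[OF rd _ c] by auto
  note f = fetchedD[OF this]
  let ?kts = "concat (map encode Fs)"
  define A where "A = TB + 8 * ?p1"
  have stack: "len + n < sp" "sp + 4 + length ?kts \<le> TB" "?p1 + glen (Or Fs) \<le> Lmax" "ip + 2 + length
      ?kts \<le> len"
    and SB: "R0 rSB < sp"
    using rd f(2) unfolding ready_def parse_regs_def by auto
  have c1: "small_consts R1" using parse_regs_consts[OF f(2) R0(1)] .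
  have lenFs: "length Fs \<le> ?g" by (induction Fs) auto
  define R1' where "R1' = R1(rSP := sp + 2, rAd := Suc (sp + 2))"
  define M1' where "M1' = M1(sp + 2 := length Fs, Suc (sp + 2) := A)"
  have c1': "small_consts R1'" using c1 unfolding small_consts_def R1'_def by simp
  have pr1': "parse_regs R0 TB R1' (sp + 2) (ip + 2) ?p1" using f(2) unfolding R1'_def parse_regs_def by simp
  have R1': "R1' rTP = A" "R1' rLab = 2 * ?p1" using pr1' unfolding parse_regs_def A_def by auto
  have wd: "A + 24 < 2 ^ w" "2 * ?p1 + 6 < 2 ^ w" using stack word unfolding A_def by auto
  obtain R2 M2 where h: "sem w head_code (R1', M1') = (R2, M2)" "advance 3 R1' R2"
    "\<forall>y. y < A \<or> A + 24 \<le> y \<longrightarrow> M2 y = M1' y" "M2 A = 2 * ?p1"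
    "\<forall>hS hT. cells_stored (M2(A + 6 := hS, A + 7 := hT)) A (A + 24) A
      [(2 * ?p1, 2 * ?p1, 2 * ?p1, 2 * ?p1, 0, 0), (2 * ?p1 + 5, hT, 2 * ?p1 + 4, hT, 0, 0),
       (2 * ?p1 + 5, hT, 2 * ?p1 + 4, 2 * ?p1 + 4, 0, 0)]"
    using sem_head[OF c1' R1'(1) wd(1) R1'(2) wd(2)] by blast
  have "sem w parse_body (R, M) = sem w head_code (R1', M1')"
    unfolding f(1) R1'_def M1'_def token_code_def using c1 f(2-4) stack word A_def unfolding
        small_consts_def parse_regs_def by simp
  then have sem: "sem w parse_body (R, M) = (R2, M2)" using h(1) by simp
  have regs2: "parse_regs R0 TB R2 (sp + 2) (ip + 2) (?p1 + 3)" by (rule parse_regs_advance[OF pr1' h(2)])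
  have spA: "sp + 4 \<le> A" using stack unfolding A_def by auto
  have tok: "M2 (ip + 2 + j) = ?kts ! j" if "j < length ?kts" for j
  proof -
    have "\<forall>j<length ?ts. M (ip + j) = ?ts ! j" using rd unfolding ready_def by blast
    from this[rule_format, of "2 + j"] have "M (ip + (2 + j)) = ?ts ! (2 + j)" using that by simp
    then show ?thesis using that stack spA f(6) h(3) unfolding M1'_def by (auto simp: add.assoc)
  qed
  have tab: "M2 (len + i) = 2 ^ (i - 1)" if "1 \<le> i" "i \<le> n" for i
    using that stack spA f(6) h(3) rd unfolding M1'_def ready_def by auto
  have M2: "M2 (sp + 2) = length Fs" "M2 (sp + 2 + 1) = A" "M2 sp = c"
    using h(3) spA f(5) unfolding M1'_def by auto
  have rd2: "ready R2 M2 (sp + 2) (ip + 2) (?p1 + 3) ?kts ?g"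
    using tok tab regs2 stack SB lenFs h(4) M2 unfolding ready_def
    by (auto simp: parse_regs_def A_def)
  have "\<exists>k R4 M4. k \<le> length ?kts + 1 \<and> iterate w rSB rSP parse_body k (R2, M2) (R4, M4) \<and>
    parse_regs R0 TB R4 (sp + 2 - 2) (ip + 2 + length ?kts) (?p1 + glen (Or Fs)) \<and>
    (\<forall>y<TB + 8 * ?p1. y \<noteq> sp + 2 \<longrightarrow> \<not> (sp + 2 + 2 \<le> y \<and> y < TB) \<longrightarrow> M4 y = M2 y) \<and>
    cells_stored M4 (TB + 8 * ?p1) (TB + 8 * (?p1 + glen (Or Fs))) (TB + 8 * ?p1) (tmpl ?p1 (Or Fs))"
  proof (rule parse_or_block[OF assms(2) _ _ rd2])
    show "length Fs \<le> Lmax" "Fs \<noteq> []" "2 \<le> sp + 2" using stack(3) lenFs assms(1) by auto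
  qed (use M2 h(4,5) stack in \<open>simp_all add: A_def\<close>)
  then obtain k R4 M4 where k: "k \<le> length ?kts + 1" "iterate w rSB rSP parse_body k (R2, M2) (R4, M4)"
    "parse_regs R0 TB R4 (sp + 2 - 2) (ip + 2 + length ?kts) (?p1 + glen (Or Fs))"
    "\<forall>y<TB + 8 * ?p1. y \<noteq> sp + 2 \<longrightarrow> \<not> (sp + 2 + 2 \<le> y \<and> y < TB) \<longrightarrow> M4 y = M2 y"
    "cells_stored M4 (TB + 8 * ?p1) (TB + 8 * (?p1 + glen (Or Fs))) (TB + 8 * ?p1) (tmpl ?p1 (Or Fs))"
    by blast
  have low: "M4 y = M1 y" if "y < TB + 8 * ?p1" "\<not> (sp + 2 \<le> y \<and> y < TB)" for y
    using k(4) h(3) that stack unfolding M1'_def A_def by auto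
  have "parsed sp ip p ?ts (\<lambda>hS hT. sep_cells ?q (M ?q) hS hT @ tmpl ?p1 (Or Fs)) (sep_len ?q + glen (Or
      Fs)) c (R, M) (R4, M4)"
  proof (rule parsed_assemble[OF _ refl sem k(2) _ f(6,7)])
    show "parse_regs R0 TB R4 sp (ip + length ?ts) (?p1 + glen (Or Fs))" using k(3) by (simp add:
        algebra_simps)
    show "M4 sp = c" using low[of sp] stack f(5) by auto
    show "unchanged TB sp (TB + 8 * ?p1) M1 M4" using low unfolding unchanged_def by auto
    show "length (tmpl ?p1 (Or Fs)) = glen (Or Fs)" by (simp del: tmpl.simps)
  qed (use rd k in \<open>auto simp del: tmpl.simps\<close>)
  then show "\<exists>R' M'. parsed sp ip p ?ts (\<lambda>hS hT. sep_cells ?q (M ?q) hS hT @ tmpl ?p1 (Or Fs))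
       (sep_len ?q + glen (Or Fs)) c (R, M) (R', M')" by blast
qed

lemma parses_formula: "formula_over n F \<Longrightarrow> parses F"
proof (induction F)
  case (Lit b i)
  then show ?case using parses_Lit by simp
next
  case (And Fs)
  then show ?case using parses_And glen_pos[of n] by simp
next
  case (Or Fs)
  then show ?case using parses_Or glen_pos[of n] by simp
qed

end

section \<open>Emitting the vertices\<close>

abbreviation (input) "rI \<equiv> 29 :: nat"
abbreviation (input) "rX \<equiv> 30 :: nat"
abbreviation (input) "rPO \<equiv> 31 :: nat"
abbreviation (input) "rQO \<equiv> 32 :: nat"
abbreviation (input) "rSeg0 \<equiv> 33 :: nat"
abbreviation (input) "rSeg1 \<equiv> 34 :: nat"
abbreviation (input) "rM \<equiv> 35 :: nat"
abbreviation (input) "rD \<equiv> 36 :: nat"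
abbreviation (input) "rXH \<equiv> 37 :: nat"
abbreviation (input) "rLo \<equiv> 38 :: nat"
abbreviation (input) "rHi \<equiv> 39 :: nat"
abbreviation (input) "rQl \<equiv> 40 :: nat"
abbreviation (input) "rQh \<equiv> 41 :: nat"
abbreviation (input) "rP \<equiv> 42 :: nat"
abbreviation (input) "rG \<equiv> 43 :: nat"
abbreviation (input) "rF \<equiv> 44 :: nat"
abbreviation (input) "rE \<equiv> 45 :: nat"
abbreviation (input) "rSum \<equiv> 46 :: nat"
abbreviation (input) "rDf \<equiv> 47 :: nat"
abbreviation (input) "rA \<equiv> 48 :: nat"
abbreviation (input) "rX1 \<equiv> 49 :: nat"

definition load_cell :: program where
  "load_cell = ld rLo rC ;; ar Add rA rC rOne ;; ld rHi rA ;; ld rHi rHi ;; ar Add rA rA rOne ;; ld rQl rA ;;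
     ar Add rA rA rOne ;; ld rQh rA ;; ld rQh rQh ;; ar Add rA rA rOne ;; ld rP rA ;; ar Add rA rA rOne
         ;; ld rG rA"

text \<open>Computes a remainder modulo 2, for which the machine has no instruction.\<close>

definition parity :: program where
  "parity = ar Div rE rF rTwo ;; ar Add rE rE rE ;; ar Sub rF rF rE"

definition put_vertex :: "nat \<Rightarrow> program" where
  "put_vertex b = st b rSum ;; ar Add b b rOne ;; st b rM ;; ar Add b b rOne ;; st b rDf ;; ar Add b b rOne ;;
     st b rD ;; ar Add b b rOne"

definition vertex_words :: "(nat \<Rightarrow> nat) \<Rightarrow> nat \<Rightarrow> nat \<Rightarrow> nat \<Rightarrow> nat \<Rightarrow> nat \<Rightarrow> nat \<Rightarrow> nat" where
  "vertex_words M x a b c d = M(x := a, x + 1 := b, x + 2 := c, x + 3 := d)"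

definition put_p :: program where
  "put_p = ar Div rF rX rP ;; parity ;; ar Add rLo rLo rF ;; ar Add rHi rHi rF ;; ar Add rSum rLo rHi ;;
     ar Sub rDf rHi rLo ;; ar Mul rDf rDf rDf ;; put_vertex rPO"

definition put_q :: program where
  "put_q = ar Div rF rXH rP ;; ar Add rF rF rG ;; parity ;; ar Add rQl rQl rF ;; ar Add rQh rQh rF ;;
     ar Add rSum rQl rQh ;; ar Sub rDf rQh rQl ;; ar Mul rDf rDf rDf ;; ar Sub rE rD rOne ;; ar Sub rDf
         rE rDf ;;
     put_vertex rQO"

text \<open>At the end of a block the cursor returns to the separators as long as block numbers
  remain. In the tail both tests fail at every step, so it runs straight to the end.
  \<open>rXH\<close> follows \<open>rX\<close> as its multiple by \<open>H\<close>, which moves the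
  bits of the \<open>Q\<close> block number to the high half.\<close>

definition next_cell :: program where
  "next_cell = ar Add rC rC rEight ;; ar Add rI rI rOne ;;
     IfLess rC rSeg1 (cst rA 0)
      (ar Add rX1 rX rOne ;;
       IfLess rX1 rH (ar Add rX rX1 rZ ;; ar Add rXH rXH rH ;; ar Add rC rSeg0 rZ) (cst rA 0))"

definition vertex_body :: program where
  "vertex_body = load_cell ;; put_p ;; put_q ;; next_cell"

definition same_below :: "nat \<Rightarrow> nat set \<Rightarrow> (nat \<Rightarrow> nat) \<Rightarrow> (nat \<Rightarrow> nat) \<Rightarrow> bool" where
  "same_below k S R R' \<longleftrightarrow> (\<forall>r<k. r \<notin> S \<longrightarrow> R' r = R r)"

lemma sem_load_cell:
  assumes "small_consts R" "R rC + 8 < 2 ^ w" "cell_stored M lo hi (R rC) (pl, ph, ql, qh, pw, sg)"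
  shows "\<exists>R'. sem w load_cell (R, M) = (R', M) \<and> same_below 38 {} R R' \<and>
    R' rLo = pl \<and> R' rHi = ph \<and> R' rQl = ql \<and> R' rQh = qh \<and> R' rP = pw \<and> R' rG = sg"
proof -
  have e: "R rC + 3 = Suc (Suc (Suc (R rC)))" "R rC + 4 = Suc (Suc (Suc (Suc (R rC))))"
    "R rC + 5 = Suc (Suc (Suc (Suc (Suc (R rC)))))" by simp_all
  then show ?thesis using assms by (simp add: load_cell_def small_consts_def cell_stored_def same_below_def e)
qed

lemma sem_parity:
  assumes "small_consts R" "R rF < 2 ^ w"
  shows "sem w parity (R, M) = (R(rE := R rF div 2 + R rF div 2, rF := R rF mod 2), M)"
proof -
  have "R rF div 2 + R rF div 2 \<le> R rF" by simp
  then have "R rF div 2 + R rF div 2 < 2 ^ w" using assms by linarith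
  moreover have "R rF - (R rF div 2 + R rF div 2) = R rF mod 2" by presburger
  ultimately show ?thesis using assms by (simp add: parity_def small_consts_def)
qed

lemma sem_put_vertex:
  assumes "small_consts R" "R b + 4 < 2 ^ w" "b \<notin> {rOne, rSum, rM, rDf, rD}"
  shows "sem w (put_vertex b) (R, M) = (R(b := R b + 4), vertex_words M (R b) (R rSum) (R rM) (R rDf) (R rD))"
proof -
  have e: "R b + 4 = Suc (Suc (Suc (Suc (R b))))" "R b + 3 = Suc (Suc (Suc (R b)))" by simp_all
  then show ?thesis using assms by (simp add: put_vertex_def small_consts_def vertex_words_def e)
qed

lemma sem_put_p:
  assumes c: "small_consts R" and l: "R rLo = pl" "R rHi = ph" "R rP = pw"
    and lab: "pl + (R rX div pw) mod 2 = L" "ph + (R rX div pw) mod 2 = r" "L \<le> r" "r < X"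
    and w: "R rX < 2 ^ w" "2 * X < 2 ^ w" "X * X < 2 ^ w" "R rPO + 4 < 2 ^ w"
  shows "\<exists>R'. sem w put_p (R, M) = (R', vertex_words M (R rPO) (L + r) (R rM) ((r - L) * (r - L)) (R rD)) \<and>
    same_below 38 {rPO} R R' \<and> R' rPO = R rPO + 4 \<and> R' rQl = R rQl \<and> R' rQh = R rQh \<and> R' rP = R rP \<and> R'
        rG = R rG"
proof -
  let ?f = "R rX div pw"
  define R1 where "R1 = R(rF := ?f)"
  define R2 where "R2 = R(rE := ?f div 2 + ?f div 2, rF := ?f mod 2)"
  have "?f \<le> R rX" by simp
  then have f: "?f < 2 ^ w" using w(1) by linarith
  have c1: "small_consts R1" using c unfolding R1_def small_consts_def by simp
  have par: "sem w parity (R1, M) = (R2, M)"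
    using sem_parity[OF c1, of w M] f unfolding R1_def R2_def by (simp add: fun_upd_twist)
  define R3 where "R3 = R2(rLo := L, rHi := r, rSum := L + r, rDf := (r - L) * (r - L))"
  have c3: "small_consts R3" using c unfolding R3_def R2_def small_consts_def by simp
  have "(r - L) * (r - L) \<le> X * X" using lab by (intro mult_mono) auto
  then have sq: "(r - L) * (r - L) < 2 ^ w" using w by linarith
  have "sem w put_p (R, M) = sem w (put_vertex rPO) (R3, M)"
  proof -
    have "sem w put_p (R, M) = sem w (ar Add rLo rLo rF ;; ar Add rHi rHi rF ;; ar Add rSum rLo rHi ;;
     ar Sub rDf rHi rLo ;; ar Mul rDf rDf rDf ;; put_vertex rPO) (sem w parity (R1, M))"
      unfolding put_p_def R1_def using l by simp
    then show ?thesis unfolding par R3_def using l lab w sq by (simp add: R2_def)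
  qed
  also have "\<dots> = (R3(rPO := R rPO + 4), vertex_words M (R rPO) (L + r) (R rM) ((r - L) * (r - L)) (R rD))"
    using sem_put_vertex[OF c3, of rPO w M] w unfolding R3_def R2_def by simp
  finally show ?thesis by (simp add: same_below_def R3_def R2_def)
qed

lemma sem_put_q:
  assumes c: "small_consts R" and l: "R rQl = ql" "R rQh = qh" "R rP = pw" "R rG = sg"
    and lab: "ql + (R rXH div pw + sg) mod 2 = L" "qh + (R rXH div pw + sg) mod 2 = r" "L \<le> r" "r < X"
    and w: "R rXH div pw + sg < 2 ^ w" "2 * X < 2 ^ w" "X * X < 2 ^ w" "R rQO + 4 < 2 ^ w"
    and D: "R rD < 2 ^ w" "(r - L) * (r - L) < R rD"
  shows "\<exists>R'. sem w put_q (R, M) = (R', vertex_words M (R rQO) (L + r) (R rM) (R rD - 1 - (r - L) * (r -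
      L)) (R rD)) \<and>
    same_below 38 {rQO} R R' \<and> R' rQO = R rQO + 4"
proof -
  let ?f = "R rXH div pw + sg"
  define R1 where "R1 = R(rF := ?f)"
  define R2 where "R2 = R(rE := ?f div 2 + ?f div 2, rF := ?f mod 2)"
  have c1: "small_consts R1" using c unfolding R1_def small_consts_def by simp
  have par: "sem w parity (R1, M) = (R2, M)"
    using sem_parity[OF c1, of w M] w(1) unfolding R1_def R2_def by (simp add: fun_upd_twist)
  define R3 where "R3 = R2(rQl := L, rQh := r, rSum := L + r, rE := R rD - 1, rDf := R rD - 1 - (r - L)
      * (r - L))"
  have c3: "small_consts R3" using c unfolding R3_def R2_def small_consts_def by simp
  have sq: "(r - L) * (r - L) < 2 ^ w" "(r - L) * (r - L) \<le> R rD - 1" "R rD - 1 < 2 ^ w" "1 \<le> R rD"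
    using D by linarith+
  have "sem w put_q (R, M) = sem w (put_vertex rQO) (R3, M)"
  proof -
    have "sem w put_q (R, M) = sem w (ar Add rQl rQl rF ;; ar Add rQh rQh rF ;;
     ar Add rSum rQl rQh ;; ar Sub rDf rQh rQl ;; ar Mul rDf rDf rDf ;; ar Sub rE rD rOne ;; ar Sub rDf
         rE rDf ;;
     put_vertex rQO) (sem w parity (R1, M))"
      unfolding put_q_def R1_def using l w(1) by simp
    then show ?thesis unfolding par R3_def using l lab w sq D c by (simp add: R2_def small_consts_def)
  qed
  also have "\<dots> = (R3(rQO := R rQO + 4), vertex_words M (R rQO) (L + r) (R rM) (R rD - 1 - (r - L) * (r -
      L)) (R rD))"
    using sem_put_vertex[OF c3, of rQO w M] w unfolding R3_def R2_def by simp
  finally show ?thesis by (simp add: same_below_def R3_def R2_def)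
qed

lemma sem_next_cell:
  assumes c: "small_consts R" and w: "R rC + 8 < 2 ^ w" "R rI + 1 < 2 ^ w" "R rX + 1 < 2 ^ w" "R rXH + R
      rH < 2 ^ w" "R rSeg0 < 2 ^ w"
  shows "\<exists>R'. sem w next_cell (R, M) = (R', M) \<and> same_below 38 {rC, rI, rX, rXH} R R' \<and> R' rI = R rI + 1 \<and>
    (R' rC, R' rX, R' rXH) = (if R rC + 8 < R rSeg1 then (R rC + 8, R rX, R rXH)
       else if R rX + 1 < R rH then (R rSeg0, R rX + 1, R rXH + R rH) else (R rC + 8, R rX, R rXH))"
  using assms by (simp add: next_cell_def small_consts_def same_below_def)

text \<open>The cursor gives, for the \<open>t\<close>-th vertex, the cell it comes from and its block.\<close>

fun cursor :: "nat \<Rightarrow> nat \<Rightarrow> nat \<Rightarrow> nat \<times> nat" where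
  "cursor m H 0 = (0, 0)"
| "cursor m H (Suc t) = (let (i, x) = cursor m H t in
     if Suc i < 3 + m then (Suc i, x) else if Suc x < H then (3, Suc x) else (Suc i, x))"

lemma cursor_head: "t < 3 + m \<Longrightarrow> cursor m H t = (t, 0)"
  by (induction t) auto

lemma cursor_blocks: "a < H \<Longrightarrow> u < m \<Longrightarrow> cursor m H (3 + a * m + u) = (3 + u, a)"
proof (induction a arbitrary: u)
  case 0
  then show ?case by (simp add: cursor_head)
next
  case (Suc a)
  show ?case using Suc.prems(2)
  proof (induction u)
    case 0
    then obtain m' where m: "m = Suc m'" by (cases m) auto
    have "cursor m H (3 + a * m + m') = (3 + m', a)" using Suc m by simp
    moreover have "3 + Suc a * m + 0 = Suc (3 + a * m + m')" using m by simp
    ultimately show ?case using Suc.prems m by (simp only: cursor.simps) simp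
  next
    case (Suc u)
    then have IH: "cursor m H (3 + Suc a * m + u) = (3 + u, Suc a)" by simp
    have "3 + Suc a * m + Suc u = Suc (3 + Suc a * m + u)" by simp
    then show ?case using IH Suc.prems by (simp only: cursor.simps) simp
  qed
qed

lemma cursor_tail:
  assumes "0 < H" "0 < m" shows "v < 3 \<Longrightarrow> cursor m H (3 + H * m + v) = (3 + m + v, H - 1)"
proof (induction v)
  case 0
  obtain m' h' where m: "m = Suc m'" "H = Suc h'" using assms by (metis gr0_conv_Suc)
  have "cursor m H (3 + h' * m + m') = (3 + m', h')" using m by (intro cursor_blocks) auto
  moreover have "3 + H * m + 0 = Suc (3 + h' * m + m')" using m by simp
  ultimately show ?case using m by (simp only: cursor.simps) simp
next
  case (Suc v)
  then have IH: "cursor m H (3 + H * m + v) = (3 + m + v, H - 1)" by simp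
  have "3 + H * m + Suc v = Suc (3 + H * m + v)" by simp
  then show ?case using IH assms by (simp only: cursor.simps) simp
qed

lemma cursor_cases:
  assumes "t < 6 + H * m" "0 < H" "0 < m"
  obtains "t < 3" "cursor m H t = (t, 0)"
  | a u where "a < H" "u < m" "t = 3 + a * m + u" "cursor m H t = (3 + u, a)"
  | v where "v < 3" "t = 3 + H * m + v" "cursor m H t = (3 + m + v, H - 1)"
proof -
  consider "t < 3" | "3 \<le> t" "t < 3 + H * m" | "3 + H * m \<le> t" by linarith
  then show thesis
  proof cases
    case 1
    then show thesis using that(1) cursor_head[of t m H] by simp
  next
    case 2
    then have "(t - 3) div m < H" "(t - 3) mod m < m" "t = 3 + (t - 3) div m * m + (t - 3) mod m"
      using assms by (auto simp: less_mult_imp_div_less div_mult_mod_eq)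
    then show thesis using that(2) cursor_blocks by metis
  next
    case 3
    then have "t - (3 + H * m) < 3" "t = 3 + H * m + (t - (3 + H * m))" using assms by auto
    then show thesis using that(3) cursor_tail[OF assms(2,3)] by metis
  qed
qed

lemma cursor_bounds:
  assumes "t < 6 + H * m" "0 < H" "0 < m" "cursor m H t = (i, x)"
  shows "i < 6 + m" "x < H"
  by (rule cursor_cases[OF assms(1-3)]; use assms in auto)+

definition p_stored :: "nat \<Rightarrow> (nat \<Rightarrow> nat) \<Rightarrow> nat \<Rightarrow> nat \<times> nat \<Rightarrow> bool" where
  "p_stored X M x = (\<lambda>(l, r). M x = l + r \<and> M (x + 1) = X * X \<and> M (x + 2) = (r - l) * (r - l) \<and>
     M (x + 3) = 2 * (X * X * (X * X)))"

definition q_stored :: "nat \<Rightarrow> (nat \<Rightarrow> nat) \<Rightarrow> nat \<Rightarrow> nat \<times> nat \<Rightarrow> bool" where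
  "q_stored X M x = (\<lambda>(l, r). M x = l + r \<and> M (x + 1) = X * X \<and>
     M (x + 2) = 2 * (X * X * (X * X)) - 1 - (r - l) * (r - l) \<and> M (x + 3) = 2 * (X * X * (X * X)))"

definition cell_sign :: "cell \<Rightarrow> nat" where "cell_sign = (\<lambda>(pl, ph, ql, qh, pw, sg). sg)"

definition valid_label :: "nat \<Rightarrow> nat \<times> nat \<Rightarrow> bool" where "valid_label X = (\<lambda>(l, r). l \<le> r \<and> r < X)"

lemma emit_vertices:
  fixes cells :: "cell list" and m H X TB :: nat
  defines "N \<equiv> 6 + H * m" and "OP \<equiv> TB + 8 * (6 + m)" and "D \<equiv> 2 * (X * X * (X * X))"
  assumes R1: "small_consts R1" "R1 2 = N" "R1 rH = H" "R1 rSeg0 = TB + 24" "R1 rSeg1 = TB + 8 * (3 + m)"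
    "R1 rM = X * X" "R1 rD = D" "R1 rC = TB" "R1 rX = 0" "R1 rXH = 0" "R1 rI = 0" "R1 rPO = OP" "R1 rQO
        = OP + 4 * N"
    and cells: "cells_stored M1 TB OP TB cells" "length cells = 6 + m" "\<And>c. c \<in> set cells \<Longrightarrow> cell_sign c \<le> 1"
    and pos: "0 < H" "0 < m"
    and labels: "\<And>t i x. t < N \<Longrightarrow> cursor m H t = (i, x) \<Longrightarrow>
        valid_label X (plabel x (cells ! i)) \<and> valid_label X (qlabel (x * H) (cells ! i))"
    and w: "OP + 8 * N + 8 < 2 ^ w" "2 * D < 2 ^ w" "H * H + 1 < 2 ^ w"
  shows "\<exists>R M. iterate w rI 2 vertex_body N (R1, M1) (R, M) \<and> (\<forall>r\<le>2. R r = R1 r) \<and> R rI = N \<and>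
    (\<forall>t<N. p_stored X M (OP + 4 * t) ((\<lambda>(i, x). plabel x (cells ! i)) (cursor m H t)) \<and>
      q_stored X M (OP + 4 * N + 4 * t) ((\<lambda>(i, x). qlabel (x * H) (cells ! i)) (cursor m H t)))"
proof -
  let ?pl = "\<lambda>t. (\<lambda>(i, x). plabel x (cells ! i)) (cursor m H t)"
  let ?ql = "\<lambda>t. (\<lambda>(i, x). qlabel (x * H) (cells ! i)) (cursor m H t)"
  define OQ where "OQ = OP + 4 * N"
  define inv where "inv = (\<lambda>t (R :: nat \<Rightarrow> nat, M).
     same_below 28 {} R1 R \<and> R rSeg0 = R1 rSeg0 \<and> R rSeg1 = R1 rSeg1 \<and> R rM = X * X \<and> R rD = D \<and> R rI = t \<and>
     R rC = TB + 8 * fst (cursor m H t) \<and> R rX = snd (cursor m H t) \<and> R rXH = snd (cursor m H t) * H \<and>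
     R rPO = OP + 4 * t \<and> R rQO = OQ + 4 * t \<and> (\<forall>y<OP. M y = M1 y) \<and>
     (\<forall>j<t. p_stored X M (OP + 4 * j) (?pl j) \<and> q_stored X M (OQ + 4 * j) (?ql j)))"
  have init: "inv 0 (R1, M1)" unfolding inv_def OQ_def using R1 by (simp add: same_below_def)
  have step: "fst \<sigma> rI < fst \<sigma> 2 \<and> inv (Suc t) (sem w vertex_body \<sigma>)" if t: "t < N" and I: "inv t \<sigma>" for t \<sigma>
  proof -
    obtain R M where \<sigma>: "\<sigma> = (R, M)" by (cases \<sigma>)
    obtain i x where cur: "cursor m H t = (i, x)" by (cases "cursor m H t")
    obtain pl ph ql qh pw sg where cell: "cells ! i = (pl, ph, ql, qh, pw, sg)" by (cases "cells ! i") auto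
    obtain L r where pL: "plabel x (cells ! i) = (L, r)" by (cases "plabel x (cells ! i)")
    obtain L' r' where qL: "qlabel (x * H) (cells ! i) = (L', r')" by (cases "qlabel (x * H) (cells ! i)")
    have b: "i < 6 + m" "x < H" using cursor_bounds[OF _ pos cur] t unfolding N_def by auto
    have lr: "L \<le> r" "r < X" "L' \<le> r'" "r' < X" using labels[OF t cur] pL qL unfolding valid_label_def by auto
    have R: "\<And>r. r < 28 \<Longrightarrow> R r = R1 r" "R rSeg0 = TB + 24" "R rSeg1 = TB + 8 * (3 + m)" "R rM = X * X" "R
        rD = D"
      "R rI = t" "R rC = TB + 8 * i" "R rX = x" "R rXH = x * H" "R rPO = OP + 4 * t" "R rQO = OQ + 4 * t"
      and M: "\<And>y. y < OP \<Longrightarrow> M y = M1 y"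
      and old: "\<And>j. j < t \<Longrightarrow> p_stored X M (OP + 4 * j) (?pl j) \<and> q_stored X M (OQ + 4 * j) (?ql j)"
      using I cur R1 unfolding inv_def \<sigma> same_below_def by auto
    have c: "small_consts R" using R1(1) R(1) unfolding small_consts_def by simp
    \<comment> \<open>Vertices are written at \<open>OP\<close> and above, whereas the cells and all
      addresses in them lie below; so the template can be reread for every block.\<close>
    have "cells_stored M TB OP TB cells" by (rule cells_stored_cong[OF cells(1)]) (use M cells(2) in
        \<open>auto simp: OP_def\<close>)
    then have ok: "cell_stored M TB OP (R rC) (pl, ph, ql, qh, pw, sg)"
      using cells_stored_nth[of M TB OP TB cells i] b cells(2) R(7) cell by simp
    have sg: "sg \<le> 1" using cells(3)[of "cells ! i"] nth_mem[of i cells] b cells(2) cell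
      unfolding cell_sign_def by simp
    have XX: "X \<le> X * X" "X * X \<le> X * X * (X * X)" using lr by (cases X; simp)+
    have ww: "2 * X < 2 ^ w" "X * X < 2 ^ w" "D < 2 ^ w" using w(2) XX unfolding D_def by linarith+
    have xH: "x * H + H \<le> H * H" using b(2) by (metis Suc_leI add.commute mult_Suc mult_le_mono1)
    then have xw: "x + 1 < 2 ^ w" "x * H + H < 2 ^ w" "x * H + 1 < 2 ^ w" using w(3) b pos
      by (auto intro: le_less_trans[of "Suc x" "H * H"] le_trans[of "Suc x" H])
    have "x * H div pw \<le> x * H" by simp
    then have sw: "x * H div pw + sg < 2 ^ w" using sg xw(3) by linarith
    have aw: "TB + 8 * i + 8 < 2 ^ w" "OP + 4 * t + 4 < 2 ^ w" "OQ + 4 * t + 4 < 2 ^ w" "t + 1 < 2 ^ w"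
      using w(1) b t unfolding OP_def OQ_def by auto
    obtain R2 where 2: "sem w load_cell (R, M) = (R2, M)" "same_below 38 {} R R2"
      "R2 rLo = pl" "R2 rHi = ph" "R2 rQl = ql" "R2 rQh = qh" "R2 rP = pw" "R2 rG = sg"
      using sem_load_cell[OF c _ ok] aw R by auto
    have r2: "\<And>r. r < 38 \<Longrightarrow> R2 r = R r" using 2(2) unfolding same_below_def by simp
    have c2: "small_consts R2" using c r2 unfolding small_consts_def by simp
    have lab: "pl + (R2 rX div pw) mod 2 = L" "ph + (R2 rX div pw) mod 2 = r"
      using pL r2 R(8) unfolding cell plabel_def by auto
    define M3 where "M3 = vertex_words M (OP + 4 * t) (L + r) (X * X) ((r - L) * (r - L)) D"
    obtain R3 where 3: "sem w put_p (R2, M) = (R3, M3)" "same_below 38 {rPO} R2 R3" "R3 rPO = OP + 4 * t + 4"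
      "R3 rQl = ql" "R3 rQh = qh" "R3 rP = pw" "R3 rG = sg"
      using sem_put_p[OF c2 2(3,4,7) lab lr(1,2), of w M] ww xw aw 2 r2 R(4,5,8,10) unfolding M3_def by auto
    have r3: "\<And>r. r < 38 \<Longrightarrow> r \<noteq> rPO \<Longrightarrow> R3 r = R r" using 3(2) r2 unfolding same_below_def by simp
    have c3: "small_consts R3" using c r3 unfolding small_consts_def by simp
    have lab': "ql + (R3 rXH div pw + sg) mod 2 = L'" "qh + (R3 rXH div pw + sg) mod 2 = r'"
      using qL r3 R(9) unfolding cell qlabel_def by auto
    have "(r' - L') * (r' - L') \<le> (X - 1) * (X - 1)" using lr by (intro mult_mono) auto
    also have "\<dots> < D" unfolding D_def using lr XX
      by (cases X) (auto intro: le_less_trans)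
    finally have sq: "(r' - L') * (r' - L') < D" .
    define M4 where "M4 = vertex_words M3 (OQ + 4 * t) (L' + r') (X * X) (D - 1 - (r' - L') * (r' - L')) D"
    obtain R4 where 4: "sem w put_q (R3, M3) = (R4, M4)" "same_below 38 {rQO} R3 R4" "R4 rQO = OQ + 4 * t + 4"
      using sem_put_q[OF c3 3(4-7) lab' lr(3,4), of w M3] ww sw aw sq 3 r3 R(4,5,9,11) unfolding M4_def
          by auto
    have r4: "\<And>r. r < 38 \<Longrightarrow> r \<noteq> rPO \<Longrightarrow> r \<noteq> rQO \<Longrightarrow> R4 r = R r" "R4 rPO = OP + 4 * t + 4"
      using 4(2) r3 3(3) unfolding same_below_def by simp_all
    have c4: "small_consts R4" using c r4 unfolding small_consts_def by simp
    have v4: "R4 rC = TB + 8 * i" "R4 rI = t" "R4 rX = x" "R4 rXH = x * H" "R4 rH = H" "R4 rSeg0 = TB + 24"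
      "R4 rSeg1 = TB + 8 * (3 + m)" using r4 R R1(3) by simp_all
    have tb: "TB + 24 < 2 ^ w" using w(1) unfolding OP_def by simp
    obtain R5 where 5: "sem w next_cell (R4, M4) = (R5, M4)" "same_below 38 {rC, rI, rX, rXH} R4 R5" "R5
        rI = t + 1"
      "(R5 rC, R5 rX, R5 rXH) = (if TB + 8 * i + 8 < TB + 8 * (3 + m) then (TB + 8 * i + 8, x, x * H)
       else if x + 1 < H then (TB + 24, x + 1, x * H + H) else (TB + 8 * i + 8, x, x * H))"
      using sem_next_cell[OF c4, of w M4, unfolded v4, OF aw(1,4) xw(1,2) tb] by blast
    have nxt: "R5 rC = TB + 8 * fst (cursor m H (Suc t))" "R5 rX = snd (cursor m H (Suc t))"
      "R5 rXH = snd (cursor m H (Suc t)) * H"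
      using 5(4) unfolding cursor.simps cur by (auto split: if_splits)
    have body: "sem w vertex_body \<sigma> = (R5, M4)" unfolding \<sigma> vertex_body_def using 2(1) 3(1) 4(1) 5(1) by simp
    have r5: "\<And>r. r < 38 \<Longrightarrow> r \<notin> {rPO, rQO, rC, rI, rX, rXH} \<Longrightarrow> R5 r = R r" "R5 rPO = OP + 4 * t + 4" "R5
        rQO = OQ + 4 * t + 4"
      using 5(2) r4 4(3) unfolding same_below_def by simp_all
    have M4: "M4 y = M y" if "y < OP + 4 * t \<or> (OP + 4 * t + 4 \<le> y \<and> y < OQ + 4 * t)" for y
      using that t unfolding M4_def M3_def vertex_words_def OQ_def by auto
    have new: "p_stored X M4 (OP + 4 * t) (?pl t)" "q_stored X M4 (OQ + 4 * t) (?ql t)"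
      using t unfolding cur split pL qL p_stored_def q_stored_def M4_def M3_def vertex_words_def OQ_def
          D_def by auto
    have stay: "p_stored X M4 (OP + 4 * j) (?pl j) \<and> q_stored X M4 (OQ + 4 * j) (?ql j)" if "j < t" for j
    proof -
      have "M4 (OP + 4 * j + k) = M (OP + 4 * j + k)" "M4 (OQ + 4 * j + k) = M (OQ + 4 * j + k)" if "k <
          4" for k
        using M4 that \<open>j < t\<close> t unfolding OQ_def by auto
      from this(1)[of 0] this(1)[of 1] this(1)[of 2] this(1)[of 3] this(2)[of 0] this(2)[of 1]
          this(2)[of 2] this(2)[of 3]
      show ?thesis using old[OF that] unfolding p_stored_def q_stored_def by (auto split: prod.splits)
    qed
    have "inv (Suc t) (R5, M4)" unfolding inv_def split
    proof (intro conjI)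
      show "same_below 28 {} R1 R5" using r5(1) R(1) unfolding same_below_def by auto
      show "\<forall>y<OP. M4 y = M1 y" using M4 M by auto
      show "\<forall>j<Suc t. p_stored X M4 (OP + 4 * j) (?pl j) \<and> q_stored X M4 (OQ + 4 * j) (?ql j)"
        using new stay less_Suc_eq by auto
    qed (use r5 R R1 nxt 5(3) in auto)
    moreover have "fst \<sigma> rI < fst \<sigma> 2" unfolding \<sigma> using R(1)[of 2] R(6) R1(2) t by simp
    ultimately show ?thesis unfolding body by blast
  qed
  obtain \<sigma> where "iterate w rI 2 vertex_body N (R1, M1) \<sigma>" "inv N \<sigma>"
    using iterate_invariant[of inv "(R1, M1)" N rI 2 w vertex_body, OF init step] by blast
  then show ?thesis unfolding inv_def OQ_def same_below_def by (cases \<sigma>) (auto intro!: exI)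
qed

section \<open>Initialisation\<close>

definition init_code :: program where
  "init_code = cst rZ 0 ;; cst rOne 1 ;; cst rTwo 2 ;; cst rFour 4 ;; cst rSix 6 ;; cst rEight 8 ;;
     cst rPw 1 ;; cst rC 0 ;; cst rH 1"

text \<open>Builds the table of weights at the addresses \<open>len + i\<close>. Variables are
  numbered from 1, so address \<open>len\<close> itself is skipped.\<close>

definition pow_body :: program where
  "pow_body = ar Add rC rC rOne ;; ar Add rAd 1 rC ;; st rAd rPw ;; ar Add rPw rPw rPw"

text \<open>Counting in steps of two makes \<open>rH\<close> the power of two whose exponent is
  \<open>n / 2\<close> rounded up.\<close>

definition half_body :: program where
  "half_body = ar Add rH rH rH ;; ar Add rC rC rTwo"

text \<open>The memory holds, in this order, the encoding, the table of weights, the stack, the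
  template and the two curves. The frame of the root gate is made by hand with one missing child;
  popping it brings \<open>rSP\<close> down to \<open>rSB\<close>, which ends the parsing
  loop.\<close>

definition layout_code :: program where
  "layout_code = ar Add rSB 1 0 ;; ar Add rSB rSB rOne ;; ar Add rTB rSB 1 ;; ar Add rTB rTB rFour ;;
     ar Add rSP rSB rTwo ;; ar Add rIP rZ rZ ;; ar Add rTP rTB rZ ;; ar Add rLab rZ rZ ;;
     st rSP rOne ;; ar Add rAd rSP rOne ;; st rAd rTP ;; head_code"

text \<open>After parsing, \<open>rLab\<close> is twice the number of cells and serves as
  \<open>X\<close>. All cells except three at either end belong to the copied segment, hence the
  subtractions of 24 words and of 6 cells.\<close>

definition setup_code :: program where
  "setup_code = ar Mul rM rLab rLab ;; ar Mul rD rM rM ;; ar Add rD rD rD ;; cst rA 24 ;;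
     ar Add rSeg0 rTB rA ;; ar Sub rSeg1 rTP rA ;; ar Div rE rLab rTwo ;; ar Sub rE rE rSix ;;
     ar Mul rE rH rE ;; ar Add 2 rE rSix ;; ar Add 0 rTP rZ ;; ar Mul rE rFour 2 ;; ar Add 1 0 rE ;;
     ar Add rPO 0 rZ ;; ar Add rQO 1 rZ ;; ar Add rC rTB rZ ;; cst rX 0 ;; cst rXH 0 ;; cst rI 0"

definition reduction :: program where
  "reduction = init_code ;; WhileLess rC 0 pow_body ;; cst rC 0 ;; WhileLess rC 0 half_body ;;
     layout_code ;; WhileLess rSB rSP parse_body ;; setup_code ;; WhileLess rI 2 vertex_body"

lemma while_free_code [simp]:
  "while_free init_code" "while_free pow_body" "while_free half_body" "while_free layout_code"
  "while_free parse_body" "while_free setup_code" "while_free vertex_body"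
  by (simp_all add: init_code_def pow_body_def half_body_def layout_code_def parse_body_def
      token_code_def setup_code_def
      vertex_body_def head_code_def tail_code_def sep_code_def or_addresses_def emit_def load_cell_def
          put_p_def
      put_q_def next_cell_def parity_def put_vertex_def)

lemma sem_init:
  assumes "8 < (2::nat) ^ w"
  shows "\<exists>R'. sem w init_code (R, M) = (R', M) \<and> small_consts R' \<and> (\<forall>r<3. R' r = R r) \<and> R' rPw = 1 \<and> R'
      rC = 0 \<and> R' rH = 1"
proof -
  have "0 < w" using assms by (cases w) auto
  then show ?thesis using assms by (simp add: init_code_def small_consts_def)
qed

lemma pow_loop:
  assumes R: "small_consts R" "R 0 = n" "R 1 = len" "R rPw = 1" "R rC = 0" and w: "len + n < 2 ^ w"
      "(2::nat) ^ n < 2 ^ w"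
  shows "\<exists>R' M'. iterate w rC 0 pow_body n (R, M) (R', M') \<and> (\<forall>r. r \<notin> {rC, rAd, rPw} \<longrightarrow> R' r = R r) \<and> R'
      rC = n \<and>
    (\<forall>i. 1 \<le> i \<and> i \<le> n \<longrightarrow> M' (len + i) = 2 ^ (i - 1)) \<and> (\<forall>y\<le>len. M' y = M y)"
proof -
  define inv where "inv = (\<lambda>t (R' :: nat \<Rightarrow> nat, M'). (\<forall>r. r \<notin> {rC, rAd, rPw} \<longrightarrow> R' r = R r) \<and> R' rC = t \<and>
      R' rPw = 2 ^ t \<and>
    (\<forall>i. 1 \<le> i \<and> i \<le> t \<longrightarrow> M' (len + i) = 2 ^ (i - 1)) \<and> (\<forall>y\<le>len. M' y = M y))"
  have init: "inv 0 (R, M)" unfolding inv_def using R by simp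
  have step: "fst \<sigma> rC < fst \<sigma> 0 \<and> inv (Suc t) (sem w pow_body \<sigma>)" if t: "t < n" "inv t \<sigma>" for t \<sigma>
  proof -
    obtain R' M' where \<sigma>: "\<sigma> = (R', M')" by (cases \<sigma>)
    have R': "\<And>r. r \<notin> {rC, rAd, rPw} \<Longrightarrow> R' r = R r" "R' rC = t" "R' rPw = 2 ^ t"
      and M': "\<And>i. 1 \<le> i \<and> i \<le> t \<Longrightarrow> M' (len + i) = 2 ^ (i - 1)" "\<And>y. y \<le> len \<Longrightarrow> M' y = M y"
      using t(2) unfolding inv_def \<sigma> by auto
    \<comment> \<open>The last round still doubles \<open>rPw\<close>, although the table ends with
      \<open>2^(n-1)\<close>; this is why \<open>2^n\<close> has to fit into a word.\<close>
    have "(2::nat) ^ Suc t \<le> 2 ^ n" using t by (intro power_increasing) auto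
    moreover have "(2::nat) ^ t + 2 ^ t = 2 ^ Suc t" by simp
    ultimately have w2: "(2::nat) ^ t + 2 ^ t < 2 ^ w" using w(2) by linarith
    have ww: "t + 1 < 2 ^ w" "len + (t + 1) < 2 ^ w" using w t by auto
    have c: "R' rOne = 1" "R' 1 = len" "R' 0 = n" using R' R unfolding small_consts_def by auto
    have "sem w pow_body (R', M') = (R'(rC := t + 1, rAd := len + (t + 1), rPw := 2 ^ t + 2 ^ t), M'(len
        + (t + 1) := 2 ^ t))"
      using c R'(2,3) w2 ww by (simp add: pow_body_def)
    then show ?thesis unfolding \<sigma> inv_def using R' M' c t by (auto simp: le_Suc_eq)
  qed
  obtain \<sigma> where "iterate w rC 0 pow_body n (R, M) \<sigma>" "inv n \<sigma>"
    using iterate_invariant[of inv "(R, M)" n rC 0 w pow_body, OF init step] by blast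
  then show ?thesis unfolding inv_def by (cases \<sigma>) auto
qed

lemma half_loop:
  assumes R: "small_consts R" "R 0 = n" "R rH = 1" "R rC = 0" and w: "n + 2 < 2 ^ w" "(2::nat) ^ ((n +
      1) div 2) < 2 ^ w"
  shows "\<exists>R'. iterate w rC 0 half_body ((n + 1) div 2) (R, M) (R', M) \<and> (\<forall>r. r \<notin> {rC, rH} \<longrightarrow> R' r = R r) \<and>
    R' rC = 2 * ((n + 1) div 2) \<and> R' rH = 2 ^ ((n + 1) div 2)"
proof -
  define inv where "inv = (\<lambda>t (R' :: nat \<Rightarrow> nat, M'). M' = M \<and> (\<forall>r. r \<notin> {rC, rH} \<longrightarrow> R' r = R r) \<and> R' rC =
      2 * t \<and> R' rH = 2 ^ t)"
  have init: "inv 0 (R, M)" unfolding inv_def using R by simp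
  have step: "fst \<sigma> rC < fst \<sigma> 0 \<and> inv (Suc t) (sem w half_body \<sigma>)" if t: "t < (n + 1) div 2" "inv t \<sigma>"
      for t \<sigma>
  proof -
    obtain R' where \<sigma>: "\<sigma> = (R', M)" and R': "\<And>r. r \<notin> {rC, rH} \<Longrightarrow> R' r = R r" "R' rC = 2 * t" "R' rH = 2 ^ t"
      using t(2) unfolding inv_def by (cases \<sigma>) auto
    have "(2::nat) ^ Suc t \<le> 2 ^ ((n + 1) div 2)" using t by (intro power_increasing) auto
    moreover have "(2::nat) ^ t + 2 ^ t = 2 ^ Suc t" by simp
    ultimately have w2: "(2::nat) ^ t + 2 ^ t < 2 ^ w" using w(2) by linarith
    have c: "R' rTwo = 2" "R' 0 = n" using R' R unfolding small_consts_def by auto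
    have "2 * t < n" using t by linarith
    moreover have "sem w half_body (R', M) = (R'(rH := 2 ^ t + 2 ^ t, rC := 2 * t + 2), M)"
      using c R'(2,3) w2 w \<open>2 * t < n\<close> by (simp add: half_body_def)
    ultimately show ?thesis unfolding \<sigma> inv_def using R' c by auto
  qed
  obtain \<sigma> where "iterate w rC 0 half_body ((n + 1) div 2) (R, M) \<sigma>" "inv ((n + 1) div 2) \<sigma>"
    using iterate_invariant[of inv "(R, M)" "(n + 1) div 2" rC 0 w half_body, OF init step] by blast
  then show ?thesis unfolding inv_def by (cases \<sigma>) auto
qed

lemma sem_layout:
  assumes R: "small_consts R" "R 0 = n" "R 1 = len" and w: "2 * len + n + 40 < 2 ^ w"
  defines "SB \<equiv> len + n + 1" and "TB \<equiv> 2 * len + n + 5"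
  shows "\<exists>R' M'. sem w layout_code (R, M) = (R', M') \<and> small_consts R' \<and> R' 1 = len \<and> R' rH = R rH \<and>
    R' rSB = SB \<and> R' rTB = TB \<and> R' rSP = SB + 2 \<and> R' rIP = 0 \<and> R' rTP = TB + 24 \<and> R' rLab = 6 \<and>
    (\<forall>y\<le>len + n. M' y = M y) \<and> M' (SB + 2) = 1 \<and> M' (SB + 3) = TB \<and> M' TB = 0 \<and>
    (\<forall>hS hT. cells_stored (M'(TB + 6 := hS, TB + 7 := hT)) TB (TB + 24) TB
      [(0, 0, 0, 0, 0, 0), (5, hT, 4, hT, 0, 0), (5, hT, 4, 4, 0, 0)])"
proof -
  define R1 where "R1 = R(rSB := SB, rTB := TB, rSP := SB + 2, rIP := 0, rTP := TB, rLab := 0, rAd :=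
      Suc (SB + 2))"
  define M1 where "M1 = M(SB + 2 := 1, Suc (SB + 2) := TB)"
  have c1: "small_consts R1" using R unfolding small_consts_def R1_def by simp
  have e: "Suc (len + n) = SB" "SB + len + 4 = TB" unfolding SB_def TB_def by simp_all
  have ww: "len + n < 2 ^ w" "SB < 2 ^ w" "SB + len < 2 ^ w" "TB < 2 ^ w" "SB + 2 < 2 ^ w" "Suc (SB + 2)
      < 2 ^ w"
    using w unfolding SB_def TB_def by auto
  have "sem w layout_code (R, M) = sem w head_code (R1, M1)"
    using R ww unfolding layout_code_def R1_def M1_def small_consts_def by (simp add: e)
  moreover obtain R' M' where h: "sem w head_code (R1, M1) = (R', M')" "advance 3 R1 R'"
    "\<forall>y. y < TB \<or> TB + 24 \<le> y \<longrightarrow> M' y = M1 y" "M' TB = 0"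
    "\<forall>hS hT. cells_stored (M'(TB + 6 := hS, TB + 7 := hT)) TB (TB + 24) TB
      [(0, 0, 0, 0, 0, 0), (0+5, hT, 0+4, hT, 0, 0), (0+5, hT, 0+4, 0+4, 0, 0)]"
    using sem_head[OF c1, of TB w 0 M1] w unfolding R1_def TB_def by auto
  moreover have "small_consts R'" using c1 h(2) unfolding small_consts_def advance_def by simp
  ultimately show ?thesis using R unfolding advance_def R1_def M1_def by (auto simp: SB_def TB_def)
qed

lemma sem_setup:
  assumes R: "small_consts R" "R rLab = 2 * (8 + g)" "R rTP = TB + 8 * (8 + g)" "R rTB = TB" "R rH = H"
    and N: "N = 6 + H * (2 + g)" and X: "X = 2 * (8 + g)"
    and w: "TB + 8 * (8 + g) + 8 * N < 2 ^ w" "2 * (2 * (X * X * (X * X))) < 2 ^ w"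
  shows "\<exists>R'. sem w setup_code (R, M) = (R', M) \<and> small_consts R' \<and> R' 0 = TB + 8 * (8 + g) \<and>
    R' 1 = TB + 8 * (8 + g) + 4 * N \<and> R' 2 = N \<and> R' rH = H \<and> R' rSeg0 = TB + 24 \<and>
    R' rSeg1 = TB + 8 * (3 + (2 + g)) \<and> R' rM = X * X \<and> R' rD = 2 * (X * X * (X * X)) \<and> R' rC = TB \<and> R'
        rX = 0 \<and>
    R' rXH = 0 \<and> R' rI = 0 \<and> R' rPO = TB + 8 * (8 + g) \<and> R' rQO = TB + 8 * (8 + g) + 4 * N"
proof -
  have "X * X \<le> X * X * (X * X)" using X by simp
  then have ww: "X * X < 2 ^ w" "X * X * (X * X) < 2 ^ w" "X * X * (X * X) + X * X * (X * X) < 2 ^ w"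
      using w by linarith+
  have e: "(24::nat) < 2 ^ w" "H * (2 + g) < 2 ^ w" "H * (2 + g) + 6 < 2 ^ w" "4 * N < 2 ^ w" "TB + 24 <
      2 ^ w"
    "TB + 8 * (8 + g) < 2 ^ w" "TB + 8 * (8 + g) + 4 * N < 2 ^ w" "8 + g < 2 ^ w"
    using w N by auto
  have d: "2 * (8 + g) div 2 - 6 = 2 + g" "2 * (8 + g) div 2 = 8 + g" by simp_all
  show ?thesis
    using R X N ww e w unfolding setup_code_def small_consts_def by (simp add: d)
qed

section \<open>Running time and correctness of the reduction\<close>

lemma concat_blocks_nth:
  assumes "\<And>a. a < H \<Longrightarrow> length (g a) = m" "a < H" "u < m"
  shows "concat (map g [0..<H]) ! (a * m + u) = g a ! u" "length (concat (map g [0..<H])) = H * m"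
proof -
  have len: "(\<And>a. a < H \<Longrightarrow> length (g a) = m) \<Longrightarrow> length (concat (map g [0..<H])) = H * m" for H
    by (induction H) (simp_all add: add.commute)
  show "length (concat (map g [0..<H])) = H * m" using len assms(1) by blast
  show "concat (map g [0..<H]) ! (a * m + u) = g a ! u"
    using assms
  proof (induction H)
    case (Suc H)
    have l: "length (concat (map g [0..<H])) = H * m" using len Suc.prems(1) by simp
    show ?case
    proof (cases "a < H")
      case True
      then have "Suc a * m \<le> H * m" by (intro mult_le_mono1) simp
      then have "a * m + u < H * m" using Suc.prems(3) by simp
      then show ?thesis using Suc True l by (simp add: nth_append)
    next
      case False
      then have "a = H" using Suc.prems by simp
      then show ?thesis using l by (simp add: nth_append)
    qed
  qed simp
qed

text \<open>In the tail the cursor still carries the block number \<open>H - 1\<close>, while the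
  curves are defined with 0 there. Cells that are never shifted do not notice the
  difference.\<close>

lemma blocks_by_cursor:
  fixes f :: "nat \<Rightarrow> cell \<Rightarrow> nat \<times> nat"
  assumes len: "length us = 3" "length vs = m" "length ws = 3" and pos: "0 < m" "0 < H"
    and const: "\<And>c x. c \<in> set us \<union> set ws \<Longrightarrow> f x c = f 0 c"
  shows "map (f 0) us @ concat (map (\<lambda>a. map (f a) vs) [0..<H]) @ map (f 0) ws =
    map (\<lambda>t. (\<lambda>(i, x). f x ((us @ vs @ ws) ! i)) (cursor m H t)) [0..<6 + H * m]" (is "?l = ?r")
proof -
  let ?c = "concat (map (\<lambda>a. map (f a) vs) [0..<H])"
  have lc: "length ?c = H * m" using concat_blocks_nth(2)[of H "\<lambda>a. map (f a) vs" m 0 0] pos len by simp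
  show ?thesis
  proof (rule nth_equalityI)
    show "length ?l = length ?r" using len lc by simp
    fix t assume "t < length ?l"
    then have t: "t < 6 + H * m" using len lc by simp
    then show "?l ! t = ?r ! t"
    proof (cases rule: cursor_cases[OF t pos(2,1)])
      case 1
      then show ?thesis using len t by (simp add: nth_append)
    next
      case (2 a u)
      have "a * m + u < H * m"
      proof -
        have "Suc a * m \<le> H * m" using 2(1) by (intro mult_le_mono1) simp
        then show ?thesis using 2(2) by simp
      qed
      then have "?l ! t = ?c ! (a * m + u)" using 2(3) len lc by (simp add: nth_append)
      also have "\<dots> = f a (vs ! u)" using concat_blocks_nth(1)[of H "\<lambda>a. map (f a) vs" m a u] 2 len by simp
      finally show ?thesis using 2 t len by (simp add: nth_append)
    next
      case (3 v)
      then have "?l ! t = f 0 (ws ! v)" using len lc by (simp add: nth_append)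
      moreover have "f 0 (ws ! v) = f (H - 1) (ws ! v)" using const[of "ws ! v" "H - 1"] len 3(1) by simp
      ultimately show ?thesis using 3 t len by (simp add: nth_append)
    qed
  qed
qed

text \<open>\<open>Or [F]\<close> violates the condition on the fan-in and serves only as a list of
  cells. It makes the statements on parsing an OR gate applicable to the root.\<close>

lemma cells_of_root: "tmpl 0 (Or [F]) = (let (u, v, w) = big_cells F in u @ v @ w)"
  by (simp add: big_cells_def or_end_def numeral_eq_Suc)

lemma plabels_by_cursor:
  "plabels h F = map (\<lambda>t. (\<lambda>(i, x). plabel x (tmpl 0 (Or [F]) ! i)) (cursor (2 + glen F) (2 ^ h) t))
      [0..<6 + 2 ^ h * (2 + glen F)]"
  unfolding plabels_def cells_of_root big_cells_def Let_def split
  by (rule blocks_by_cursor) (auto simp: or_head_def or_sep_def or_tail_def leaf_def plabel_def)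

lemma qlabels_by_cursor:
  "qlabels h F = map (\<lambda>t. (\<lambda>(i, x). qlabel (x * 2 ^ h) (tmpl 0 (Or [F]) ! i)) (cursor (2 + glen F) (2 ^
      h) t)) [0..<6 + 2 ^ h * (2 + glen F)]"
proof -
  have "map (qlabel (0 * 2 ^ h)) us = map (qlabel 0) us" for us by simp
  moreover have "map (qlabel (0 * 2 ^ h)) (or_head 0 (5 + glen F)) @
    concat (map (\<lambda>a. map (qlabel (a * 2 ^ h)) (or_sep 0 (5 + glen F) @ tmpl 5 F)) [0..<2 ^ h]) @
    map (qlabel (0 * 2 ^ h)) (or_tail 0 (5 + glen F)) = map (\<lambda>t. (\<lambda>(i, x). qlabel (x * 2 ^ h)
      ((or_head 0 (5 + glen F) @ (or_sep 0 (5 + glen F) @ tmpl 5 F) @ or_tail 0 (5 + glen F)) ! i))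
      (cursor (2 + glen F) (2 ^ h) t)) [0..<6 + 2 ^ h * (2 + glen F)]"
    by (rule blocks_by_cursor[where f = "\<lambda>x. qlabel (x * 2 ^ h)"])
      (auto simp: or_head_def or_sep_def or_tail_def leaf_def qlabel_def)
  ultimately show ?thesis unfolding qlabels_def cells_of_root big_cells_def Let_def split by simp
qed

lemma cell_sign_le: "c \<in> set (tmpl p F) \<Longrightarrow> cell_sign c \<le> 1"
proof (induction F arbitrary: p)
  case (Lit b i)
  then show ?case by (simp add: cell_sign_def)
next
  case (And Fs)
  then obtain cs where cs: "cs \<in> set (kids 0 p Fs)" "c \<in> set cs" by auto
  from kids_cells[OF cs(1)] obtain q G where "G \<in> set Fs" "cs = tmpl q G" by blast
  then show ?case using And.IH cs(2) by blast
next
  case (Or Fs)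
  show ?case
  proof (cases "\<exists>cs\<in>set (kids 2 (p + 3) Fs). c \<in> set cs")
    case True
    then obtain cs where cs: "cs \<in> set (kids 2 (p + 3) Fs)" "c \<in> set cs" by auto
    from kids_cells[OF cs(1)] obtain q G where "G \<in> set Fs" "cs = tmpl q G" by blast
    then show ?thesis using Or.IH cs(2) by blast
  next
    case False
    then have "c \<in> set (or_head p (or_end p Fs)) \<union> set (or_sep p (or_end p Fs)) \<union> set (or_tail p (or_end
        p Fs))"
      using Or.prems by (auto split: if_splits)
    then show ?thesis by (auto simp: or_head_def or_sep_def or_tail_def leaf_def cell_sign_def)
  qed
qed

section \<open>Bounds on sizes and words\<close>

text \<open>The surplus \<open>a\<close> of every child is collected here; with at least two
  children, the surplus pays for the gate itself.\<close>

lemma sum_list_le_affine: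
  fixes a b :: nat
  assumes "\<forall>x\<in>set xs. f x + a \<le> b * g x"
  shows "sum_list (map f xs) + length xs * a \<le> b * sum_list (map g xs)"
  using assms by (induction xs) (auto simp: algebra_simps)

lemma length_encode_le: "formula_over n F \<Longrightarrow> length (encode F) + 2 \<le> 4 * glen F"
proof (induction F)
  case (And Fs)
  then have "sum_list (map (\<lambda>F. length (encode F)) Fs) + length Fs * 2 \<le> 4 * sum_list (map glen Fs)"
    by (intro sum_list_le_affine) auto
  then show ?case using And.prems by (simp add: length_concat comp_def)
next
  case (Or Fs)
  then have "sum_list (map (\<lambda>F. length (encode F)) Fs) + length Fs * 2 \<le> 4 * sum_list (map glen Fs)"
    by (intro sum_list_le_affine) auto
  moreover have "sum_list (map (\<lambda>F. 2 + glen F) Fs) = 2 * length Fs + sum_list (map glen Fs)"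
    by (induction Fs) auto
  ultimately show ?case using Or.prems by (simp add: length_concat comp_def)
qed simp

text \<open>An OR gate with \<open>k\<close> children adds \<open>6 + 2k\<close> cells. With surplus
  10 per child, the induction needs \<open>16 + 2k \<le> 10k\<close>, which is tight for
  \<open>k = 2\<close>. A literal then dictates the factor 11.\<close>

lemma glen_le_leaves: "formula_over n F \<Longrightarrow> glen F + 10 \<le> 11 * leaves F"
proof (induction F)
  case (And Fs)
  then have "sum_list (map glen Fs) + length Fs * 10 \<le> 11 * sum_list (map leaves Fs)"
    by (intro sum_list_le_affine) auto
  then show ?case using And.prems by simp
next
  case (Or Fs)
  then have "sum_list (map glen Fs) + length Fs * 10 \<le> 11 * sum_list (map leaves Fs)"
    by (intro sum_list_le_affine) auto
  moreover have "sum_list (map (\<lambda>F. 2 + glen F) Fs) = 2 * length Fs + sum_list (map glen Fs)"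
    by (induction Fs) auto
  ultimately show ?case using Or.prems by simp
qed simp

lemma num_vars_pos: "formula_over n F \<Longrightarrow> 1 \<le> n"
proof (induction F)
  case (And Fs)
  then obtain F Gs where "Fs = F # Gs" by (cases Fs) auto
  then show ?case using And.IH[of F] And.prems by simp
next
  case (Or Fs)
  then obtain F Gs where "Fs = F # Gs" by (cases Fs) auto
  then show ?case using Or.IH[of F] Or.prems by simp
qed auto

lemma length_encode_ge: "2 \<le> length (encode F)"
  by (cases F) auto

lemma length_le_concat_encode: "length Fs \<le> length (concat (map encode Fs))"
proof (induction Fs)
  case (Cons F Fs)
  then show ?case using length_encode_ge[of F] by simp
qed simp

lemma length_encode_member: "F \<in> set Fs \<Longrightarrow> length (encode F) \<le> length (concat (map encode Fs))"
  by (induction Fs) auto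

lemma encode_entries: "formula_over n F \<Longrightarrow> x \<in> set (encode F) \<Longrightarrow> x \<le> n + length (encode F) + 1"
proof (induction F)
  case (And Fs)
  consider "x = 2" | "x = length Fs" | F where "F \<in> set Fs" "x \<in> set (encode F)" using And.prems by auto
  then show ?case
  proof cases
    case 3
    then show ?thesis using And.IH[of F] And.prems length_encode_member[of F Fs] by auto
  qed (use length_le_concat_encode[of Fs] And.prems in auto)
next
  case (Or Fs)
  consider "x = 3" | "x = length Fs" | F where "F \<in> set Fs" "x \<in> set (encode F)" using Or.prems by auto
  then show ?case
  proof cases
    case 3
    then show ?thesis using Or.IH[of F] Or.prems length_encode_member[of F Fs] by auto
  qed (use length_le_concat_encode[of Fs] Or.prems in auto)
qed (auto split: if_splits)

text \<open>With \<open>B = 2N\<close> the fifth power of \<open>B\<close> dominates everything, the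
  critical term being \<open>4 X^4\<close> with \<open>X \<le> B\<close>. Moreover
  \<open>n \<le> N\<close>, as \<open>(n + 1) div 2\<close> is below the number \<open>H\<close> of
  blocks; so the loops over the variables fit into the time bound.\<close>

lemma word_bounds:
  fixes n g len N H X w :: nat
  assumes N: "N = 6 + H * (2 + g)" and H: "H = 2 ^ ((n + 1) div 2)" and n: "1 \<le> n" and g: "1 \<le> g"
    and len: "len + 2 \<le> 4 * g" and X: "X = 2 * (8 + g)" and w: "(2 * N) ^ 10 \<le> 2 ^ w"
  shows "2 * len + n + 5 + 8 * (8 + g) + 8 * N + 40 < 2 ^ w" "2 * (2 * (X * X * (X * X))) < 2 ^ w"
    "H * H + 1 < 2 ^ w" "(2::nat) ^ n < 2 ^ w" "H < 2 ^ w" "n \<le> N" "len + 1 \<le> 2 * N" "(n + 1) div 2 \<le> N"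
        "12 \<le> N"
proof -
  define B where "B = 2 * N"
  have h: "1 \<le> (n + 1) div 2" using n by linarith
  have "(2::nat) ^ 1 \<le> 2 ^ ((n + 1) div 2)" using h by (intro power_increasing) auto
  then have H2: "2 \<le> H" using H by simp
  have "2 * (2 + g) \<le> H * (2 + g)" using H2 by (intro mult_le_mono1)
  then have gN: "2 * g + 10 \<le> N" using N by simp
  have "H * 3 \<le> H * (2 + g)" using g by (intro mult_le_mono2) simp
  then have HN: "3 * H + 6 \<le> N" using N by simp
  have "(n + 1) div 2 < H" unfolding H by (rule less_exp)
  then show nN: "n \<le> N" "(n + 1) div 2 \<le> N" using HN by linarith+
  show "len + 1 \<le> 2 * N" using len gN by linarith
  show N12: "12 \<le> N" using gN g by linarith
  have "B ^ 5 < B ^ 10" using N12 unfolding B_def by (intro power_strict_increasing) auto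
  also have "B ^ 10 \<le> 2 ^ w" using w unfolding B_def .
  also have "B ^ 5 = B * B * (B * B) * B" by (simp add: eval_nat_numeral)
  finally have B5: "B * B * (B * B) * B < 2 ^ w" .
  have B4: "4 \<le> B" using N12 unfolding B_def by simp
  then have "B * B * 1 \<le> B * B * (B * B * B)" by (intro mult_le_mono2) simp
  then have B2: "B * B \<le> B * B * (B * B) * B" by (simp only: mult.assoc mult_1_right)
  have "48 * N \<le> B * B" using N12 mult_le_mono1[of 48 "4 * N" N] unfolding B_def by simp
  moreover have "2 * len + n + 5 + 8 * (8 + g) + 8 * N + 40 \<le> 24 * N" using len gN nN(1) N12 by (simp
      add: algebra_simps)
  ultimately show "2 * len + n + 5 + 8 * (8 + g) + 8 * N + 40 < 2 ^ w" using B2 B5 by linarith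
  have XB: "X \<le> B" using X gN unfolding B_def by simp
  have "X * X * (X * X) \<le> B * B * (B * B)" using XB by (intro mult_le_mono)
  from mult_le_mono[OF B4 this] have "4 * (X * X * (X * X)) \<le> B * (B * B * (B * B))" .
  also have "\<dots> = B * B * (B * B) * B" by (rule mult.commute)
  finally show "2 * (2 * (X * X * (X * X))) < 2 ^ w" using B5 by linarith
  have "H * H + 1 \<le> (H + 1) * (H + 1)" by simp
  also have "\<dots> \<le> B * B" using HN unfolding B_def by (intro mult_le_mono) auto
  finally show HH: "H * H + 1 < 2 ^ w" using B2 B5 by linarith
  have "(2::nat) ^ n \<le> 2 ^ ((n + 1) div 2 + (n + 1) div 2)" by (intro power_increasing) auto
  then have "2 ^ n \<le> H * H" unfolding H power_add .
  then show "(2::nat) ^ n < 2 ^ w" using HH by linarith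
  have "H \<le> H * H" by simp
  then show "H < 2 ^ w" using HH by linarith
qed

text \<open>The numerators are less than half of \<open>2^w\<close>, so reading them as signed
  numbers does not change them.\<close>

lemma stored_p:
  assumes "p_stored X M x lr" "valid_label X lr" "2 * (2 * (X * X * (X * X))) < 2 ^ w"
  shows "M (x + 1) \<noteq> 0 \<and> M (x + 3) \<noteq> 0 \<and> pvert X lr = (real_of_int (signed w (M x)) / real (M (x + 1)),
    real_of_int (signed w (M (x + 2))) / real (M (x + 3)))"
proof -
  obtain l r where lr: "lr = (l, r)" by (cases lr)
  have v: "l \<le> r" "r < X" using assms(2) unfolding lr valid_label_def by auto
  have X: "1 \<le> X" using v by simp
  have sq: "(r - l) * (r - l) \<le> X * X" using v by (intro mult_le_mono) auto
  define Y Z where "Y = X * X" and "Z = X * X * (X * X)"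
  have "X \<le> Y" "Y \<le> Z" unfolding Y_def Z_def using X by simp_all
  moreover have "4 * Z < 2 ^ w" "(r - l) * (r - l) \<le> Y" using assms(3) sq unfolding Y_def Z_def by simp_all
  ultimately have "2 * (l + r) < 2 ^ w" "2 * ((r - l) * (r - l)) < 2 ^ w"
    using v unfolding distrib_left by linarith+
  then show ?thesis using assms(1) X unfolding lr p_stored_def pvert_def signed_def by simp
qed

lemma stored_q:
  assumes "q_stored X M x lr" "valid_label X lr" "2 * (2 * (X * X * (X * X))) < 2 ^ w"
  shows "M (x + 1) \<noteq> 0 \<and> M (x + 3) \<noteq> 0 \<and> qvert X lr = (real_of_int (signed w (M x)) / real (M (x + 1)),
    real_of_int (signed w (M (x + 2))) / real (M (x + 3)))"
proof -
  obtain l r where lr: "lr = (l, r)" by (cases lr)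
  have v: "l \<le> r" "r < X" using assms(2) unfolding lr valid_label_def by auto
  have X: "1 \<le> X" using v by simp
  define Z where "Z = X * X * (X * X)"
  have "X * 1 \<le> X * (X * (X * X))" using X by (intro mult_le_mono2) simp
  then have "X \<le> Z" "4 * Z < 2 ^ w" unfolding Z_def using assms(3) by (simp_all add: mult.assoc)
  then have "2 * (l + r) < 2 ^ w" using v unfolding distrib_left by linarith
  moreover have "2 * (2 * (X * X * (X * X)) - 1 - (r - l) * (r - l)) < 2 ^ w" using assms(3) by linarith
  ultimately show ?thesis using assms(1) X unfolding lr q_stored_def qvert_def signed_def by simp
qed

text \<open>Parsing counts twice because it takes up to \<open>2N\<close> rounds. The 5 covers the
  final tests of the four loops and the instruction that resets \<open>rC\<close>.\<close>

definition time_factor :: nat where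
  "time_factor = cost init_code + (cost pow_body + 1) + (cost half_body + 1) + cost layout_code +
     2 * (cost parse_body + 1) + cost setup_code + (cost vertex_body + 1) + 5"

lemma reduction_exec:
  assumes F: "formula_over n F" and w: "(2 * (6 + 2 ^ ((n + 1) div 2) * (2 + glen F))) ^ 10 \<le> (2::nat) ^ w"
  defines "h \<equiv> (n + 1) div 2" and "N \<equiv> 6 + 2 ^ ((n + 1) div 2) * (2 + glen F)" and "X \<equiv> 2 * (8 + glen F)"
  shows "\<exists>t \<sigma>. exec w reduction (input_state w n F) t \<sigma> \<and> t \<le> time_factor * N \<and>
    output_curves w \<sigma> (map (pvert X) (plabels h F)) (map (qvert X) (qlabels h F))"
proof -
  define g H len where "g = glen F" and "H = (2::nat) ^ h" and "len = length (encode F)"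
  define TB where "TB = 2 * len + n + 5"
  define OP where "OP = TB + 8 * (8 + g)"
  let ?cells = "tmpl 0 (Or [F])"
  have NH: "N = 6 + H * (2 + g)" "X = 2 * (8 + g)" "H = 2 ^ ((n + 1) div 2)"
    unfolding N_def H_def h_def g_def X_def by simp_all
  have "1 \<le> n" "1 \<le> g" "len + 2 \<le> 4 * g" "(2 * N) ^ 10 \<le> 2 ^ w"
    using num_vars_pos[OF F] glen_pos[OF F] length_encode_le[OF F] w unfolding g_def len_def N_def by auto
  note wb = word_bounds[OF NH(1,3) this(1,2,3) NH(2) this(4)]
  obtain Ri Mi where input: "input_state w n F = (Ri, Mi)" "Ri 0 = n" "Ri 1 = len"
    and tok: "\<And>j. j < len \<Longrightarrow> Mi j = encode F ! j"
  proof -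
    have small: "n < 2 ^ w" "len < 2 ^ w" using wb(1) by linarith+
    have "encode F ! j < 2 ^ w" if "j < len" for j
      using encode_entries[OF F, of "encode F ! j"] that wb(1) unfolding len_def by auto
    then show thesis using that[of "fst (input_state w n F)" "snd (input_state w n F)"] small
      unfolding input_state_def len_def by simp
  qed
  have w8: "8 < (2::nat) ^ w" using wb(1) by linarith
  obtain R1 where 1: "sem w init_code (Ri, Mi) = (R1, Mi)" "small_consts R1" "\<And>r. r < 3 \<Longrightarrow> R1 r = Ri r"
      "R1 rPw = 1" "R1 rC = 0" "R1 rH = 1"
    using sem_init[OF w8, of Ri Mi] by blast
  have r1: "R1 0 = n" "R1 1 = len" using 1(3) input by simp_all
  have ln: "len + n < 2 ^ w" "n + 2 < 2 ^ w" using wb(1) by linarith+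
  obtain R2 M2 where 2: "iterate w rC 0 pow_body n (R1, Mi) (R2, M2)" "\<And>r. r \<notin> {rC, rAd, rPw} \<Longrightarrow> R2 r =
      R1 r" "R2 rC = n"
    "\<And>i. 1 \<le> i \<and> i \<le> n \<Longrightarrow> M2 (len + i) = 2 ^ (i - 1)" "\<And>y. y \<le> len \<Longrightarrow> M2 y = Mi y"
    using pow_loop[OF 1(2) r1 1(4,5) ln(1) wb(4), of Mi] by blast
  define R2' where "R2' = R2(rC := 0)"
  have c2: "small_consts R2'" using 1(2) 2(2) unfolding small_consts_def R2'_def by simp
  have r2: "R2' 0 = n" "R2' 1 = len" "R2' rH = 1" "R2' rC = 0" using 2(2) r1 1(6) unfolding R2'_def by
      simp_all
  have wh: "(2::nat) ^ ((n + 1) div 2) < 2 ^ w" using wb(5) NH(3) by simp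
  obtain R3 where 3: "iterate w rC 0 half_body h (R2', M2) (R3, M2)" "\<And>r. r \<notin> {rC, rH} \<Longrightarrow> R3 r = R2' r"
    "R3 rC = 2 * h" "R3 rH = H"
    using half_loop[OF c2 r2(1,3,4) ln(2) wh, of M2] unfolding h_def H_def by auto
  have c3: "small_consts R3" using c2 3(2) unfolding small_consts_def by simp
  have r3: "R3 0 = n" "R3 1 = len" using 3(2) r2 by simp_all
  have wl: "2 * len + n + 40 < 2 ^ w" using wb(1) by linarith
  obtain R4 M4 where 4: "sem w layout_code (R3, M2) = (R4, M4)" "small_consts R4" "R4 1 = len" "R4 rH = H"
    "R4 rSB = len + n + 1" "R4 rTB = TB" "R4 rSP = len + n + 1 + 2" "R4 rIP = 0" "R4 rTP = TB + 24" "R4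
        rLab = 6"
    "\<And>y. y \<le> len + n \<Longrightarrow> M4 y = M2 y" "M4 (len + n + 1 + 2) = 1" "M4 (len + n + 1 + 3) = TB" "M4 TB = 0"
    "\<forall>hS hT. cells_stored (M4(TB + 6 := hS, TB + 7 := hT)) TB (TB + 24) TB
      [(0, 0, 0, 0, 0, 0), (5, hT, 4, hT, 0, 0), (5, hT, 4, 4, 0, 0)]"
    using sem_layout[OF c3 r3 wl, of M2] 3(4) unfolding TB_def by auto
  define sp where "sp = len + n + 1 + 2"
  have "sp + 1 = len + n + 1 + 3" unfolding sp_def by simp
  then have sp: "M4 sp = 1" "M4 (sp + 1) = TB"
    using 4(13) unfolding sp_def[symmetric] 4(12)[folded sp_def] by simp_all
  have glenOr: "glen (Or [F]) = 8 + g" unfolding g_def by simp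
  have wp: "TB + 8 * (8 + g) + 32 < 2 ^ w" "2 * (8 + g) + 32 < 2 ^ w" using wb(1) unfolding TB_def by
      linarith+
  \<comment> \<open>The room for the stack is exact at the start: \<open>sp + 2 + len\<close> equals
    \<open>TB\<close>.\<close>
  have rd: "ready n len TB (8 + g) R4 R4 M4 sp 0 (0 + 3) (concat (map encode [F])) (sum_list (map (\<lambda>F. 2
      + glen F) [F]))"
    unfolding ready_def[OF 4(2,3) wp]
  proof (intro conjI)
    show "parse_regs R4 TB R4 sp 0 (0 + 3)" unfolding parse_regs_def sp_def using 4(7-10) by simp
    show "R4 rSB < sp" unfolding sp_def using 4(5) by simp
    show "\<forall>j<length (concat (map encode [F])). M4 (0 + j) = concat (map encode [F]) ! j"
      using 4(11) 2(5) tok unfolding len_def by simp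
    show "\<forall>i. 1 \<le> i \<and> i \<le> n \<longrightarrow> M4 (len + i) = 2 ^ (i - 1)" using 4(11) 2(4) by simp
    show "M4 (sp + 1) = 0 \<or> TB \<le> M4 (sp + 1) \<and> M4 (sp + 1) + 8 \<le> TB + 8 * (0 + 3) \<and> M4 (M4 (sp + 1)) \<le> 2
        * (0 + 3)"
      unfolding sp(2) using 4(14) by simp
    show "M4 sp \<le> 8 + g" unfolding sp(1) by simp
  qed (simp_all add: len_def sp_def g_def TB_def)
  have "\<exists>k R' M'. k \<le> length (concat (map encode [F])) + 1 \<and> iterate w rSB rSP parse_body k (R4, M4)
      (R', M') \<and>
    parse_regs R4 TB R' (sp - 2) (0 + length (concat (map encode [F]))) (0 + glen (Or [F])) \<and>
    (\<forall>y<TB + 8 * 0. y \<noteq> sp \<longrightarrow> \<not> (sp + 2 \<le> y \<and> y < TB) \<longrightarrow> M' y = M4 y) \<and>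
    cells_stored M' (TB + 8 * 0) (TB + 8 * (0 + glen (Or [F]))) (TB + 8 * 0) (tmpl 0 (Or [F]))"
  proof (rule parse_or_block[OF 4(2,3) wp _ _ _ rd])
    show "\<forall>F\<in>set [F]. parses w n len TB (8 + g) R4 F" using parses_formula[OF 4(2,3) wp F] by simp
    show "\<forall>hS hT. cells_stored (M4(TB + 8 * 0 + 6 := hS, TB + 8 * 0 + 7 := hT)) (TB + 8 * 0) (TB + 8 * 0
        + 24) (TB + 8 * 0)
      [(2*0, 2*0, 2*0, 2*0, 0, 0), (2*0+5, hT, 2*0+4, hT, 0, 0), (2*0+5, hT, 2*0+4, 2*0+4, 0, 0)]"
      using 4(15) by simp
    show "M4 sp = length [F]" "M4 (sp + 1) = TB + 8 * 0" "M4 (TB + 8 * 0) = 2 * 0" using sp 4(14) by simp_all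
    show "2 \<le> sp" unfolding sp_def by simp
    show "0 + glen (Or [F]) \<le> 8 + g" unfolding glenOr by simp
  qed simp_all
  then obtain k R5 M5 where 5: "k \<le> len + 1" "iterate w rSB rSP parse_body k (R4, M4) (R5, M5)"
    "parse_regs R4 TB R5 (sp - 2) len (8 + g)" "cells_stored M5 TB OP TB ?cells"
    unfolding glenOr by (auto simp: len_def OP_def simp del: tmpl.simps)
  have c5: "small_consts R5" using parse_regs_consts[OF 5(3) 4(2)] .
  have r5: "R5 rLab = 2 * (8 + g)" "R5 rTP = TB + 8 * (8 + g)" "R5 rTB = TB" "R5 rH = H" "R5 rSB = len +
      n + 1" "R5 rSP = len + n + 1"
    using 5(3) 4(4,5,6) unfolding parse_regs_def sp_def by auto
  have ws: "TB + 8 * (8 + g) + 8 * N < 2 ^ w" "OP + 8 * N + 8 < 2 ^ w" using wb(1) unfolding TB_def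
      OP_def by linarith+
  obtain R6 where 6: "sem w setup_code (R5, M5) = (R6, M5)" "small_consts R6" "R6 0 = OP" "R6 1 = OP + 4
      * N" "R6 2 = N"
    "R6 rH = H" "R6 rSeg0 = TB + 24" "R6 rSeg1 = TB + 8 * (3 + (2 + g))" "R6 rM = X * X" "R6 rD = 2 * (X
        * X * (X * X))"
    "R6 rC = TB" "R6 rX = 0" "R6 rXH = 0" "R6 rI = 0" "R6 rPO = OP" "R6 rQO = OP + 4 * N"
    using sem_setup[OF c5 r5(1-4) NH(1,2) ws(1) wb(2), of M5] unfolding OP_def by blast
  have "length ?cells = 8 + g" unfolding length_tmpl glenOr ..
  then have lc: "length ?cells = 6 + (2 + g)" by simp
  note G = labels_gadget[OF F, of h]
  have "n \<le> 2 * h" unfolding h_def by linarith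
  then have conf: "confined 0 (8 + g) (plabels h F)" "confined 0 (8 + g) (qlabels h F)"
    using G unfolding is_gadget_def g_def by auto
  have pl: "plabels h F = map (\<lambda>t. (\<lambda>(i, x). plabel x (?cells ! i)) (cursor (2 + g) H t)) [0..<N]"
    using plabels_by_cursor[of h F] unfolding NH(1) H_def g_def by (simp del: tmpl.simps)
  have ql: "qlabels h F = map (\<lambda>t. (\<lambda>(i, x). qlabel (x * H) (?cells ! i)) (cursor (2 + g) H t)) [0..<N]"
    using qlabels_by_cursor[of h F] unfolding NH(1) H_def g_def by (simp del: tmpl.simps)
  have lenPQ: "length (plabels h F) = N" "length (qlabels h F) = N" unfolding pl ql by simp_all
  have valid: "valid_label X (plabels h F ! t)" "valid_label X (qlabels h F ! t)" if "t < N" for t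
    using conf nth_mem[of t "plabels h F"] nth_mem[of t "qlabels h F"] lenPQ that
    unfolding confined_def valid_label_def NH(2) by auto
  have nth: "plabels h F ! t = (\<lambda>(i, x). plabel x (?cells ! i)) (cursor (2 + g) H t)"
    "qlabels h F ! t = (\<lambda>(i, x). qlabel (x * H) (?cells ! i)) (cursor (2 + g) H t)" if "t < N" for t
    using that unfolding pl ql by simp_all
  have lab: "valid_label X (plabel x (?cells ! i)) \<and> valid_label X (qlabel (x * H) (?cells ! i))"
    if "t < N" "cursor (2 + g) H t = (i, x)" for t i x
    using valid[OF that(1)] nth[OF that(1)] that(2) by simp
  have Hpos: "0 < H" "0 < 2 + g" unfolding H_def by simp_all
  have OP': "TB + 8 * (6 + (2 + g)) = OP" unfolding OP_def by simp
  have "\<exists>R M. iterate w rI 2 vertex_body N (R6, M5) (R, M) \<and> (\<forall>r\<le>2. R r = R6 r) \<and> R rI = N \<and>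
    (\<forall>t<N. p_stored X M (OP + 4 * t) ((\<lambda>(i, x). plabel x (?cells ! i)) (cursor (2 + g) H t)) \<and>
      q_stored X M (OP + 4 * N + 4 * t) ((\<lambda>(i, x). qlabel (x * H) (?cells ! i)) (cursor (2 + g) H t)))"
  proof (rule emit_vertices[where H = H and m = "2 + g" and X = X and TB = TB and cells = ?cells and w = w,
        unfolded NH(1)[symmetric] OP', OF 6(2,5-16) 5(4) lc _ Hpos _ ws(2) wb(2,3)])
    show "cell_sign c \<le> 1" if "c \<in> set ?cells" for c using that by (rule cell_sign_le)
    show "valid_label X (plabel x (?cells ! i)) \<and> valid_label X (qlabel (x * H) (?cells ! i))"
      if "t < N" "cursor (2 + g) H t = (i, x)" for t i x using that by (rule lab)
  qed
  then obtain R7 M7 where 7: "iterate w rI 2 vertex_body N (R6, M5) (R7, M7)" "\<forall>r\<le>2. R7 r = R6 r" "R7 rI = N"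
    "\<forall>t<N. p_stored X M7 (OP + 4 * t) ((\<lambda>(i, x). plabel x (?cells ! i)) (cursor (2 + g) H t)) \<and>
      q_stored X M7 (OP + 4 * N + 4 * t) ((\<lambda>(i, x). qlabel (x * H) (?cells ! i)) (cursor (2 + g) H t))"
    by blast
  have r7: "R7 0 = OP" "R7 1 = OP + 4 * N" "R7 2 = N" using 7(2) 6(3-5) by simp_all
  have "output_curves w (R7, M7) (map (pvert X) (plabels h F)) (map (qvert X) (qlabels h F))"
    unfolding output_curves_def stored_curve_def fst_conv snd_conv r7 length_map lenPQ
  proof (intro conjI allI impI refl)
    fix t assume t: "t < N"
    have st: "p_stored X M7 (OP + 4 * t) (plabels h F ! t)" "q_stored X M7 (OP + 4 * N + 4 * t) (qlabels
        h F ! t)"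
      using 7(4) t unfolding nth[OF t] by blast+
    note sp = stored_p[OF st(1) valid(1)[OF t] wb(2)] and sq = stored_q[OF st(2) valid(2)[OF t] wb(2)]
    have nthPQ: "map (pvert X) (plabels h F) ! t = pvert X (plabels h F ! t)"
      "map (qvert X) (qlabels h F) ! t = qvert X (qlabels h F ! t)" using t lenPQ by simp_all
    show "M7 (OP + 4 * t + 1) \<noteq> 0" "M7 (OP + 4 * t + 3) \<noteq> 0"
      "map (pvert X) (plabels h F) ! t = (real_of_int (signed w (M7 (OP + 4 * t))) / real (M7 (OP + 4 *
          t + 1)),
        real_of_int (signed w (M7 (OP + 4 * t + 2))) / real (M7 (OP + 4 * t + 3)))"
      using sp unfolding nthPQ by blast+
    show "M7 (OP + 4 * N + 4 * t + 1) \<noteq> 0" "M7 (OP + 4 * N + 4 * t + 3) \<noteq> 0"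
      "map (qvert X) (qlabels h F) ! t = (real_of_int (signed w (M7 (OP + 4 * N + 4 * t))) / real (M7
          (OP + 4 * N + 4 * t + 1)),
        real_of_int (signed w (M7 (OP + 4 * N + 4 * t + 2))) / real (M7 (OP + 4 * N + 4 * t + 3)))"
      using sq unfolding nthPQ by blast+
  qed
  moreover have "\<exists>t\<le>time_factor * N. exec w reduction (Ri, Mi) t (R7, M7)"
  proof -
    obtain t1 where t1: "t1 \<le> cost init_code" "exec w init_code (Ri, Mi) t1 (R1, Mi)"
      using exec_while_free[of init_code w "(Ri, Mi)"] 1(1) by auto
    obtain t2 where t2: "t2 \<le> n * (cost pow_body + 1) + 1" "exec w (WhileLess rC 0 pow_body) (R1, Mi) t2
        (R2, M2)"
      using exec_while[OF _ 2(1)] 2(2,3) r1 by auto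
    have t3: "exec w (cst rC 0) (R2, M2) 1 (R2', M2)" using exec.Instr[of w "Const rC 0" "(R2, M2)"]
        unfolding R2'_def by simp
    obtain t4 where t4: "t4 \<le> h * (cost half_body + 1) + 1" "exec w (WhileLess rC 0 half_body) (R2', M2)
        t4 (R3, M2)"
      using exec_while[OF _ 3(1)] 3(3) r3 \<open>n \<le> 2 * h\<close> by auto
    obtain t5 where t5: "t5 \<le> cost layout_code" "exec w layout_code (R3, M2) t5 (R4, M4)"
      using exec_while_free[of layout_code w "(R3, M2)"] 4(1) by auto
    obtain t6 where t6: "t6 \<le> k * (cost parse_body + 1) + 1" "exec w (WhileLess rSB rSP parse_body) (R4,
        M4) t6 (R5, M5)"
      using exec_while[OF _ 5(2)] r5 by auto
    obtain t7 where t7: "t7 \<le> cost setup_code" "exec w setup_code (R5, M5) t7 (R6, M5)"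
      using exec_while_free[of setup_code w "(R5, M5)"] 6(1) by auto
    obtain t8 where t8: "t8 \<le> N * (cost vertex_body + 1) + 1" "exec w (WhileLess rI 2 vertex_body) (R6,
        M5) t8 (R7, M7)"
      using exec_while[OF _ 7(1)] 7(3) r7 by auto
    let ?t = "t1 + (t2 + (1 + (t4 + (t5 + (t6 + (t7 + t8))))))"
    have "exec w reduction (Ri, Mi) ?t (R7, M7)"
      unfolding reduction_def 
      by (rule exec.Seq[OF t1(2) exec.Seq[OF t2(2) exec.Seq[OF t3 exec.Seq[OF t4(2) exec.Seq[OF t5(2)
          exec.Seq[OF t6(2) exec.Seq[OF t7(2) t8(2)]]]]]]])
    moreover have "?t \<le> time_factor * N"
    proof -
      have N1: "1 \<le> N" using wb(9) by linarith
      have "n * (cost pow_body + 1) \<le> N * (cost pow_body + 1)" using wb(6) by (rule mult_le_mono1)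
      moreover have "h * (cost half_body + 1) \<le> N * (cost half_body + 1)" using wb(8) unfolding h_def by
          (rule mult_le_mono1)
      moreover have "k * (cost parse_body + 1) \<le> 2 * N * (cost parse_body + 1)"
        using 5(1) wb(7) by (intro mult_le_mono1) linarith
      moreover have "cost init_code * 1 \<le> cost init_code * N" "cost layout_code * 1 \<le> cost layout_code * N"
        "cost setup_code * 1 \<le> cost setup_code * N" using N1 by (intro mult_le_mono2; simp)+
      ultimately have "?t \<le> cost init_code * N + (N * (cost pow_body + 1) + 1) + 1 + (N * (cost
          half_body + 1) + 1) +
        cost layout_code * N + (2 * N * (cost parse_body + 1) + 1) + cost setup_code * N + (N * (cost
            vertex_body + 1) + 1)"
        using t1(1) t2(1) t4(1) t5(1) t6(1) t7(1) t8(1) by linarith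
      also have "\<dots> \<le> time_factor * N" unfolding time_factor_def using N1 by (simp add: algebra_simps)
      finally show ?thesis .
    qed
    ultimately show ?thesis by blast
  qed
  ultimately show ?thesis unfolding input(1) by blast
qed

theorem theorem1p3:
  shows "\<exists>(p :: program) (K :: real) (C :: real) (D :: real). \<forall>(n :: nat) (F :: formula).
    formula_over n F \<longrightarrow>
      (\<exists>(P :: curve) (Q :: curve) (N :: nat).
         N \<ge> 1 \<and> length P = N \<and> length Q = N \<and>
         real N \<le> C * (2 powr (real n / 2) * real (leaves F)) \<and>
         set P \<subseteq> \<rat> \<times> \<rat> \<and> set Q \<subseteq> \<rat> \<times> \<rat> \<and>
         (frechet_dist P Q \<le> 1 \<longleftrightarrow> satisfiable F) \<and>
         computes_curves K p n F P Q (D * real N))"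
proof (intro exI allI impI)
  fix n F assume F: "formula_over n F"
  define h N X where "h = (n + 1) div 2" and "N = 6 + 2 ^ h * (2 + glen F)" and "X = 2 * (8 + glen F)"
  let ?P = "map (pvert X) (plabels h F)" and ?Q = "map (qvert X) (qlabels h F)"
  have len: "length ?P = N" "length ?Q = N"
    unfolding plabels_by_cursor qlabels_by_cursor N_def by simp_all
  \<comment> \<open>The constant is \<open>2 * 11\<close>: 11 bounds the cells per leaf including
    those of the root, and 2 pays for rounding \<open>n / 2\<close> up to \<open>h\<close>.\<close>
  have "real N \<le> 22 * (2 powr (real n / 2) * real (leaves F))"
  proof -
    have "glen F + 10 \<le> 11 * leaves F" by (rule glen_le_leaves[OF F])
    have "6 \<le> 2 ^ h * (6::nat)" by simp
    then have "N \<le> 2 ^ h * (8 + glen F)" unfolding N_def by (simp add: algebra_simps)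
    also have "\<dots> \<le> 2 ^ h * (11 * leaves F)" using \<open>glen F + 10 \<le> 11 * leaves F\<close> by (intro mult_le_mono2) simp
    finally have "N \<le> 2 ^ h * (11 * leaves F)" .
    then have "real N \<le> real (2 ^ h * (11 * leaves F))" by (rule of_nat_mono)
    also have "\<dots> = 2 ^ h * (11 * real (leaves F))" by simp
    also have "(2::real) ^ h = 2 powr real h" by (simp add: powr_realpow)
    also have "2 powr real h * (11 * real (leaves F)) \<le> (2 * 2 powr (real n / 2)) * (11 * real (leaves F))"
    proof (rule mult_right_mono)
      have "real h \<le> 1 + real n / 2" unfolding h_def by linarith
      then have "2 powr real h \<le> 2 powr (1 + real n / 2)" by simp
      then show "2 powr real h \<le> 2 * 2 powr (real n / 2)" by (simp add: powr_add)
    qed simp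
    finally show ?thesis by simp
  qed
  moreover have "set ?P \<subseteq> \<rat> \<times> \<rat>" "set ?Q \<subseteq> \<rat> \<times> \<rat>"
    unfolding pvert_def qvert_def by (auto simp del: of_nat_add of_nat_mult intro!: Rats_divide Rats_of_nat)
  moreover have "frechet_dist ?P ?Q \<le> 1 \<longleftrightarrow> satisfiable F"
    unfolding X_def by (rule frechet_labels[OF F]) (auto simp: h_def)
  \<comment> \<open>The word bounds were derived from \<open>(2N)^10 \<le> 2^w\<close>, that is
    \<open>w\<close> at least \<open>10 * (1 + log 2 N)\<close>; this gives the constant 10.\<close>
  moreover have "computes_curves 10 reduction n F ?P ?Q (real time_factor * real N)"
    unfolding computes_curves_def len
  proof (intro allI impI)
    fix w assume w: "10 * (1 + log 2 (real N)) \<le> real w"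
    have "0 < N" unfolding N_def by simp
    then have N0: "0 < real N" by simp
    have "1 + log 2 (real N) = log 2 (real (2 * N))" using N0 by (simp add: log_mult)
    moreover have "log 2 (real (2 * N) ^ 10) = real 10 * log 2 (real (2 * N))"
      by (rule log_nat_power) (use N0 in simp)
    ultimately have "log 2 (real (2 * N) ^ 10) \<le> real w" using w by (simp only: of_nat_numeral)
    then have "real (2 * N) ^ 10 \<le> 2 powr real w" using N0 by (subst (asm) log_le_iff) auto
    then have "real ((2 * N) ^ 10) \<le> real (2 ^ w)" by (simp add: powr_realpow)
    then have "(2 * N) ^ 10 \<le> 2 ^ w" by (simp only: of_nat_le_iff)
    from reduction_exec[OF F this[unfolded N_def h_def]] obtain t \<sigma> where
      t: "exec w reduction (input_state w n F) t \<sigma>" "t \<le> time_factor * N" "output_curves w \<sigma> ?P ?Q"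
      unfolding N_def h_def X_def by blast
    have "real t \<le> real (time_factor * N)" using t(2) by (rule of_nat_mono)
    then have "real t \<le> real time_factor * real N" by simp
    with t(1,3) show "\<exists>t \<sigma>. exec w reduction (input_state w n F) t \<sigma> \<and> real t \<le> real time_factor * real
        N \<and> output_curves w \<sigma> ?P ?Q"
      by blast
  qed
  moreover have "1 \<le> N" unfolding N_def by simp
  ultimately show "1 \<le> N \<and> length ?P = N \<and> length ?Q = N \<and> real N \<le> 22 * (2 powr (real n / 2) * real
      (leaves F)) \<and>
      set ?P \<subseteq> \<rat> \<times> \<rat> \<and> set ?Q \<subseteq> \<rat> \<times> \<rat> \<and> (frechet_dist ?P ?Q \<le> 1 \<longleftrightarrow> satisfiable F) \<and>
      computes_curves 10 reduction n F ?P ?Q (real time_factor * real N)"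
    using len by blast
qed

end
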